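(* Let $(\mathcal C,\mathcal D)$ be a regular inclusion. Then the following statements are equivalent: (a) $\mathcal D$ has the extension property in $\mathcal C$; (b) $\mathcal D$ is a MASA in $\mathcal C$ and the action $v\mapsto\beta_v$ of the $*$-semigroup $\mathcal N(\mathcal C,\mathcal D)$ is a quasi-free action on $\hat{\mathcal D}$; (c) $\mathcal D$ is a MASA in $\mathcal C$ and for each $\sigma\in\hat{\mathcal D}$, the isotropy group of the Weyl groupoid $\mathcal W\mathcal G(\mathcal C,\mathcal D)$ at $\sigma$ is the trivial group.
   Context: All $C^*$-algebras are unital. An inclusion is a pair $(\mathcal C,\mathcal D)$ where $\mathcal C$ is a unital $C^*$-algebra and $\mathcal D\subseteq\mathcal C$ is an abelian $C^*$-subalgebra containing the unit of $\mathcal C$. Its normalizers are $\mathcal N(\mathcal C,\mathcal D)=\{v\in\mathcal C: v^*\mathcal Dv\cup v\mathcal Dv^*\subseteq\mathcal D\}$ (a $*$-semigroup under multiplication). The inclusion is regular if $\operatorname{span}\mathcal N(\mathcal C,\mathcal D)$ is norm dense in $\mathcal C$. MASA means maximal abelian $C^*$-subalgebra. $\mathcal D$ has the extension property in $\mathcal C$ if every pure state of $\mathcal D$ has a unique extension to a state on $\mathcal C$ and no pure state of $\mathcal C$ annihilates $\mathcal D$. $\hat{\mathcal D}$ is the space of characters of $\mathcal D$ (weak-$*$ topology). A partial homeomorphism of a topological space $X$ is a homeomorphism between two open subsets of $X$; these form an inverse semigroup $\mathrm{Inv}_{\mathcal O}(X)$. Each $v\in\mathcal N(\mathcal C,\mathcal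 D)$ determines a partial homeomorphism $\beta_v:\{\rho\in\hat{\mathcal D}:\rho(v^*v)>0\}\to\{\rho\in\hat{\mathcal D}:\rho(vv^* )>0\}$, $\beta_v(\rho)(d)=\rho(v^*dv)/\rho(v^*v)$, and $v\mapsto\beta_v$ is a $*$-semigroup homomorphism into $\mathrm{Inv}_{\mathcal O}(\hat{\mathcal D})$ (with $\beta_{v^*}=\beta_v^{-1}$). An action $\alpha:\mathcal S\to\mathrm{Inv}_{\mathcal O}(X)$ of a $*$-semigroup is quasi-free if for every $s\in\mathcal S$ the set $\{x\in\operatorname{dom}(\alpha(s)):\alpha(s)(x)=x\}$ is open in $X$. The Weyl groupoid $\mathcal W\mathcal G(\mathcal C,\mathcal D)$ is the groupoid of germs of $\{\beta_v:v\in\mathcal N(\mathcal C,\mathcal D)\}$: its elements are classes $[x,\phi,y]$ with $\phi=\beta_v$ for some $v$, $y\in\operatorname{dom}\phi$, $x=\phi(y)$, where $[x,\phi,y]=[x_1,\phi_1,y_1]$ iff $y=y_1$ and $\phi,\phi_1$ agree on a neighbourhood of $y$; product $[w,\phi,x][x,\psi,z]=[w,\phi\psi,z]$, inverse $[x,\phi,y]^{-1}=[y,\phi^{-1},x]$, range $x$, source $y$. The isotropy group at $\sigma$ is the group of elements with range and source $\sigma$. *)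

theory Defs
  imports
    "HOL-Analysis.Analysis"
    "HOL-Algebra.Elementary_Groups"
    "HOL-Library.Complex_Order"
begin

section \<open>Unital C*-algebras\<close>

text \<open>A type of this class is a unital C*-algebra. As a ring of class \<^class>\<open>real_normed_algebra_1\<close>
  it is nonzero.\<close>

class cstar_algebra = real_normed_algebra_1 + banach +
  fixes scaleC :: "complex \<Rightarrow> 'a \<Rightarrow> 'a"
    and star :: "'a \<Rightarrow> 'a"
  assumes scaleC_add_right: "scaleC c (x + y) = scaleC c x + scaleC c y"
    and scaleC_add_left: "scaleC (c + d) x = scaleC c x + scaleC d x"
    and scaleC_scaleC: "scaleC c (scaleC d x) = scaleC (c * d) x"
    and scaleC_one: "scaleC 1 x = x"
    and scaleR_eq_scaleC: "scaleR r x = scaleC (complex_of_real r) x"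
    and norm_scaleC: "norm (scaleC c x) = cmod c * norm x"
    and scaleC_mult_left: "scaleC c x * y = scaleC c (x * y)"
    and scaleC_mult_right: "x * scaleC c y = scaleC c (x * y)"
    and star_add: "star (x + y) = star x + star y"
    and star_scaleC: "star (scaleC c x) = scaleC (cnj c) (star x)"
    and star_mult: "star (x * y) = star y * star x"
    and star_star: "star (star x) = x"
    and cstar_identity: "norm (star x * x) = (norm x)\<^sup>2"

definition cspan :: "'a::cstar_algebra set \<Rightarrow> 'a set" where
  "cspan = Modules.module.span scaleC"

definition cstar_subalgebra :: "'a::cstar_algebra set \<Rightarrow> bool" where
  "cstar_subalgebra A \<longleftrightarrow>
     0 \<in> A \<and>
     (\<forall>x\<in>A. \<forall>y\<in>A. x + y \<in> A) \<and>
     (\<forall>c. \<forall>x\<in>A. scaleC c x \<in> A) \<and>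
     (\<forall>x\<in>A. \<forall>y\<in>A. x * y \<in> A) \<and>
     (\<forall>x\<in>A. star x \<in> A) \<and>
     closed A"

definition abelian_cstar_subalgebra :: "'a::cstar_algebra set \<Rightarrow> bool" where
  "abelian_cstar_subalgebra A \<longleftrightarrow>
     cstar_subalgebra A \<and> (\<forall>x\<in>A. \<forall>y\<in>A. x * y = y * x)"

section \<open>Inclusions\<close>

text \<open>The ambient algebra \<open>\<C>\<close> is the whole type.\<close>

definition inclusion :: "'a::cstar_algebra set \<Rightarrow> bool" where
  "inclusion D \<longleftrightarrow> abelian_cstar_subalgebra D \<and> 1 \<in> D"

definition normalizers :: "'a::cstar_algebra set \<Rightarrow> 'a set" where
  "normalizers D = {v. (\<forall>d\<in>D. star v * d * v \<in> D) \<and> (\<forall>d\<in>D. v * d * star v \<in> D)}"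

definition regular_inclusion :: "'a::cstar_algebra set \<Rightarrow> bool" where
  "regular_inclusion D \<longleftrightarrow> inclusion D \<and> closure (cspan (normalizers D)) = UNIV"

definition is_MASA :: "'a::cstar_algebra set \<Rightarrow> bool" where
  "is_MASA D \<longleftrightarrow>
     abelian_cstar_subalgebra D \<and>
     (\<forall>E. abelian_cstar_subalgebra E \<and> D \<subseteq> E \<longrightarrow> E = D)"

section \<open>States and characters\<close>

text \<open>A functional on a subset \<open>A\<close> of the type is a function that is
  \<^const>\<open>extensional\<close> on \<open>A\<close>, so that functionals are equal iff they agree on \<open>A\<close>.\<close>

definition functionals :: "'a::cstar_algebra set \<Rightarrow> ('a \<Rightarrow> complex) set" where
  "functionals A = {f \<in> extensional A.
     (\<forall>x\<in>A. \<forall>y\<in>A. f (x + y) = f x + f y) \<and>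
     (\<forall>c. \<forall>x\<in>A. f (scaleC c x) = c * f x)}"

text \<open>The order on \<^typ>\<open>complex\<close> is that of \<^theory>\<open>HOL-Library.Complex_Order\<close>:
  \<open>0 \<le> z\<close> means that \<open>z\<close> is real and nonnegative.\<close>

definition states :: "'a::cstar_algebra set \<Rightarrow> ('a \<Rightarrow> complex) set" where
  "states A = {f \<in> functionals A. (\<forall>x\<in>A. 0 \<le> f (star x * x)) \<and> f 1 = 1}"

text \<open>Pure states are the extreme points of the convex set of states.\<close>

definition pure_states :: "'a::cstar_algebra set \<Rightarrow> ('a \<Rightarrow> complex) set" where
  "pure_states A = {f \<in> states A.
     \<forall>g\<in>states A. \<forall>h\<in>states A. \<forall>t::real. 0 < t \<and> t < 1 \<and>
       (\<forall>x\<in>A. f x = complex_of_real t * g x + complex_of_real (1 - t) * h x)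
       \<longrightarrow> g = f \<and> h = f}"

definition extension_property :: "'a::cstar_algebra set \<Rightarrow> bool" where
  "extension_property D \<longleftrightarrow>
     (\<forall>f\<in>pure_states D. \<exists>!g. g \<in> states UNIV \<and> (\<forall>d\<in>D. g d = f d)) \<and>
     (\<forall>g\<in>pure_states UNIV. \<not> (\<forall>d\<in>D. g d = 0))"

definition characters :: "'a::cstar_algebra set \<Rightarrow> ('a \<Rightarrow> complex) set" where
  "characters D = {f \<in> functionals D.
     (\<forall>x\<in>D. \<forall>y\<in>D. f (x * y) = f x * f y) \<and> (\<exists>x\<in>D. f x \<noteq> 0)}"

text \<open>The weak-* topology is the topology of pointwise convergence on \<open>D\<close>.\<close>

definition character_space :: "'a::cstar_algebra set \<Rightarrow> ('a \<Rightarrow> complex) topology" where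
  "character_space D = subtopology (product_topology (\<lambda>_. euclidean) D) (characters D)"

section \<open>Partial homeomorphisms and actions of *-semigroups\<close>

definition partial_homeos :: "'x topology \<Rightarrow> ('x \<rightharpoonup> 'x) set" where
  "partial_homeos X = {\<phi>. openin X (dom \<phi>) \<and> openin X (ran \<phi>) \<and>
     homeomorphic_map (subtopology X (dom \<phi>)) (subtopology X (ran \<phi>)) (\<lambda>x. the (\<phi> x))}"

definition partial_inv :: "('x \<rightharpoonup> 'x) \<Rightarrow> ('x \<rightharpoonup> 'x)" where
  "partial_inv \<phi> = (\<lambda>y. if y \<in> ran \<phi> then Some (THE x. \<phi> x = Some y) else None)"

text \<open>The *-semigroup is a subset \<open>S\<close> of a C*-algebra with the inherited operations.\<close>

definition semigroup_action ::
    "'a::cstar_algebra set \<Rightarrow> 'x topology \<Rightarrow> ('a \<Rightarrow> ('x \<rightharpoonup> 'x)) \<Rightarrow> bool" where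
  "semigroup_action S X \<alpha> \<longleftrightarrow>
     (\<forall>s\<in>S. \<forall>t\<in>S. s * t \<in> S) \<and> (\<forall>s\<in>S. star s \<in> S) \<and>
     (\<forall>s\<in>S. \<alpha> s \<in> partial_homeos X) \<and>
     (\<forall>s\<in>S. \<forall>t\<in>S. \<alpha> (s * t) = \<alpha> s \<circ>\<^sub>m \<alpha> t) \<and>
     (\<forall>s\<in>S. \<alpha> (star s) = partial_inv (\<alpha> s))"

definition quasi_free_action ::
    "'a::cstar_algebra set \<Rightarrow> 'x topology \<Rightarrow> ('a \<Rightarrow> ('x \<rightharpoonup> 'x)) \<Rightarrow> bool" where
  "quasi_free_action S X \<alpha> \<longleftrightarrow>
     semigroup_action S X \<alpha> \<and> (\<forall>s\<in>S. openin X {x \<in> dom (\<alpha> s). \<alpha> s x = Some x})"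

definition beta ::
    "'a::cstar_algebra set \<Rightarrow> 'a \<Rightarrow> (('a \<Rightarrow> complex) \<rightharpoonup> ('a \<Rightarrow> complex))" where
  "beta D v = (\<lambda>\<rho>. if \<rho> \<in> characters D \<and> 0 < \<rho> (star v * v)
     then Some (\<lambda>d\<in>D. \<rho> (star v * d * v) / \<rho> (star v * v)) else None)"

section \<open>Groupoids of germs\<close>

record ('g, 'x) groupoid =
  arrows :: "'g set"
  range_map :: "'g \<Rightarrow> 'x"
  source_map :: "'g \<Rightarrow> 'x"
  arrow_mult :: "'g \<Rightarrow> 'g \<Rightarrow> 'g"
  arrow_inv :: "'g \<Rightarrow> 'g"
  unit_arrow :: "'x \<Rightarrow> 'g"

definition isotropy_group :: "('g, 'x) groupoid \<Rightarrow> 'x \<Rightarrow> 'g monoid" where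
  "isotropy_group G x =
     \<lparr>carrier = {\<gamma> \<in> arrows G. range_map G \<gamma> = x \<and> source_map G \<gamma> = x},
      monoid.mult = arrow_mult G,
      one = unit_arrow G x\<rparr>"

type_synonym 'x germ_rep = "'x \<times> ('x \<rightharpoonup> 'x) \<times> 'x"

definition germ_reps :: "('x \<rightharpoonup> 'x) set \<Rightarrow> 'x germ_rep set" where
  "germ_reps P = {(x, \<phi>, y). \<phi> \<in> P \<and> \<phi> y = Some x}"

definition germ_rel ::
    "'x topology \<Rightarrow> ('x \<rightharpoonup> 'x) set \<Rightarrow> ('x germ_rep \<times> 'x germ_rep) set" where
  "germ_rel X P = {((x, \<phi>, y), (x1, \<phi>1, y1)).
     (x, \<phi>, y) \<in> germ_reps P \<and> (x1, \<phi>1, y1) \<in> germ_reps P \<and> y = y1 \<and>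
     (\<exists>U. openin X U \<and> y \<in> U \<and> U \<subseteq> dom \<phi> \<inter> dom \<phi>1 \<and> (\<forall>z\<in>U. \<phi> z = \<phi>1 z))}"

text \<open>\<open>P\<close> is meant to be a set of partial homeomorphisms of \<open>X\<close> that contains the identity of
  \<open>X\<close> and is closed under composition and inverses. Each set \<open>germ_rel X P `` R\<close> below is then
  a single equivalence class: \<open>R\<close> collects the values of the operation on all representatives
  of its arguments.\<close>

definition germ_groupoid ::
    "'x topology \<Rightarrow> ('x \<rightharpoonup> 'x) set \<Rightarrow> ('x germ_rep set, 'x) groupoid" where
  "germ_groupoid X P =
     \<lparr>arrows = germ_reps P // germ_rel X P,
      range_map = (\<lambda>\<gamma>. THE x. \<exists>\<phi> y. (x, \<phi>, y) \<in> \<gamma>),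
      source_map = (\<lambda>\<gamma>. THE y. \<exists>x \<phi>. (x, \<phi>, y) \<in> \<gamma>),
      arrow_mult = (\<lambda>\<gamma> \<delta>. germ_rel X P ``
        {(w, \<phi> \<circ>\<^sub>m \<psi>, z) | w \<phi> x \<psi> z. (w, \<phi>, x) \<in> \<gamma> \<and> (x, \<psi>, z) \<in> \<delta>}),
      arrow_inv = (\<lambda>\<gamma>. germ_rel X P `` {(y, partial_inv \<phi>, x) | x \<phi> y. (x, \<phi>, y) \<in> \<gamma>}),
      unit_arrow = (\<lambda>x. germ_rel X P ``
        {(x, (\<lambda>y. if y \<in> topspace X then Some y else None), x)})\<rparr>"

text \<open>The identity of the character space is \<open>beta D 1\<close>.\<close>

definition weyl_groupoid ::
    "'a::cstar_algebra set \<Rightarrow> (('a \<Rightarrow> complex) germ_rep set, 'a \<Rightarrow> complex) groupoid" where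
  "weyl_groupoid D = germ_groupoid (character_space D) (beta D ` normalizers D)"

end

theory Submission
  imports Defs
begin

text \<open>Characters are produced from maximal preorderings: a maximal proper preordering of the selfadjoint
  part of an abelian algebra is total, hence is the cone of a real-valued homomorphism. This gives enough
  characters to recognise positivity, square roots and positive parts, whence \<open>x\<^sup>* x \<ge> 0\<close>; and the
  positive functionals on a subspace extend to states, with any value at a new element that the order
  permits.

  If \<open>f\<close> is a state that extends a character \<open>\<rho>\<close> of \<open>D\<close> and \<open>v\<close> is a normalizer, then
  \<open>v (v\<^sup>* d v) = d v (v\<^sup>* v)\<close> shows that \<open>f v \<noteq> 0\<close> implies \<open>\<beta>\<^sub>v \<rho> = \<rho>\<close>. If the extension of \<open>\<rho>\<close> is
  unique, the converse holds: the vector states of \<open>1 + tv\<close> extend \<open>\<rho>\<close> as well, and if \<open>f v\<close>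
  were \<open>0\<close>, comparing them with \<open>f\<close> would give \<open>\<rho> (v\<^sup>* v) = 0\<close>. Uniqueness also squeezes
  each selfadjoint element between elements of \<open>D\<close> with almost equal values at \<open>\<rho>\<close>. So \<open>f v \<noteq> 0\<close> persists near \<open>\<rho>\<close> and fixed points of \<open>\<beta>\<^sub>v\<close>
  are interior; and for an element of the commutant of \<open>D\<close> the squeezing elements can be glued, which
  puts it into \<open>D\<close>. Conversely, if \<open>\<beta>\<^sub>v\<close> is the identity near \<open>\<rho>\<close> and \<open>d \<in> D\<close> is supported there,
  then \<open>v d\<close> commutes with \<open>D\<close>, hence lies in the MASA \<open>D\<close>, and \<open>f v\<close> is determined by \<open>\<rho>\<close>; regularity
  then determines \<open>f\<close>. Both dynamical conditions say that fixed points of each \<open>\<beta>\<^sub>v\<close> are interior.\<close>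

section \<open>Basic C*-algebra\<close>

text \<open>Spectra and the Gelfand isomorphism are avoided. Order is defined by a norm inequality,
  inverses and square roots are fixed points of contractions, and identities or estimates in an
  abelian algebra are verified by evaluating characters. A contraction yields roots only of elements
  strictly inside the cone, so many arguments carry a summand \<open>e > 0\<close> and end with a
  limit, the cone being closed. Preorderings do the work of compactness. To pass from local
  information at each character to a global statement, the available certificates are collected in a
  set; if they do not produce \<open>- 1\<close>, a proper preordering arises, and with it a
  character at which the local information fails. This recognises positivity from characters, and it
  also glues the squeezing elements, in place of a finite subcover and a partition of unity.
  Positivity of \<open>star x * x\<close> links two descriptions of states: they are defined by
  their values at these products, whereas extension of functionals is governed by the cone.\<close>

interpretation cvec: vector_space "scaleC :: complex \<Rightarrow> 'a::cstar_algebra \<Rightarrow> 'a"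
  by unfold_locales
    (simp_all add: scaleC_add_right scaleC_add_left scaleC_scaleC scaleC_one)

lemma star_0 [simp]: "star (0::'a::cstar_algebra) = 0"
  using star_add[of "0::'a" 0] by simp

lemma star_1 [simp]: "star (1::'a::cstar_algebra) = 1"
  by (metis mult.right_neutral star_mult star_star mult_1)

lemma star_minus [simp]: "star (- x) = - star (x::'a::cstar_algebra)"
  by (metis star_0 star_add add.right_inverse add_eq_0_iff)

lemma star_diff [simp]: "star (x - y) = star x - star (y::'a::cstar_algebra)"
  using star_add[of x "- y"] by simp

lemma star_scaleR [simp]: "star (r *\<^sub>R x) = r *\<^sub>R star (x::'a::cstar_algebra)"
  by (simp add: scaleR_eq_scaleC star_scaleC)

declare star_star [simp] star_add [simp] star_mult [simp] star_scaleC [simp]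

lemma star_of_real [simp]: "star (of_real r) = (of_real r :: 'a::cstar_algebra)"
  by (simp add: of_real_def)

lemma norm_star [simp]: "norm (star x) = norm (x::'a::cstar_algebra)"
proof -
  have le: "norm y \<le> norm (star y)" for y :: 'a
  proof (cases "y = 0")
    case False
    have "norm y * norm y \<le> norm (star y) * norm y"
      using cstar_identity[of y] norm_mult_ineq[of "star y" y] by (simp add: power2_eq_square)
    with False show ?thesis by simp
  qed simp
  from le[of x] le[of "star x"] show ?thesis by simp
qed

lemma bounded_linear_star: "bounded_linear (star :: 'a::cstar_algebra \<Rightarrow> 'a)"
  by (intro bounded_linear_intro[where K = 1]) auto

lemmas continuous_on_star [continuous_intros] = bounded_linear.continuous_on[OF bounded_linear_star]

definition re_part :: "'a::cstar_algebra \<Rightarrow> 'a" where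
  "re_part x = scaleC (1/2) (x + star x)"

definition im_part :: "'a::cstar_algebra \<Rightarrow> 'a" where
  "im_part x = scaleC (- \<i>/2) (x - star x)"

lemma star_re_part [simp]: "star (re_part x) = re_part x"
  by (simp add: re_part_def add.commute)

lemma star_im_part [simp]: "star (im_part x) = im_part x"
proof -
  have "star (im_part x) = scaleC (\<i>/2) (- (x - star x))"
    by (simp add: im_part_def)
  then show ?thesis unfolding cvec.scale_minus_right by (simp add: im_part_def)
qed

lemma scaleC_half_add: "scaleC (1/2) x + scaleC (1/2) x = (x::'a::cstar_algebra)"
  by (simp add: scaleC_one flip: cvec.scale_left_distrib)

lemma cartesian: "x = re_part x + scaleC \<i> (im_part (x::'a::cstar_algebra))"
proof -
  have "re_part x + scaleC \<i> (im_part x) = scaleC (1/2) x + scaleC (1/2) x"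
    by (simp add: re_part_def im_part_def scaleC_scaleC cvec.scale_right_distrib
        cvec.scale_right_diff_distrib)
  then show ?thesis unfolding scaleC_half_add by (rule sym)
qed

lemma re_part_selfadjoint: "star x = x \<Longrightarrow> re_part x = (x::'a::cstar_algebra)"
  by (simp add: re_part_def cvec.scale_right_distrib scaleC_half_add)

lemma im_part_selfadjoint: "star x = x \<Longrightarrow> im_part x = (0::'a::cstar_algebra)"
  by (simp add: im_part_def)

lemma re_part_add: "re_part (x + y) = re_part x + re_part (y::'a::cstar_algebra)"
  by (simp add: re_part_def cvec.scale_right_distrib algebra_simps)

lemma im_part_add: "im_part (x + y) = im_part x + im_part (y::'a::cstar_algebra)"
  by (simp add: im_part_def cvec.scale_right_distrib cvec.scale_right_diff_distrib algebra_simps)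

lemma re_part_scaleC:
  "re_part (scaleC c x) = Re c *\<^sub>R re_part x - Im c *\<^sub>R im_part (x::'a::cstar_algebra)"
proof -
  have c: "c = complex_of_real (Re c) + \<i> * complex_of_real (Im c)"
    by (simp add: complex_eq_iff)
  have "re_part (scaleC c x) =
     scaleC (c/2) x + scaleC (cnj c/2) (star x)"
    by (simp add: re_part_def cvec.scale_right_distrib scaleC_scaleC)
  also have "\<dots> = scaleC (Re c/2 + \<i> * Im c/2) x + scaleC (Re c/2 - \<i> * Im c/2) (star x)"
    by (subst (1 2) c, simp add: add_divide_distrib diff_divide_distrib)
  also have "\<dots> = Re c *\<^sub>R re_part x - Im c *\<^sub>R im_part x"
    by (simp add: re_part_def im_part_def scaleR_eq_scaleC scaleC_scaleC cvec.scale_right_distrib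
        cvec.scale_right_diff_distrib cvec.scale_left_distrib cvec.scale_left_diff_distrib
        algebra_simps)
  finally show ?thesis .
qed

lemma im_part_eq_re_part: "im_part x = re_part (scaleC (- \<i>) (x::'a::cstar_algebra))"
  by (simp add: re_part_def im_part_def cvec.scale_right_distrib scaleC_scaleC
      cvec.scale_right_diff_distrib)

lemma im_part_scaleC:
  "im_part (scaleC c x) = Re c *\<^sub>R im_part x + Im c *\<^sub>R re_part (x::'a::cstar_algebra)"
  unfolding im_part_eq_re_part[of "scaleC c x"] scaleC_scaleC re_part_scaleC
  by simp

lemma star_mult_cartesian:
  fixes a b :: "'a::cstar_algebra"
  assumes "star a = a" "star b = b"
  shows "star (a + scaleC \<i> b) * (a + scaleC \<i> b) =
           a * a + b * b + scaleC \<i> (a * b - b * a)"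
  using assms
  by (simp add: algebra_simps scaleC_mult_left scaleC_mult_right scaleC_scaleC
      cvec.scale_right_diff_distrib cvec.scale_left_distrib)

lemma norm_square_selfadjoint:
  "star y = y \<Longrightarrow> norm (y * y) = (norm (y::'a::cstar_algebra))\<^sup>2"
  using cstar_identity[of y] by simp

section \<open>Subalgebras\<close>

lemma cstar_subalgebraD:
  assumes "cstar_subalgebra A"
  shows "0 \<in> A" "x \<in> A \<Longrightarrow> y \<in> A \<Longrightarrow> x + y \<in> A" "x \<in> A \<Longrightarrow> scaleC c x \<in> A"
    "x \<in> A \<Longrightarrow> y \<in> A \<Longrightarrow> x * y \<in> A" "x \<in> A \<Longrightarrow> star x \<in> A" "closed A"
  using assms by (auto simp: cstar_subalgebra_def)

lemma cstar_subalgebra_scaleR: "cstar_subalgebra A \<Longrightarrow> x \<in> A \<Longrightarrow> r *\<^sub>R x \<in> A"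
  by (simp add: scaleR_eq_scaleC cstar_subalgebraD)

lemma cstar_subalgebra_minus:
  assumes "cstar_subalgebra A" "x \<in> A" shows "- x \<in> A"
  using cstar_subalgebra_scaleR[OF assms, of "-1"] by simp

lemma cstar_subalgebra_diff:
  assumes "cstar_subalgebra A" "x \<in> A" "y \<in> A" shows "x - y \<in> A"
  using cstar_subalgebraD(2)[OF assms(1,2) cstar_subalgebra_minus[OF assms(1,3)]] by simp

lemma cstar_subalgebra_of_real:
  assumes "cstar_subalgebra A" "1 \<in> A" shows "of_real r \<in> A"
  using cstar_subalgebra_scaleR[OF assms] by (simp add: of_real_def)

lemma cstar_subalgebra_re_im:
  assumes "cstar_subalgebra A" "x \<in> A" shows "re_part x \<in> A" "im_part x \<in> A"
  unfolding re_part_def im_part_def using assms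
  by (blast intro: cstar_subalgebraD cstar_subalgebra_diff)+

lemmas cstar_subalgebra_intros =
  cstar_subalgebraD(1-5) cstar_subalgebra_scaleR cstar_subalgebra_minus cstar_subalgebra_diff
  cstar_subalgebra_of_real cstar_subalgebra_re_im

lemma cstar_subalgebra_UNIV: "cstar_subalgebra UNIV"
  by (simp add: cstar_subalgebra_def)

definition commutant :: "'a::cstar_algebra set \<Rightarrow> 'a set" where
  "commutant S = {x. \<forall>s\<in>S. x * s = s * x}"

lemma commutant_subalgebra:
  fixes S :: "'a::cstar_algebra set"
  assumes "\<And>s. s \<in> S \<Longrightarrow> star s \<in> S"
  shows "cstar_subalgebra (commutant S)"
proof -
  have "star x * s = s * star x" if "x \<in> commutant S" "s \<in> S" for x s
  proof -
    have "x * star s = star s * x" using that assms by (auto simp: commutant_def)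
    then have "star (x * star s) = star (star s * x)" by simp
    then show ?thesis by simp
  qed
  moreover have "closed (commutant S)"
  proof -
    have "commutant S = (\<Inter>s\<in>S. {x. x * s = s * x})" by (auto simp: commutant_def)
    moreover have "closed {x. x * s = s * x}" for s :: 'a
      by (intro closed_Collect_eq continuous_intros)
    ultimately show ?thesis by auto
  qed
  moreover have "x * y * s = s * (x * y)" if "x \<in> commutant S" "y \<in> commutant S" "s \<in> S" for x y s
  proof -
    have "y * s = s * y" "x * s = s * x" using that by (auto simp: commutant_def)
    then show ?thesis by (metis mult.assoc)
  qed
  ultimately show ?thesis
    unfolding cstar_subalgebra_def
    by (auto simp: commutant_def algebra_simps scaleC_mult_left scaleC_mult_right)
qed

lemma one_commutant: "1 \<in> commutant S"
  by (simp add: commutant_def)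

text \<open>The bicommutant stands in for the closed algebra generated by \<open>S\<close>: a
  commuting \<open>S\<close> lies in its commutant, so \<open>commutant (commutant S)\<close> lies
  in \<open>commutant S\<close> and is abelian.\<close>

lemma inclusion_bicommutant:
  fixes S :: "'a::cstar_algebra set"
  assumes star: "\<And>s. s \<in> S \<Longrightarrow> star s \<in> S"
    and comm: "\<And>s t. s \<in> S \<Longrightarrow> t \<in> S \<Longrightarrow> s * t = t * s"
  shows "inclusion (commutant (commutant S))" "S \<subseteq> commutant (commutant S)"
proof -
  show S: "S \<subseteq> commutant (commutant S)" by (auto simp: commutant_def)
  have "S \<subseteq> commutant S" using comm by (auto simp: commutant_def)
  then have sub: "commutant (commutant S) \<subseteq> commutant S" by (auto simp: commutant_def)
  have "star x \<in> commutant S" if "x \<in> commutant S" for x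
    using commutant_subalgebra[OF star] that by (rule cstar_subalgebraD)
  then have "cstar_subalgebra (commutant (commutant S))"
    by (rule commutant_subalgebra)
  moreover have "x * y = y * x" if "x \<in> commutant (commutant S)" "y \<in> commutant (commutant S)" for x y
    using that sub by (auto simp: commutant_def)
  ultimately show "inclusion (commutant (commutant S))"
    by (auto simp: inclusion_def abelian_cstar_subalgebra_def one_commutant)
qed

section \<open>Fixed points: inverses and square roots\<close>

text \<open>The fixed points of \<open>x \<mapsto> 1 + z * x\<close> and
  \<open>x \<mapsto> 1 + x * z\<close> are a right and a left inverse of \<open>1 - z\<close>. The
  contraction principle is applied on the complete set \<open>A\<close>, so the inverse stays in
  \<open>A\<close>.\<close>

lemma subalgebra_neumann:
  fixes z :: "'a::cstar_algebra"
  assumes A: "cstar_subalgebra A" "1 \<in> A" and z: "z \<in> A" "norm z < 1"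
  obtains q where "q \<in> A" "(1 - z) * q = 1" "q * (1 - z) = 1"
proof -
  have "\<exists>!q. q \<in> A \<and> 1 + z * q = q"
  proof (rule Banach_fix)
    show "complete A" using A by (simp add: complete_eq_closed cstar_subalgebraD)
    show "dist (1 + z * x) (1 + z * y) \<le> norm z * dist x y" for x y
      by (simp add: dist_norm flip: right_diff_distrib) (rule norm_mult_ineq)
  qed (use A z in \<open>auto intro: cstar_subalgebra_intros\<close>)
  then obtain q where q: "q \<in> A" "1 + z * q = q" by auto
  have "\<exists>!q. q \<in> A \<and> 1 + q * z = q"
  proof (rule Banach_fix)
    show "complete A" using A by (simp add: complete_eq_closed cstar_subalgebraD)
    show "dist (1 + x * z) (1 + y * z) \<le> norm z * dist x y" for x y
      using norm_mult_ineq[of "x - y" z]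
      by (simp add: dist_norm mult.commute[of "norm z"] flip: left_diff_distrib)
  qed (use A z in \<open>auto intro: cstar_subalgebra_intros\<close>)
  then obtain p where p: "p \<in> A" "1 + p * z = p" by auto
  have 1: "(1 - z) * q = 1" using q(2) by (simp add: algebra_simps)
  have 2: "p * (1 - z) = 1" using p(2) by (simp add: algebra_simps)
  have "p = q" by (metis 1 2 mult.assoc mult_1 mult.right_neutral)
  with 1 2 q(1) show ?thesis by (auto intro: that)
qed

text \<open>With the root written as \<open>1 - u\<close>, the equation becomes
  \<open>u = (x + u * u) / 2\<close>. This map preserves and contracts a ball of radius below
  \<open>1\<close> in the selfadjoint part of \<open>A\<close>.\<close>

lemma subalgebra_sqrt:
  fixes x :: "'a::cstar_algebra"
  assumes A: "cstar_subalgebra A" "1 \<in> A" and x: "x \<in> A" "star x = x" "norm x < 1"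
  obtains y where "y \<in> A" "star y = y" "y * y = 1 - x" "norm (1 - y) < 1"
proof -
  \<comment> \<open>The smaller root of \<open>r * r - 2 * r + norm x = 0\<close>: then
    \<open>(norm x + r * r) / 2 = r\<close>, so the ball of radius \<open>r\<close> is preserved,
    and \<open>r < 1\<close> is at the same time the contraction constant.\<close>
  define r where "r = 1 - sqrt (1 - norm x)"
  have r: "0 \<le> r" "r < 1" "norm x + r * r = 2 * r"
    using x(3) norm_ge_zero[of x] by (auto simp: r_def algebra_simps)
  define S where "S = {y \<in> A. star y = y} \<inter> cball 0 r"
  have "\<exists>!y. y \<in> S \<and> (1/2) *\<^sub>R (x + y * y) = y"
  proof (rule Banach_fix)
    have "closed {y::'a. star y = y}"
      by (intro closed_Collect_eq continuous_intros)
    then have "closed (A \<inter> {y. star y = y} \<inter> cball 0 r)"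
      using A(1) cstar_subalgebraD(6) by (intro closed_Int) auto
    moreover have "S = A \<inter> {y. star y = y} \<inter> cball 0 r" by (auto simp: S_def)
    ultimately show "complete S" by (simp add: complete_eq_closed)
    have "0 \<in> S" using A r by (auto simp: S_def cstar_subalgebraD)
    then show "S \<noteq> {}" by auto
    show "0 \<le> r" "r < 1" by fact+
    show "(\<lambda>y. (1/2) *\<^sub>R (x + y * y)) ` S \<subseteq> S"
    proof (clarify)
      fix y assume y: "y \<in> S"
      have "norm (y * y) \<le> r * r"
        using y by (intro order_trans[OF norm_mult_ineq] mult_mono) (auto simp: S_def r)
      then have "norm (x + y * y) \<le> 2 * r"
        using norm_triangle_ineq[of x "y * y"] r by linarith
      then show "(1/2) *\<^sub>R (x + y * y) \<in> S"
        using y x A by (auto simp: S_def intro!: cstar_subalgebra_intros)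
    qed
    fix y z assume yz: "y \<in> S" "z \<in> S"
    have "y * y - z * z = y * (y - z) + (y - z) * z" by (simp add: algebra_simps)
    also have "norm \<dots> \<le> norm y * norm (y - z) + norm (y - z) * norm z"
      by (intro order_trans[OF norm_triangle_ineq] add_mono norm_mult_ineq)
    also have "\<dots> \<le> r * norm (y - z) + norm (y - z) * r"
      using yz by (intro add_mono mult_mono) (auto simp: S_def r)
    finally have "norm (y * y - z * z) \<le> 2 * (r * norm (y - z))" by simp
    then show "dist ((1/2) *\<^sub>R (x + y * y)) ((1/2) *\<^sub>R (x + z * z)) \<le> r * dist y z"
      by (simp add: dist_norm flip: scaleR_diff_right)
  qed
  then obtain y where y: "y \<in> S" "(1/2) *\<^sub>R (x + y * y) = y" by auto
  have "x + y * y = 2 *\<^sub>R y" by (subst y(2)[symmetric]) simp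
  then have "(1 - y) * (1 - y) = 1 - x"
    by (simp add: algebra_simps scaleR_2)
  moreover have "norm (1 - (1 - y)) < 1" using y r by (simp add: S_def)
  moreover have "1 - y \<in> A" "star (1 - y) = 1 - y"
    using y A by (auto simp: S_def intro: cstar_subalgebra_intros)
  ultimately show ?thesis using that by blast
qed

section \<open>The order\<close>

text \<open>In spectral terms the inequality confines the spectrum of a selfadjoint \<open>a\<close>
  to \<open>[0, 2 * norm a]\<close>. In this form sums need only the triangle inequality, once
  \<open>norm a\<close> may be replaced by any bound \<open>t\<close>.\<close>

definition positive :: "'a::cstar_algebra \<Rightarrow> bool" where
  "positive a \<longleftrightarrow> star a = a \<and> norm (of_real (norm a) - a) \<le> norm a"

text \<open>The element \<open>w + \<i>a\<close> is a multiple of a unitary.\<close>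

lemma norm_le_of_squares:
  fixes w a :: "'a::cstar_algebra"
  assumes sa: "star w = w" "star a = a" and comm: "w * a = a * w"
    and eq: "w * w + a * a = of_real s" and s: "0 \<le> s"
  shows "(norm a)\<^sup>2 \<le> s"
proof -
  define u where "u = w + scaleC \<i> a"
  have u: "star u * u = of_real s"
    using star_mult_cartesian[OF sa] comm eq by (simp add: u_def)
  have nu: "(norm u)\<^sup>2 = s" using cstar_identity[of u] u s by simp
  have "u - star u = scaleC (2 * \<i>) a"
    by (simp add: u_def sa flip: cvec.scale_left_distrib)
  then have "2 * norm a = norm (u - star u)" by (simp add: norm_scaleC norm_mult)
  also have "\<dots> \<le> 2 * norm u" using norm_triangle_ineq4[of u "star u"] by simp
  finally show ?thesis by (simp flip: nu)
qed

text \<open>The element \<open>a + e\<close> equals \<open>(t + e) * (1 - x)\<close> with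
  \<open>norm x < 1\<close>; the shift by \<open>e\<close> makes this inequality strict. The bound
  on \<open>of_real c - y\<close> says that the root is positive, in the raw form that is available
  before \<open>positiveI\<close>, which rests on this lemma.\<close>

lemma sqrt_approx_of_norm:
  fixes a :: "'a::cstar_algebra"
  assumes A: "cstar_subalgebra A" "1 \<in> A" and a: "a \<in> A" "star a = a"
    and t: "norm (of_real t - a) \<le> t" and e: "0 < e"
  obtains y c where "y \<in> A" "star y = y" "y * y = a + of_real e" "norm (of_real c - y) \<le> c"
proof -
  have t0: "0 \<le> t" using t norm_ge_zero order_trans by blast
  define x where "x = (1 / (t + e)) *\<^sub>R (of_real t - a)"
  have "norm x < 1" using t t0 e by (simp add: x_def divide_simps)
  moreover have "x \<in> A" "star x = x"
    using A a by (auto simp: x_def intro!: cstar_subalgebra_intros)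
  ultimately obtain w where w: "w \<in> A" "star w = w" "w * w = 1 - x" "norm (1 - w) < 1"
    using subalgebra_sqrt[OF A] by metis
  define c where "c = sqrt (t + e)"
  have c: "c > 0" "c * c = t + e" using t0 e by (simp_all add: c_def)
  have "(c *\<^sub>R w) * (c *\<^sub>R w) = (t + e) *\<^sub>R (1 - x)" using c w by simp
  also have "\<dots> = a + of_real e"
    using t0 e by (simp add: x_def scaleR_diff_right of_real_def scaleR_add_left)
  finally have "(c *\<^sub>R w) * (c *\<^sub>R w) = a + of_real e" .
  moreover have "norm (of_real c - c *\<^sub>R w) \<le> c"
  proof -
    have "of_real c - c *\<^sub>R w = c *\<^sub>R (1 - w)" by (simp add: of_real_def scaleR_diff_right)
    then show ?thesis using w(4) c by simp
  qed
  ultimately show ?thesis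
    using that[of "c *\<^sub>R w" c] w A by (auto intro: cstar_subalgebra_intros)
qed

text \<open>After scaling \<open>y\<close> to \<open>z\<close> with \<open>norm (z * z) < 1\<close>,
  a root \<open>w\<close> of \<open>1 - z * z\<close> exists in the commutant of \<open>y\<close>.
  Then \<open>z * z + w * w = 1\<close> gives \<open>norm w \<le> 1\<close>, hence
  \<open>norm (1 - z * z) \<le> 1\<close>.\<close>

lemma norm_diff_square_le:
  fixes y :: "'a::cstar_algebra"
  assumes y: "star y = y" and s: "norm (y * y) < s"
  shows "norm (of_real s - y * y) \<le> s"
proof -
  have s0: "0 < s" using s norm_ge_zero[of "y * y"] by linarith
  define z where "z = (1 / sqrt s) *\<^sub>R y"
  have zz: "z * z = (1 / s) *\<^sub>R (y * y)" using s0 by (simp add: z_def field_simps)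
  have zs: "star z = z" using y by (simp add: z_def)
  have A: "cstar_subalgebra (commutant {y})"
    using y by (intro commutant_subalgebra) auto
  have "z * z \<in> commutant {y}" by (simp add: zz commutant_def mult.assoc)
  moreover have "norm (z * z) < 1" using s s0 by (simp add: zz)
  moreover have "star (z * z) = z * z" using zs by simp
  ultimately obtain w where w: "w \<in> commutant {y}" "star w = w" "w * w = 1 - z * z"
    using subalgebra_sqrt[OF A one_commutant] by metis
  have "z * w = w * z" using w(1) by (simp add: commutant_def z_def)
  then have "(norm w)\<^sup>2 \<le> 1"
    by (intro norm_le_of_squares[of z w]) (use w zs in auto)
  then have "norm (1 - z * z) \<le> 1"
    using norm_square_selfadjoint[OF w(2)] w by simp
  moreover have "of_real s - y * y = s *\<^sub>R (1 - z * z)"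
    using s0 by (simp add: zz of_real_def scaleR_diff_right)
  ultimately show ?thesis using s0 by simp
qed

text \<open>Any bound \<open>t\<close> can be traded for \<open>norm a\<close>: up to a small
  summand \<open>a\<close> is a square, and squares satisfy the inequality for every
  \<open>s\<close> above their norm.\<close>

lemma positiveI:
  fixes a :: "'a::cstar_algebra"
  assumes a: "star a = a" and t: "norm (of_real t - a) \<le> t"
  shows "positive a"
proof -
  have "norm (of_real (norm a) - a) \<le> norm a + e" if "e > 0" for e :: real
  proof -
    \<comment> \<open>One \<open>d\<close> makes \<open>a + d\<close> a square, one makes the norm
      bound strict, and one pays for removing the shift again.\<close>
    define d where "d = e / 3"
    have d: "d > 0" using that by (simp add: d_def)
    obtain y where y: "star y = y" "y * y = a + of_real d"
      using sqrt_approx_of_norm[OF cstar_subalgebra_UNIV _ _ a t d] by auto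
    have "norm (y * y) \<le> norm a + d"
      using norm_triangle_ineq[of a "of_real d"] d y by simp
    then have "norm (of_real (norm a + (d + d)) - y * y) \<le> norm a + (d + d)"
      using d by (intro norm_diff_square_le y) auto
    moreover have "of_real (norm a + (d + d)) - y * y = (of_real (norm a) - a) + of_real d"
      unfolding y of_real_add by (simp only: diff_conv_add_uminus minus_add_distrib ac_simps) simp
    ultimately have "norm ((of_real (norm a) - a) + of_real d) \<le> norm a + (d + d)"
      by (simp only:)
    then have "norm (of_real (norm a) - a) \<le> norm a + 3 * d"
      using norm_triangle_ineq4[of "(of_real (norm a) - a) + of_real d" "of_real d"] d by simp
    then show ?thesis by (simp add: d_def)
  qed
  then show ?thesis using a by (auto simp: positive_def intro: field_le_epsilon)
qed

lemma positive_star: "positive a \<Longrightarrow> star a = a"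
  by (simp add: positive_def)

lemma positive_square: "star y = y \<Longrightarrow> positive (y * y :: 'a::cstar_algebra)"
  by (rule positiveI[OF _ norm_diff_square_le[of y "norm (y * y) + 1"]]) auto

lemma positive_sqrt_approx:
  fixes a :: "'a::cstar_algebra"
  assumes a: "positive a" and A: "cstar_subalgebra A" "1 \<in> A" "a \<in> A" and e: "0 < e"
  obtains y where "y \<in> A" "star y = y" "y * y = a + of_real e" "positive y"
proof -
  from a have "star a = a" "norm (of_real (norm a) - a) \<le> norm a"
    by (auto simp: positive_def)
  from sqrt_approx_of_norm[OF A this e] that show ?thesis using positiveI by metis
qed

lemma positive_add:
  fixes a b :: "'a::cstar_algebra"
  assumes "positive a" "positive b"
  shows "positive (a + b)"
proof (rule positiveI)
  show "star (a + b) = a + b" using assms by (simp add: positive_star)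
  have "norm (of_real (norm a + norm b) - (a + b)) =
     norm ((of_real (norm a) - a) + (of_real (norm b) - b))"
    by (simp add: algebra_simps)
  also have "\<dots> \<le> norm a + norm b"
    using assms by (intro order_trans[OF norm_triangle_ineq] add_mono) (auto simp: positive_def)
  finally show "norm (of_real (norm a + norm b) - (a + b)) \<le> norm a + norm b" .
qed

lemma positive_scaleR:
  fixes a :: "'a::cstar_algebra"
  assumes "positive a" "0 \<le> r"
  shows "positive (r *\<^sub>R a)"
proof (rule positiveI)
  show "star (r *\<^sub>R a) = r *\<^sub>R a" using assms by (simp add: positive_star)
  have "norm (of_real (r * norm a) - r *\<^sub>R a) = norm (r *\<^sub>R (of_real (norm a) - a))"
    by (simp add: scaleR_diff_right of_real_def)
  also have "\<dots> \<le> r * norm a" using assms by (auto simp: positive_def intro: mult_left_mono)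
  finally show "norm (of_real (r * norm a) - r *\<^sub>R a) \<le> r * norm a" .
qed

lemma positive_of_real: "0 \<le> r \<Longrightarrow> positive (of_real r :: 'a::cstar_algebra)"
  by (rule positiveI[of _ r]) auto

lemma positive_0 [simp]: "positive (0::'a::cstar_algebra)"
  using positive_of_real[of 0] by simp

lemma positive_1 [simp]: "positive (1::'a::cstar_algebra)"
  using positive_of_real[of 1] by simp

lemma positive_of_real_diff:
  "star a = a \<Longrightarrow> norm a \<le> t \<Longrightarrow> positive (of_real t - (a::'a::cstar_algebra))"
  by (rule positiveI[of _ t]) auto

lemma closed_positive: "closed {a::'a::cstar_algebra. positive a}"
proof -
  have "closed ({a::'a. star a = a} \<inter> {a. norm (of_real (norm a) - a) \<le> norm a})"
    unfolding of_real_def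
    by (intro closed_Int closed_Collect_eq closed_Collect_le continuous_intros)
  then show ?thesis by (auto simp: positive_def Collect_conj_eq)
qed

lemma positive_limit:
  fixes f :: "real \<Rightarrow> 'a::cstar_algebra"
  assumes "\<And>e. 0 < e \<Longrightarrow> positive (f e)" "(f \<longlongrightarrow> a) (at_right 0)"
  shows "positive a"
proof -
  have "a \<in> {a. positive a}"
    using closed_positive
  proof (rule Lim_in_closed_set)
    show "\<forall>\<^sub>F e in at_right 0. f e \<in> {a. positive a}"
      using assms(1) by (auto simp: eventually_at_right_less eventually_at_filter)
  qed (use assms in auto)
  then show ?thesis by simp
qed

lemma positive_approx:
  fixes a :: "'a::cstar_algebra"
  assumes "\<And>e. 0 < e \<Longrightarrow> positive (a + of_real e)"
  shows "positive a"
proof (rule positive_limit[OF assms])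
  have "((\<lambda>e. a + of_real e) \<longlongrightarrow> a + of_real 0) (at_right 0)"
    by (intro tendsto_intros)
  then show "((\<lambda>e. a + of_real e) \<longlongrightarrow> a) (at_right 0)" by simp
qed

lemma inclusionD:
  assumes "inclusion D"
  shows "cstar_subalgebra D" "1 \<in> D" "x \<in> D \<Longrightarrow> y \<in> D \<Longrightarrow> x * y = y * x"
  using assms by (auto simp: inclusion_def abelian_cstar_subalgebra_def)

lemma inclusion_singleton:
  fixes a :: "'a::cstar_algebra"
  assumes "star a = a"
  obtains D where "inclusion D" "a \<in> D"
  using inclusion_bicommutant[of "{a}"] assms by auto

text \<open>Roots taken inside the abelian \<open>D\<close> commute, so
  \<open>(a + e) * (b + e)\<close> is the square of the selfadjoint \<open>y * z\<close>; then
  \<open>e\<close> tends to \<open>0\<close>.\<close>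

lemma positive_mult:
  fixes a b :: "'a::cstar_algebra"
  assumes D: "inclusion D" and ab: "a \<in> D" "b \<in> D" "positive a" "positive b"
  shows "positive (a * b)"
proof -
  note A = inclusionD(1,2)[OF D]
  have 1: "positive ((a + of_real e) * (b + of_real e))" if e: "0 < e" for e
  proof -
    obtain y where y: "y \<in> D" "star y = y" "y * y = a + of_real e"
      using positive_sqrt_approx[OF ab(3) A ab(1) e] by metis
    obtain z where z: "z \<in> D" "star z = z" "z * z = b + of_real e"
      using positive_sqrt_approx[OF ab(4) A ab(2) e] by metis
    have yz: "y * z = z * y" using D y z by (auto dest: inclusionD)
    then have "(a + of_real e) * (b + of_real e) = (y * z) * (y * z)"
      by (metis mult.assoc y(3) z(3))
    moreover have "star (y * z) = y * z" using y z yz by simp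
    ultimately show ?thesis using positive_square by metis
  qed
  have "((\<lambda>e. (a + of_real e) * (b + of_real e)) \<longlongrightarrow> (a + of_real 0) * (b + of_real 0)) (at_right 0)"
    by (intro tendsto_intros)
  then show ?thesis using positive_limit[OF 1] by simp
qed

text \<open>The product \<open>(t - a) * (t + a) = t^2 - a^2\<close> is positive. With an
  approximate root \<open>w\<close> of it, \<open>w * w + a * a\<close> is a scalar, and
  \<open>norm_le_of_squares\<close> bounds \<open>a\<close>.\<close>

lemma norm_le_of_positive:
  fixes a :: "'a::cstar_algebra"
  assumes p: "positive (of_real t - a)" "positive (of_real t + a)" and t: "0 \<le> t"
  shows "norm a \<le> t"
proof -
  have "star (of_real t + a) = of_real t + a" using p by (simp only: positive_star)
  then have a: "star a = a" by simp
  obtain D where D: "inclusion D" "a \<in> D" using inclusion_singleton[OF a] .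
  note A = inclusionD(1,2)[OF D(1)]
  have "positive ((of_real t - a) * (of_real t + a))"
    using D p A by (intro positive_mult[OF D(1)]) (auto intro: cstar_subalgebra_intros)
  then have q: "positive (of_real (t\<^sup>2) - a * a)"
    by (simp add: algebra_simps power2_eq_square of_real_def)
  have "norm a \<le> t + e" if e: "e > 0" for e
  proof -
    have mem: "of_real (t\<^sup>2) - a * a \<in> D" using D A by (blast intro: cstar_subalgebra_intros)
    obtain w where w: "w \<in> D" "star w = w" "w * w = of_real (t\<^sup>2) - a * a + of_real (e\<^sup>2)"
      using positive_sqrt_approx[OF q A mem, of "e\<^sup>2"] e by auto
    have "(norm a)\<^sup>2 \<le> t\<^sup>2 + e\<^sup>2"
    proof (rule norm_le_of_squares)
      show "w * a = a * w" using D w by (auto dest: inclusionD)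
      show "w * w + a * a = of_real (t\<^sup>2 + e\<^sup>2)" by (simp add: w)
    qed (use a w in auto)
    also have "\<dots> \<le> (t + e)\<^sup>2" using t e by (simp add: power2_sum)
    finally show ?thesis using t e by (meson add_nonneg_nonneg less_imp_le power2_le_imp_le)
  qed
  then show ?thesis by (rule field_le_epsilon)
qed

text \<open>Positivity puts \<open>of_real e + a\<close> at distance less than
  \<open>norm a + e\<close> from the scalar \<open>norm a + e\<close>, so
  \<open>subalgebra_neumann\<close> applies after scaling.\<close>

lemma positive_invertible:
  fixes a :: "'a::cstar_algebra"
  assumes p: "positive a" and e: "0 < e" and A: "cstar_subalgebra A" "1 \<in> A" "a \<in> A"
  obtains q where "q \<in> A" "(of_real e + a) * q = 1" "q * (of_real e + a) = 1"
proof -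
  define z where "z = (1 / (norm a + e)) *\<^sub>R (of_real (norm a) - a)"
  have pos: "norm a + e > 0" using e norm_ge_zero[of a] by linarith
  have "norm (of_real (norm a) - a) < norm a + e" using p e by (simp add: positive_def)
  then have "norm z < 1" using pos by (simp add: z_def)
  moreover have "z \<in> A" using A by (auto simp: z_def intro!: cstar_subalgebra_intros)
  ultimately obtain q where q: "q \<in> A" "(1 - z) * q = 1" "q * (1 - z) = 1"
    using subalgebra_neumann[OF A(1,2)] by metis
  have eq: "of_real e + a = (norm a + e) *\<^sub>R (1 - z)"
    using pos by (simp add: z_def scaleR_diff_right of_real_def scaleR_add_left)
  show ?thesis
    using that[of "(1 / (norm a + e)) *\<^sub>R q"] q A pos by (simp add: eq cstar_subalgebra_scaleR)
qed

text \<open>With a root \<open>y\<close> of \<open>a + e\<close>, the conjugate of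
  \<open>a + e\<close> becomes \<open>star (y * x) * (y * x)\<close>. The first assumption is
  supplied by \<open>positive_star_mult\<close>.\<close>

lemma positive_conjugate:
  fixes a x :: "'a::cstar_algebra"
  assumes "\<And>y::'a. positive (star y * y)" and "positive a"
  shows "positive (star x * a * x)"
proof -
  have 1: "positive (star x * (a + of_real e) * x)" if e: "0 < e" for e
  proof -
    obtain y where y: "star y = y" "y * y = a + of_real e"
      using positive_sqrt_approx[OF assms(2) cstar_subalgebra_UNIV _ _ e] by auto
    have "star x * (a + of_real e) * x = star (y * x) * (y * x)"
      using y by (simp add: mult.assoc flip: y(2))
    then show ?thesis by (simp only: assms(1))
  qed
  have "((\<lambda>e. star x * (a + of_real e) * x) \<longlongrightarrow> star x * (a + of_real 0) * x) (at_right 0)"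
    by (intro tendsto_intros)
  then show ?thesis using positive_limit[OF 1] by simp
qed

section \<open>Characters of abelian subalgebras\<close>

lemma functionals_complexify:
  fixes \<phi> :: "'a::cstar_algebra \<Rightarrow> real"
  assumes A: "cstar_subalgebra A"
    and add: "\<And>a b. a \<in> A \<Longrightarrow> b \<in> A \<Longrightarrow> star a = a \<Longrightarrow> star b = b \<Longrightarrow> \<phi> (a + b) = \<phi> a + \<phi> b"
    and scale: "\<And>r a. a \<in> A \<Longrightarrow> star a = a \<Longrightarrow> \<phi> (r *\<^sub>R a) = r * \<phi> a"
  obtains f where "f \<in> functionals A" "\<And>a. a \<in> A \<Longrightarrow> star a = a \<Longrightarrow> f a = complex_of_real (\<phi> a)"
proof -
  define f where "f = (\<lambda>x\<in>A. complex_of_real (\<phi> (re_part x)) + \<i> * complex_of_real (\<phi> (im_part x)))"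
  note mem = cstar_subalgebra_intros[OF A]
  have diff: "\<phi> (a - b) = \<phi> a - \<phi> b" if "a \<in> A" "b \<in> A" "star a = a" "star b = b" for a b
    using add[of a "(-1) *\<^sub>R b"] scale[of b "-1"] that mem by simp
  have 0: "\<phi> 0 = 0" using scale[of 0 0] mem by simp
  have "f (x + y) = f x + f y" if "x \<in> A" "y \<in> A" for x y
    using that mem by (simp add: f_def re_part_add im_part_add add algebra_simps)
  moreover have "f (scaleC c x) = c * f x" if "x \<in> A" for c x
    using that mem
    by (simp add: f_def re_part_scaleC im_part_scaleC add diff scale complex_eq_iff algebra_simps)
  ultimately have "f \<in> functionals A"
    by (auto simp: functionals_def f_def extensional_def)
  moreover have "f a = complex_of_real (\<phi> a)" if "a \<in> A" "star a = a" for a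
    using that by (simp add: f_def re_part_selfadjoint im_part_selfadjoint 0)
  ultimately show ?thesis using that by blast
qed

lemma functionalsD:
  assumes "f \<in> functionals A"
  shows "x \<in> A \<Longrightarrow> y \<in> A \<Longrightarrow> f (x + y) = f x + f y" "x \<in> A \<Longrightarrow> f (scaleC c x) = c * f x"
    "x \<in> A \<Longrightarrow> f (r *\<^sub>R x) = complex_of_real r * f x" "f \<in> extensional A"
  using assms by (auto simp: functionals_def scaleR_eq_scaleC)

lemma functionals_diff:
  assumes "cstar_subalgebra A" "f \<in> functionals A" "x \<in> A" "y \<in> A"
  shows "f (- x) = - f x" "f (x - y) = f x - f y" "f 0 = 0"
proof -
  have m: "f (- z) = - f z" if "z \<in> A" for z
    using functionalsD(3)[OF assms(2) that, of "-1"] by simp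
  show "f (- x) = - f x" using m assms by simp
  show "f 0 = 0" using functionalsD(3)[OF assms(2) assms(3), of 0] by simp
  show "f (x - y) = f x - f y"
    using functionalsD(1)[OF assms(2) assms(3), of "- y"] m assms cstar_subalgebra_minus by auto
qed

text \<open>A preordering as in real algebra, but containing every positive element and not only
  squares. Hence \<open>norm a - a\<close> and \<open>norm a + a\<close> belong to it for
  selfadjoint \<open>a\<close> in \<open>D\<close>: it is archimedean, and its cuts define real
  numbers.\<close>

definition preordering :: "'a::cstar_algebra set \<Rightarrow> 'a set \<Rightarrow> bool" where
  "preordering D T \<longleftrightarrow>
     (\<forall>a\<in>T. a \<in> D \<and> star a = a) \<and> (\<forall>a\<in>D. positive a \<longrightarrow> a \<in> T) \<and>
     (\<forall>a\<in>T. \<forall>b\<in>T. a + b \<in> T \<and> a * b \<in> T) \<and> - 1 \<notin> T"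

context
  fixes D :: "'a::cstar_algebra set"
  assumes D: "inclusion D"
begin

private lemma comm: "x \<in> D \<Longrightarrow> y \<in> D \<Longrightarrow> x * y = y * x"
  using D by (rule inclusionD)

lemmas mem_inclusion = cstar_subalgebra_intros[OF inclusionD(1)[OF D]] inclusionD(2)[OF D]

lemma mem_inclusion_of_real: "of_real r \<in> D"
  using D by (auto intro: mem_inclusion inclusionD)

text \<open>If \<open>b\<close> is not in \<open>M\<close>, maximality puts \<open>- 1\<close> into
  \<open>M + b * M\<close>. Applied to \<open>a\<close> and \<open>- a\<close> this gives
  \<open>a * t = - (1 + s)\<close> and \<open>a * t' = 1 + s'\<close>; multiplying the two writes
  \<open>- 1\<close> as an element of \<open>M\<close>.\<close>

lemma preordering_total:
  assumes M: "preordering D M" and max: "\<And>T. preordering D T \<Longrightarrow> M \<subseteq> T \<Longrightarrow> T = M"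
    and a: "a \<in> D" "star a = a"
  shows "a \<in> M \<or> - a \<in> M"
proof (rule ccontr)
  assume "\<not> ?thesis"
  then have notin: "a \<notin> M" "- a \<notin> M" by auto
  have MD: "x \<in> D" "star x = x" if "x \<in> M" for x using M that by (auto simp: preordering_def)
  have Madd: "x + y \<in> M" and Mmult: "x * y \<in> M" if "x \<in> M" "y \<in> M" for x y
    using M that by (auto simp: preordering_def)
  have Mpos: "x \<in> M" if "x \<in> D" "positive x" for x using M that by (auto simp: preordering_def)
  have M01: "0 \<in> M" "1 \<in> M" using Mpos mem_inclusion by auto
  have ext: "\<exists>s\<in>M. \<exists>t\<in>M. - 1 = s + b * t" if b: "b \<in> D" "star b = b" "b \<notin> M" for b
  proof (rule ccontr)
    assume no: "\<not> ?thesis"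
    define T where "T = {s + b * t | s t. s \<in> M \<and> t \<in> M}"
    have TI: "s + b * t \<in> T" if "s \<in> M" "t \<in> M" for s t
      using that by (auto simp: T_def)
    have bb: "b * b \<in> M" using b by (intro Mpos positive_square mem_inclusion)
    have "preordering D T"
      unfolding preordering_def
    proof (intro conjI ballI impI)
      fix x assume "x \<in> T"
      then obtain s t where x: "x = s + b * t" "s \<in> M" "t \<in> M" by (auto simp: T_def)
      show "x \<in> D" using x MD b by (auto intro!: mem_inclusion)
      show "star x = x" using x MD b comm by simp
    next
      fix x assume "x \<in> D" "positive x"
      then show "x \<in> T" using TI[OF Mpos M01(1)] by simp
    next
      fix x y assume "x \<in> T" "y \<in> T"
      then obtain s t s' t' where x: "x = s + b * t" "s \<in> M" "t \<in> M"
        and y: "y = s' + b * t'" "s' \<in> M" "t' \<in> M" by (auto simp: T_def)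
      have "x + y = (s + s') + b * (t + t')" by (simp add: x y algebra_simps)
      then show "x + y \<in> T" using TI[OF Madd[OF x(2) y(2)] Madd[OF x(3) y(3)]] by simp
      have "x * y = (s * s' + b * b * (t * t')) + b * (s * t' + t * s')"
      proof -
        have "x * y = s * s' + (s * b) * t' + b * (t * s') + b * ((t * b) * t')"
          by (simp add: x(1) y(1) algebra_simps)
        moreover have "s * b = b * s" "t * b = b * t" using x y MD b by (auto intro: comm)
        ultimately show ?thesis by (simp only:) (simp add: algebra_simps)
      qed
      then show "x * y \<in> T"
        using TI[OF Madd[OF Mmult[OF x(2) y(2)] Mmult[OF bb Mmult[OF x(3) y(3)]]]
          Madd[OF Mmult[OF x(2) y(3)] Mmult[OF x(3) y(2)]]] by simp
    next
      show "- 1 \<notin> T" using no unfolding T_def by blast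
    qed
    moreover have "M \<subseteq> T" using TI[OF _ M01(1)] by auto
    ultimately have "T = M" by (rule max)
    moreover have "b \<in> T" using TI[OF M01] by simp
    ultimately show False using b by simp
  qed
  obtain s t where st: "s \<in> M" "t \<in> M" "- 1 = s + a * t" using ext[OF a notin(1)] by auto
  obtain s' t' where st': "s' \<in> M" "t' \<in> M" "- 1 = s' + - a * t'"
    using ext[of "- a"] a notin(2) mem_inclusion by auto
  have "a * t = - 1 - s" unfolding st(3) by simp
  moreover have "a * t' = s' - (- 1)" unfolding st'(3) by simp
  ultimately have at: "a * t = - 1 - s" "a * t' = 1 + s'" by simp_all
  have "a * a * (t * t') = (a * t) * (a * t')"
  proof -
    have "a * t = t * a" using a(1) MD(1)[OF st(2)] by (rule comm)
    then show ?thesis by (metis mult.assoc)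
  qed
  also have "\<dots> = - (1 + s + s' + s * s')" by (simp add: at algebra_simps)
  finally have "- 1 = s + s' + s * s' + a * a * (t * t')" by (simp add: algebra_simps)
  moreover have "s + s' + s * s' + a * a * (t * t') \<in> M"
    using st st' a by (intro Madd Mmult Mpos[of "a * a"] positive_square mem_inclusion) auto
  ultimately show False using M by (simp add: preordering_def)
qed

text \<open>The value at a selfadjoint \<open>a\<close> is the supremum of the \<open>r\<close> with
  \<open>a - r\<close> in \<open>M\<close>; totality makes it bound \<open>a\<close> from above as
  well, up to every \<open>e > 0\<close>. Multiplicativity follows from the case of squares by
  polarization.\<close>

lemma character_of_total_preordering:
  assumes M: "preordering D M" and total: "\<And>a. a \<in> D \<Longrightarrow> star a = a \<Longrightarrow> a \<in> M \<or> - a \<in> M"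
  obtains \<rho> where "\<rho> \<in> characters D" "\<And>a. a \<in> M \<Longrightarrow> 0 \<le> \<rho> a"
proof -
  have MD: "x \<in> D" "star x = x" if "x \<in> M" for x using M that by (auto simp: preordering_def)
  have Madd: "x + y \<in> M" and Mmult: "x * y \<in> M" if "x \<in> M" "y \<in> M" for x y
    using M that by (auto simp: preordering_def)
  have Mpos: "x \<in> M" if "x \<in> D" "positive x" for x using M that by (auto simp: preordering_def)
  have Mreal: "of_real r \<in> M" if "0 \<le> r" for r
    using Mpos mem_inclusion_of_real positive_of_real that by blast
  have Mscale: "r *\<^sub>R x \<in> M" if "x \<in> M" "0 \<le> r" for r x
    using Mmult[OF Mreal[of r] that(1)] that(2) by (simp add: of_real_def)
  have nonneg: "0 \<le> r" if "of_real r \<in> M" for r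
  proof (rule ccontr)
    assume "\<not> 0 \<le> r"
    then have "(- 1 / r) *\<^sub>R of_real r \<in> M" using that by (intro Mscale) auto
    then show False using \<open>\<not> 0 \<le> r\<close> M by (simp add: of_real_def preordering_def)
  qed
  \<comment> \<open>\<open>M\<close> need not be closed, so a value is determined only with slack
    \<open>e\<close>. The algebraic laws are proved for this relation and then transferred to the
    value it determines.\<close>
  define near where "near a c \<longleftrightarrow> (\<forall>e>0. a - of_real c + of_real e \<in> M \<and> of_real c - a + of_real e \<in> M)"
    for a c
  have near_unique: "c = d" if "near a c" "near a d" for a c d
  proof -
    have "c \<le> d + e" if c: "near a c" and d: "near a d" and e: "0 < e" for c d e
    proof -
      have "of_real d - a + of_real (e/2) + (a - of_real c + of_real (e/2)) \<in> M"
        using c d e unfolding near_def by - (rule Madd, auto)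
      also have "of_real d - a + of_real (e/2) + (a - of_real c + of_real (e/2)) =
          (of_real (d + (e/2 + e/2) - c) :: 'a)"
        unfolding of_real_add of_real_diff by simp
      finally show ?thesis using nonneg[of "d + e - c"] by simp
    qed
    then show ?thesis using that by (meson antisym field_le_epsilon)
  qed
  have near_ex: "\<exists>c. near a c" if a: "a \<in> D" "star a = a" for a
  proof -
    define S where "S = {r. a - of_real r \<in> M}"
    have "a - of_real (- norm a) \<in> M"
      using positive_of_real_diff[of "- a" "norm a"] a mem_inclusion
      by (intro Mpos) (auto simp: add.commute intro: mem_inclusion mem_inclusion_of_real)
    then have ne: "- norm a \<in> S" by (simp add: S_def)
    have bdd: "r \<le> norm a" if "r \<in> S" for r
    proof -
      have "of_real (norm a) - a \<in> M"
        using a by (intro Mpos positive_of_real_diff mem_inclusion mem_inclusion_of_real) auto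
      then have "of_real (norm a) - a + (a - of_real r) \<in> M"
        using that by (intro Madd[of "of_real (norm a) - a"]) (simp_all add: S_def)
      then show ?thesis using nonneg[of "norm a - r"] by simp
    qed
    have S: "bdd_above S" "S \<noteq> {}" using ne bdd by (auto simp: bdd_above_def)
    have "near a (Sup S)"
      unfolding near_def
    proof (intro allI impI conjI)
      fix e :: real assume e: "0 < e"
      obtain r where r: "r \<in> S" "Sup S - e < r" using less_cSupD[of S "Sup S - e"] S e by auto
      have "a - of_real r + of_real (r - (Sup S - e)) \<in> M"
        using r by (intro Madd Mreal) (auto simp: S_def)
      then show "a - of_real (Sup S) + of_real e \<in> M" by (simp add: algebra_simps)
      have "Sup S + e \<notin> S" using S cSup_upper[of "Sup S + e" S] e by fastforce
      then have "- (a - of_real (Sup S + e)) \<in> M"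
        using total[of "a - of_real (Sup S + e)"] a
        by (auto simp: S_def intro: mem_inclusion mem_inclusion_of_real)
      then show "of_real (Sup S) - a + of_real e \<in> M" by (simp add: algebra_simps)
    qed
    then show ?thesis by blast
  qed
  define \<phi> where "\<phi> a = (SOME c. near a c)" for a
  have phi: "near a (\<phi> a)" if "a \<in> D" "star a = a" for a
    using near_ex[OF that] unfolding \<phi>_def by (rule someI_ex)
  have phi_eq: "\<phi> a = c" if "near a c" for a c
    unfolding \<phi>_def by (rule some_equality, rule that, erule near_unique[OF _ that])
  have near_add: "near (a + b) (c + d)" if "near a c" "near b d" for a b c d
    unfolding near_def
  proof (intro allI impI conjI)
    fix e :: real assume "0 < e"
    then have e: "0 < e/2" by simp
    have "(a - of_real c + of_real (e/2)) + (b - of_real d + of_real (e/2)) \<in> M"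
      using that e unfolding near_def by - (rule Madd, auto)
    also have "(a - of_real c + of_real (e/2)) + (b - of_real d + of_real (e/2)) =
        (a + b) - of_real (c + d) + of_real (e/2 + e/2)"
      unfolding of_real_add by (simp only: diff_conv_add_uminus minus_add_distrib ac_simps)
    finally show "(a + b) - of_real (c + d) + of_real e \<in> M" by simp
    have "(of_real c - a + of_real (e/2)) + (of_real d - b + of_real (e/2)) \<in> M"
      using that e unfolding near_def by - (rule Madd, auto)
    also have "(of_real c - a + of_real (e/2)) + (of_real d - b + of_real (e/2)) =
        of_real (c + d) - (a + b) + of_real (e/2 + e/2)"
      unfolding of_real_add by (simp only: diff_conv_add_uminus minus_add_distrib ac_simps)
    finally show "of_real (c + d) - (a + b) + of_real e \<in> M" by simp
  qed
  have near_real: "near (of_real c) c" for c by (auto simp: near_def intro!: Mreal)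
  have near_minus: "near (- a) (- c)" if "near a c" for a c
    using that unfolding near_def by (simp add: algebra_simps)
  have near_pos: "near (r *\<^sub>R a) (r * c)" if n: "near a c" and r: "0 < r" for r a c
    unfolding near_def
  proof (intro allI impI conjI)
    fix e :: real assume e: "0 < e"
    then have e: "0 < e / r" using r by simp
    have "r *\<^sub>R (a - of_real c + of_real (e / r)) \<in> M" "r *\<^sub>R (of_real c - a + of_real (e / r)) \<in> M"
      using n e r unfolding near_def by (auto intro!: Mscale)
    then show "r *\<^sub>R a - of_real (r * c) + of_real e \<in> M" "of_real (r * c) - r *\<^sub>R a + of_real e \<in> M"
      using r by (simp_all add: of_real_def scaleR_add_right scaleR_diff_right)
  qed
  have near_scale: "near (r *\<^sub>R a) (r * c)" if "near a c" for r a c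
  proof -
    consider "0 < r" | "r = 0" | "r < 0" by linarith
    then show ?thesis
    proof cases
      case 2
      then show ?thesis using near_real[of 0] by simp
    next
      case 3
      then show ?thesis using near_pos[OF near_minus[OF that], of "- r"] by simp
    qed (use near_pos that in auto)
  qed
  \<comment> \<open>The upper bound comes from
    \<open>e - b * b = (b + sqrt e) * (sqrt e - b)\<close>, a product of two elements of
    \<open>M\<close>.\<close>
  have near_sq0: "near (b * b) 0" if b: "near b 0" "b \<in> D" "star b = b" for b
    unfolding near_def
  proof (intro allI impI conjI)
    fix e :: real assume e: "0 < e"
    have bb: "b * b \<in> M" using b by (intro Mpos positive_square mem_inclusion)
    then show "b * b - of_real 0 + of_real e \<in> M"
      using Madd[OF bb Mreal[of e]] e by simp
    have e': "0 < sqrt e" using e by simp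
    have "(b - of_real 0 + of_real (sqrt e)) * (of_real 0 - b + of_real (sqrt e)) \<in> M"
      using b(1) e' unfolding near_def by (blast intro: Mmult)
    also have "(b - of_real 0 + of_real (sqrt e)) * (of_real 0 - b + of_real (sqrt e)) =
        of_real 0 - b * b + of_real (sqrt e * sqrt e)"
      by (simp add: of_real_def algebra_simps)
    finally show "of_real 0 - b * b + of_real e \<in> M" using e by simp
  qed
  have near_sq: "near (a * a) (c * c)" if a: "near a c" "a \<in> D" "star a = a" for a c
  proof -
    define b where "b = a + of_real (- c)"
    have b0: "near b 0" using near_add[OF a(1) near_real[of "- c"]] by (simp add: b_def)
    have b: "b \<in> D" "star b = b"
      using a by (auto simp: b_def intro!: mem_inclusion mem_inclusion_of_real)
    have "near (b * b + (c *\<^sub>R b + c *\<^sub>R b) + of_real (c * c)) (0 + (c * 0 + c * 0) + c * c)"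
      by (intro near_add near_sq0 near_scale near_real b0 b)
    moreover have "b * b + (c *\<^sub>R b + c *\<^sub>R b) + of_real (c * c) = a * a"
      by (simp add: b_def of_real_def algebra_simps)
    ultimately show ?thesis by simp
  qed
  have phi_add: "\<phi> (a + b) = \<phi> a + \<phi> b" if "a \<in> D" "b \<in> D" "star a = a" "star b = b" for a b
    using that phi by (intro phi_eq near_add) auto
  have phi_scale: "\<phi> (r *\<^sub>R a) = r * \<phi> a" if "a \<in> D" "star a = a" for r a
    using that phi by (intro phi_eq near_scale) auto
  have phi_sq: "\<phi> (a * a) = \<phi> a * \<phi> a" if "a \<in> D" "star a = a" for a
    using that phi by (intro phi_eq near_sq) auto
  have phi_mult: "\<phi> (a * b) = \<phi> a * \<phi> b" if ab: "a \<in> D" "b \<in> D" "star a = a" "star b = b" for a b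
  proof -
    have s: "star (a * b) = a * b" using ab comm by simp
    have "(a + b) * (a + b) = a * a + (b * b + 2 *\<^sub>R (a * b))"
      using comm[OF ab(1,2)] by (simp add: algebra_simps scaleR_2)
    then have "\<phi> ((a + b) * (a + b)) = \<phi> (a * a) + (\<phi> (b * b) + 2 * \<phi> (a * b))"
      using ab s by (simp add: phi_add phi_scale mem_inclusion)
    moreover have "\<phi> ((a + b) * (a + b)) = (\<phi> a + \<phi> b) * (\<phi> a + \<phi> b)"
      using ab by (simp add: phi_sq phi_add mem_inclusion)
    ultimately show ?thesis using ab by (simp add: phi_sq algebra_simps)
  qed
  obtain f where f: "f \<in> functionals D"
    and f_phi: "\<And>a. a \<in> D \<Longrightarrow> star a = a \<Longrightarrow> f a = complex_of_real (\<phi> a)"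
    using functionals_complexify[of D \<phi>] phi_add phi_scale inclusionD(1)[OF D] by metis
  have f_mult: "f (x * y) = f x * f y" if xy: "x \<in> D" "y \<in> D" for x y
  proof -
    define a b c d where abcd: "a = re_part x" "b = im_part x" "c = re_part y" "d = im_part y"
    have mem: "a \<in> D" "b \<in> D" "c \<in> D" "d \<in> D" using xy by (auto simp: abcd intro: mem_inclusion)
    have sa: "star a = a" "star b = b" "star c = c" "star d = d" by (simp_all add: abcd)
    have x: "x = a + scaleC \<i> b" and y: "y = c + scaleC \<i> d"
      using cartesian by (auto simp: abcd)
    have "x * y = (a * c + scaleC (-1) (b * d)) + scaleC \<i> (a * d + b * c)"
      by (simp add: x y algebra_simps scaleC_mult_left scaleC_mult_right scaleC_scaleC
          cvec.scale_right_distrib)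
    then have "f (x * y) = (f (a * c) - f (b * d)) + \<i> * (f (a * d) + f (b * c))"
      using mem by (simp add: functionalsD[OF f] mem_inclusion del: cvec.scale_minus_left)
    moreover have "f (p * q) = f p * f q" if "p \<in> D" "q \<in> D" "star p = p" "star q = q" for p q
    proof -
      have "star (p * q) = p * q" using that comm by simp
      then show ?thesis using that by (simp add: f_phi phi_mult mem_inclusion)
    qed
    ultimately show ?thesis
      using mem sa by (simp add: x y functionalsD[OF f] mem_inclusion algebra_simps)
  qed
  have "f 1 = 1" using f_phi[of 1] phi_eq[OF near_real[of 1]] mem_inclusion by simp
  then have "\<exists>x\<in>D. f x \<noteq> 0" using mem_inclusion by (intro bexI[of _ 1]) auto
  then have "f \<in> characters D" using f f_mult by (simp add: characters_def)
  moreover have "0 \<le> f a" if "a \<in> M" for a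
  proof -
    have "0 \<le> \<phi> a + e" if e: "0 < e" for e
    proof -
      have "of_real (\<phi> a) - a + of_real e \<in> M"
        using phi[of a] e MD \<open>a \<in> M\<close> by (simp add: near_def)
      then have "of_real (\<phi> a) - a + of_real e + a \<in> M" using \<open>a \<in> M\<close> by (rule Madd)
      then show ?thesis using nonneg[of "\<phi> a + e"] by (simp add: algebra_simps)
    qed
    then have "0 \<le> \<phi> a" by (rule field_le_epsilon)
    then show ?thesis using f_phi[of a] MD that by (simp add: less_eq_complex_def)
  qed
  ultimately show ?thesis using that by blast
qed

theorem character_of_preordering:
  assumes "preordering D T"
  obtains \<rho> where "\<rho> \<in> characters D" "\<And>a. a \<in> T \<Longrightarrow> 0 \<le> \<rho> a"
proof -
  define \<A> where "\<A> = {T'. preordering D T' \<and> T \<subseteq> T'}"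
  have "\<exists>M\<in>\<A>. \<forall>X\<in>\<A>. M \<subseteq> X \<longrightarrow> X = M"
  proof (rule subset_Zorn_nonempty)
    show "\<A> \<noteq> {}" using assms by (auto simp: \<A>_def)
    fix \<C> assume C: "\<C> \<noteq> {}" "subset.chain \<A> \<C>"
    then have P: "preordering D X" "T \<subseteq> X" if "X \<in> \<C>" for X
      using that by (auto simp: \<A>_def subset.chain_def)
    have "a + b \<in> \<Union>\<C> \<and> a * b \<in> \<Union>\<C>" if ab: "a \<in> \<Union>\<C>" "b \<in> \<Union>\<C>" for a b
    proof -
      obtain X Y where XY: "X \<in> \<C>" "Y \<in> \<C>" "a \<in> X" "b \<in> Y" using ab by blast
      then have "X \<subseteq> Y \<or> Y \<subseteq> X" using C(2) by (auto simp: subset_chain_def)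
      then obtain Z where "Z \<in> \<C>" "a \<in> Z" "b \<in> Z" using XY by blast
      then show ?thesis using P(1)[of Z] unfolding preordering_def by blast
    qed
    moreover have "\<forall>a\<in>\<Union>\<C>. a \<in> D \<and> star a = a" "-1 \<notin> \<Union>\<C>"
      using P(1) unfolding preordering_def by blast+
    moreover have "\<forall>a\<in>D. positive a \<longrightarrow> a \<in> \<Union>\<C>"
      using P(1) C(1) unfolding preordering_def by blast
    ultimately have "preordering D (\<Union>\<C>)" unfolding preordering_def by blast
    moreover have "T \<subseteq> \<Union>\<C>" using P C(1) by blast
    ultimately show "\<Union>\<C> \<in> \<A>" by (simp add: \<A>_def)
  qed
  then obtain M where "M \<in> \<A>" and max: "\<forall>X\<in>\<A>. M \<subseteq> X \<longrightarrow> X = M" by (elim bexE)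
  then have M: "preordering D M" "T \<subseteq> M" by (auto simp: \<A>_def)
  have "a \<in> M \<or> - a \<in> M" if "a \<in> D" "star a = a" for a
  proof (rule preordering_total[OF M(1) _ that])
    fix X assume "preordering D X" "M \<subseteq> X"
    then show "X = M" using max M(2) by (auto simp: \<A>_def)
  qed
  then obtain \<rho> where "\<rho> \<in> characters D" "\<And>a. a \<in> M \<Longrightarrow> 0 \<le> \<rho> a"
    using character_of_total_preordering[OF M(1)] by blast
  then show ?thesis using that M(2) by blast
qed

end

section \<open>Order, norm and square roots read off from characters\<close>

lemma charactersD:
  assumes "\<rho> \<in> characters D"
  shows "\<rho> \<in> functionals D" "x \<in> D \<Longrightarrow> y \<in> D \<Longrightarrow> \<rho> (x + y) = \<rho> x + \<rho> y"
    "x \<in> D \<Longrightarrow> \<rho> (scaleC c x) = c * \<rho> x"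
    "x \<in> D \<Longrightarrow> \<rho> (r *\<^sub>R x) = complex_of_real r * \<rho> x"
    "x \<in> D \<Longrightarrow> y \<in> D \<Longrightarrow> \<rho> (x * y) = \<rho> x * \<rho> y" "\<rho> \<in> extensional D"
  using assms by (auto simp: characters_def functionalsD)

context
  fixes D :: "'a::cstar_algebra set"
  assumes D: "inclusion D"
  notes mem = mem_inclusion[OF D]
    and subalg = inclusionD(1)[OF D]
begin

lemma character_one [simp]: assumes "\<rho> \<in> characters D" shows "\<rho> 1 = 1"
proof -
  obtain x where "x \<in> D" "\<rho> x \<noteq> 0" using assms by (auto simp: characters_def)
  moreover have "\<rho> (x * 1) = \<rho> x * \<rho> 1" using assms \<open>x \<in> D\<close> mem by (intro charactersD)
  ultimately show ?thesis by simp
qed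

lemma character_of_real:
  assumes "\<rho> \<in> characters D" shows "\<rho> (of_real r) = complex_of_real r"
  using charactersD(4)[OF assms, of 1 r] assms mem by (simp add: of_real_def)

lemma character_diff:
  assumes "\<rho> \<in> characters D" "x \<in> D" "y \<in> D"
  shows "\<rho> (x - y) = \<rho> x - \<rho> y" "\<rho> (- x) = - \<rho> x" "\<rho> 0 = 0"
  using functionals_diff[OF subalg charactersD(1)[OF assms(1)] assms(2,3)] by auto

text \<open>If \<open>\<rho> x = a + \<i> b\<close> with \<open>b \<noteq> 0\<close>, then
  \<open>y = x - a\<close> has the value \<open>\<i> b\<close>, so \<open>\<rho>\<close> kills
  \<open>b * b + y * y\<close>; but this element is invertible in \<open>D\<close>.\<close>

lemma character_selfadjoint:
  assumes r: "\<rho> \<in> characters D" and x: "x \<in> D" "star x = x"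
  shows "\<rho> x = complex_of_real (Re (\<rho> x))"
proof (rule ccontr)
  assume ne: "\<not> ?thesis"
  define a b where "a = Re (\<rho> x)" and "b = Im (\<rho> x)"
  have b: "b \<noteq> 0" using ne by (auto simp: b_def complex_eq_iff)
  define y where "y = x - of_real a"
  have y: "y \<in> D" "star y = y" using x mem by (auto simp: y_def)
  have ry: "\<rho> y = \<i> * complex_of_real b"
    using r x mem by (simp add: y_def character_diff character_of_real a_def b_def complex_eq_iff)
  obtain q where q: "q \<in> D" "(of_real (b * b) + y * y) * q = 1"
    using positive_invertible[OF positive_square[OF y(2)] _ subalg, of "b * b"] b y mem
    by (metis not_real_square_gt_zero)
  have "\<rho> (of_real (b * b) + y * y) * \<rho> q = \<rho> ((of_real (b * b) + y * y) * q)"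
    using r y q mem by (intro charactersD(5)[symmetric]) auto
  also have "\<dots> = 1" using q r by simp
  finally have "\<rho> (of_real (b * b) + y * y) \<noteq> 0" by auto
  moreover have "\<rho> (of_real (b * b) + y * y) = of_real (b * b) + \<rho> y * \<rho> y"
    using r y mem by (simp only: charactersD(2,5)[OF r] character_of_real[OF r])
  ultimately show False by (simp add: ry algebra_simps)
qed

lemma character_star:
  assumes r: "\<rho> \<in> characters D" and x: "x \<in> D"
  shows "\<rho> (star x) = cnj (\<rho> x)"
proof -
  define a b where "a = re_part x" and "b = im_part x"
  have ab: "a \<in> D" "b \<in> D" "star a = a" "star b = b" using x mem by (auto simp: a_def b_def)
  have xa: "x = a + scaleC \<i> b" using cartesian by (simp add: a_def b_def)
  have sx: "star x = a + scaleC (- \<i>) b" by (simp add: xa ab)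
  obtain s t where st: "\<rho> a = complex_of_real s" "\<rho> b = complex_of_real t"
    using character_selfadjoint[OF r] ab by metis
  have "\<rho> (star x) = s + (- \<i>) * t"
    using ab mem unfolding sx by (simp only: charactersD(2,3)[OF r] st)
  moreover have "\<rho> x = s + \<i> * t"
    using ab mem unfolding xa by (simp only: charactersD(2,3)[OF r] st)
  ultimately show ?thesis by simp
qed

lemma character_positive:
  assumes r: "\<rho> \<in> characters D" and a: "a \<in> D" "positive a"
  shows "0 \<le> \<rho> a"
proof -
  have "0 \<le> Re (\<rho> a) + e" if e: "0 < e" for e
  proof -
    obtain y where y: "y \<in> D" "star y = y" "y * y = a + of_real e"
      using positive_sqrt_approx[OF a(2) subalg _ a(1) e] mem by metis
    have "\<rho> a + of_real e = \<rho> y * \<rho> y"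
      using charactersD(5)[OF r y(1) y(1)] charactersD(2)[OF r a(1), of "of_real e"] mem y
      by (simp add: character_of_real[OF r])
    also have "\<dots> = complex_of_real (Re (\<rho> y) * Re (\<rho> y))"
      using character_selfadjoint[OF r y(1,2)] by (metis of_real_mult)
    finally have "Re (\<rho> a) + e = Re (\<rho> y) * Re (\<rho> y)" by (simp add: complex_eq_iff)
    then show ?thesis by simp
  qed
  then have "0 \<le> Re (\<rho> a)" by (rule field_le_epsilon)
  then show ?thesis using character_selfadjoint[OF r a(1) positive_star[OF a(2)]]
    by (simp add: less_eq_complex_def complex_eq_iff)
qed

text \<open>A Positivstellensatz. The element \<open>b = a + e\<close> is strictly positive at every
  character, so \<open>P - b * P\<close> is not a proper preordering and contains
  \<open>- 1\<close>. This gives a certificate \<open>b * q = 1 + p\<close> with positive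
  \<open>p\<close> and \<open>q\<close>, from which \<open>b \<ge> 0\<close> is extracted by
  repeatedly improving a lower bound.\<close>

lemma positive_of_characters:
  assumes a: "a \<in> D" "star a = a" and pos: "\<And>\<rho>. \<rho> \<in> characters D \<Longrightarrow> 0 \<le> \<rho> a"
  shows "positive a"
proof (rule positive_approx)
  fix e :: real assume e: "0 < e"
  define b where "b = a + of_real e"
  have b: "b \<in> D" "star b = b" using a mem by (auto simp: b_def)
  define P where "P = {p \<in> D. positive p}"
  have P: "0 \<in> P" "p \<in> P \<Longrightarrow> q \<in> P \<Longrightarrow> p + q \<in> P" "p \<in> P \<Longrightarrow> q \<in> P \<Longrightarrow> p * q \<in> P" for p q
    using mem positive_add positive_mult[OF D] by (auto simp: P_def)
  have PD: "p \<in> D" "star p = p" if "p \<in> P" for p using that by (auto simp: P_def positive_star)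
  have bb: "b * b \<in> P" using b mem positive_square by (auto simp: P_def)
  define T where "T = {p - b * q | p q. p \<in> P \<and> q \<in> P}"
  have TI: "p - b * q \<in> T" if "p \<in> P" "q \<in> P" for p q using that by (auto simp: T_def)
  have "\<exists>p\<in>P. \<exists>q\<in>P. - 1 = p - b * q"
  proof (rule ccontr)
    assume no: "\<not> ?thesis"
    have "preordering D T"
      unfolding preordering_def
    proof (intro conjI ballI impI)
      fix x assume "x \<in> T"
      then obtain p q where x: "x = p - b * q" "p \<in> P" "q \<in> P" by (auto simp: T_def)
      show "x \<in> D" using x PD b mem by auto
      show "star x = x" using x PD b inclusionD(3)[OF D] by simp
    next
      fix x assume "x \<in> D" "positive x"
      then show "x \<in> T" using TI[of x 0] P by (simp add: P_def)
    next
      fix x y assume "x \<in> T" "y \<in> T"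
      then obtain p q p' q' where x: "x = p - b * q" "p \<in> P" "q \<in> P"
        and y: "y = p' - b * q'" "p' \<in> P" "q' \<in> P" by (auto simp: T_def)
      have "x + y = (p + p') - b * (q + q')" by (simp add: x(1) y(1) algebra_simps)
      then show "x + y \<in> T"
        using TI[OF P(2)[OF x(2) y(2)] P(2)[OF x(3) y(3)]] by (simp only:)
      have "x * y = p * p' - (p * b) * q' - b * (q * p') + b * ((q * b) * q')"
        by (simp add: x(1) y(1) algebra_simps)
      moreover have "p * b = b * p" "q * b = b * q"
        using x PD b by (auto intro: inclusionD(3)[OF D])
      ultimately have "x * y = (p * p' + b * b * (q * q')) - b * (p * q' + q * p')"
        by (simp only:) (simp add: algebra_simps)
      then show "x * y \<in> T"
        using TI[OF P(2)[OF P(3)[OF x(2) y(2)] P(3)[OF bb P(3)[OF x(3) y(3)]]]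
          P(2)[OF P(3)[OF x(2) y(3)] P(3)[OF x(3) y(2)]]] by (simp only:)
    next
      show "- 1 \<notin> T" using no by (auto simp: T_def)
    qed
    then obtain \<rho> where r: "\<rho> \<in> characters D" "\<And>x. x \<in> T \<Longrightarrow> 0 \<le> \<rho> x"
      by (rule character_of_preordering[OF D]) blast
    have "- b \<in> T" using TI[of 0 1] P mem by (simp add: P_def)
    then have "0 \<le> \<rho> (- b)" by (rule r)
    also have "\<rho> (- b) = - (\<rho> a + of_real e)"
      using r(1) a b mem by (simp add: character_diff b_def charactersD(2) character_of_real)
    finally show False using pos[OF r(1)] e by (simp add: less_eq_complex_def)
  qed
  then obtain p q where pq: "p \<in> P" "q \<in> P" "- 1 = p - b * q" by blast
  have bq: "b * q = 1 + p" using pq(3) by (simp add: algebra_simps)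
  \<comment> \<open>Large enough for \<open>n - q\<close> to be positive; \<open>1 / n\<close> is
    the gain in each round.\<close>
  define n where "n = norm q + 1"
  have n: "n > 0" by (simp add: n_def add_nonneg_pos)
  text \<open>Multiplying \<open>b + r\<close> by \<open>n - q \<ge> 0\<close> shows that \<open>b + r \<ge> 0\<close> can be improved to
    \<open>b + r - 1/n \<ge> 0\<close>.\<close>
  have step: "positive (b + of_real (r - 1 / n))" if r: "0 \<le> r" "positive (b + of_real r)" for r
  proof -
    have nq: "positive (of_real n - q)"
      using PD pq by (intro positive_of_real_diff) (auto simp: n_def)
    have "positive ((of_real n - q) * (b + of_real r) + (p + r *\<^sub>R q))"
    proof (rule positive_add[OF positive_mult[OF D _ _ nq r(2)] positive_add[OF _ positive_scaleR[OF _ r(1)]]])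
      show "of_real n - q \<in> D" "b + of_real r \<in> D" using PD(1)[OF pq(2)] b(1) mem by auto
      show "positive p" "positive q" using pq(1,2) by (simp_all add: P_def)
    qed
    \<comment> \<open>In the expansion \<open>q * b = 1 + p\<close> absorbs \<open>p\<close> and
      leaves \<open>- 1\<close>; the two terms \<open>r * q\<close> cancel.\<close>
    moreover have "(of_real n - q) * (b + of_real r) + (p + r *\<^sub>R q) = n *\<^sub>R (b + of_real (r - 1 / n))"
    proof -
      have "q * b = 1 + p" using bq inclusionD(3)[OF D b(1) PD(1)[OF pq(2)]] by simp
      then show ?thesis using n by (simp add: of_real_def algebra_simps)
    qed
    ultimately have "positive (n *\<^sub>R (b + of_real (r - 1 / n)))" by simp
    from positive_scaleR[OF this, of "1 / n"] show ?thesis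
      using n by (simp only: scaleR_scaleR) simp
  qed
  \<comment> \<open>The start is \<open>b + norm b \<ge> 0\<close>. The maximum with
    \<open>0\<close> keeps the hypothesis \<open>0 \<le> r\<close> of \<open>step\<close> valid when
    a round overshoots.\<close>
  have iter: "positive (b + of_real (max 0 (norm b - real k / n)))" for k
  proof (induction k)
    case 0
    have "positive (of_real (norm b) - (- b))" using b by (intro positive_of_real_diff) auto
    then show ?case by (simp add: add.commute)
  next
    case (Suc k)
    define r where "r = max 0 (norm b - real k / n)"
    have "positive (b + of_real (r - 1 / n) + of_real (max 0 (norm b - real (Suc k) / n) - (r - 1 / n)))"
    proof (rule positive_add)
      show "positive (b + of_real (r - 1 / n))" using Suc by (intro step) (auto simp: r_def)
      have "real (Suc k) / n = real k / n + 1 / n" "0 < 1 / n"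
        using n by (simp_all add: add_divide_distrib)
      then show "positive (of_real (max 0 (norm b - real (Suc k) / n) - (r - 1 / n)) :: 'a)"
        unfolding r_def by (intro positive_of_real) linarith
    qed
    then show ?case by (simp add: add.assoc flip: of_real_add)
  qed
  obtain k :: nat where k: "norm b * n \<le> real k" using real_arch_simple by blast
  then have "norm b \<le> real k / n" using n by (simp add: pos_le_divide_eq)
  then have "max 0 (norm b - real k / n) = 0" by simp
  then show "positive (a + of_real e)" using iter[of k] by (simp add: b_def)
qed

lemma norm_le_of_characters:
  assumes a: "a \<in> D" "star a = a" and t: "0 \<le> t"
    and le: "\<And>\<rho>. \<rho> \<in> characters D \<Longrightarrow> cmod (\<rho> a) \<le> t"
  shows "norm a \<le> t"
proof (rule norm_le_of_positive[OF _ _ t])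
  have *: "\<rho> a = complex_of_real (Re (\<rho> a))" "\<bar>Re (\<rho> a)\<bar> \<le> t" if "\<rho> \<in> characters D" for \<rho>
    using character_selfadjoint[OF that a] le[OF that] abs_Re_le_cmod[of "\<rho> a"] by auto
  show "positive (of_real t - a)"
  proof (rule positive_of_characters)
    show "0 \<le> \<rho> (of_real t - a)" if "\<rho> \<in> characters D" for \<rho>
      using *[OF that] a mem that
      by (subst character_diff) (auto simp: character_of_real less_eq_complex_def complex_eq_iff)
  qed (use a mem in auto)
  show "positive (of_real t + a)"
  proof (rule positive_of_characters)
    show "0 \<le> \<rho> (of_real t + a)" if "\<rho> \<in> characters D" for \<rho>
      using *[OF that] a mem that
      by (subst charactersD) (auto simp: character_of_real less_eq_complex_def complex_eq_iff)
  qed (use a mem in auto)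
qed

lemma zero_of_characters:
  assumes a: "a \<in> D" and 0: "\<And>\<rho>. \<rho> \<in> characters D \<Longrightarrow> \<rho> a = 0"
  shows "a = 0"
proof -
  have "norm (star a * a) \<le> 0"
    using a mem 0 by (intro norm_le_of_characters) (auto simp: charactersD)
  then show ?thesis using cstar_identity[of a] by simp
qed

text \<open>The roots \<open>s n\<close> of \<open>a + \<epsilon> n\<close> form a Cauchy sequence:
  at each character the values of \<open>s m\<close> and \<open>s n\<close> satisfy
  \<open>(u - v)^2 \<le> u^2 - v^2 \<le> \<epsilon> m\<close>, and characters control the norm. The
  limit is an exact root.\<close>

lemma positive_sqrt:
  assumes a: "a \<in> D" "positive a"
  obtains b where "b \<in> D" "positive b" "b * b = a"
proof -
  define \<epsilon> where "\<epsilon> n = 1 / real (Suc n)" for n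
  have eps: "0 < \<epsilon> n" for n by (simp add: \<epsilon>_def)
  have "\<exists>y\<in>D. y * y = a + of_real (\<epsilon> n) \<and> positive y" for n
    using positive_sqrt_approx[OF a(2) subalg _ a(1) eps] mem by metis
  then obtain s where s: "\<And>n. s n \<in> D" "\<And>n. s n * s n = a + of_real (\<epsilon> n)" "\<And>n. positive (s n)"
    by metis
  have close: "norm (s m - s n) \<le> sqrt (\<epsilon> m)" if mn: "m \<le> n" for m n
  proof (rule norm_le_of_characters)
    fix \<rho> assume r: "\<rho> \<in> characters D"
    have sq: "(Re (\<rho> (s k)))\<^sup>2 = Re (\<rho> a) + \<epsilon> k \<and> 0 \<le> Re (\<rho> (s k)) \<and> Im (\<rho> (s k)) = 0" for k
    proof -
      have "\<rho> (s k) * \<rho> (s k) = \<rho> a + \<epsilon> k"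
        using charactersD(5)[OF r s(1) s(1), of k k] charactersD(2)[OF r a(1), of "of_real (\<epsilon> k)"] mem
        by (simp add: s(2) character_of_real[OF r])
      moreover have "0 \<le> \<rho> (s k)" using s r by (intro character_positive)
      ultimately show ?thesis
        by (auto simp: complex_eq_iff less_eq_complex_def power2_eq_square)
    qed
    define u v where "u = Re (\<rho> (s m))" and "v = Re (\<rho> (s n))"
    have uv: "u\<^sup>2 = Re (\<rho> a) + \<epsilon> m" "v\<^sup>2 = Re (\<rho> a) + \<epsilon> n" "0 \<le> u" "0 \<le> v"
      using sq by (auto simp: u_def v_def)
    have "\<epsilon> n \<le> \<epsilon> m" using mn by (simp add: \<epsilon>_def frac_le)
    then have "v\<^sup>2 \<le> u\<^sup>2" unfolding uv by simp
    then have vu: "v \<le> u" using uv(3) by (rule power2_le_imp_le)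
    have "(u - v)\<^sup>2 \<le> (u - v) * (u + v)"
      using vu uv by (auto simp: power2_eq_square intro: mult_left_mono)
    also have "\<dots> = u\<^sup>2 - v\<^sup>2" by (simp add: power2_eq_square algebra_simps)
    also have "\<dots> \<le> \<epsilon> m" using uv eps[of n] by simp
    finally have "u - v \<le> sqrt (\<epsilon> m)" by (rule real_le_rsqrt)
    moreover have "\<rho> (s m - s n) = complex_of_real (u - v)"
      using sq r s by (simp add: character_diff u_def v_def complex_eq_iff)
    ultimately show "cmod (\<rho> (s m - s n)) \<le> sqrt (\<epsilon> m)" using vu by (simp only: norm_of_real)
  qed (use s(1) mem positive_star[OF s(3)] in \<open>auto simp: \<epsilon>_def\<close>)
  have "\<epsilon> \<longlonglongrightarrow> 0" unfolding \<epsilon>_def by (rule lim_1_over_n[THEN LIMSEQ_Suc])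
  then have lim: "(\<lambda>n. sqrt (\<epsilon> n)) \<longlonglongrightarrow> 0" using tendsto_real_sqrt by fastforce
  have "Cauchy s"
  proof (rule metric_CauchyI)
    fix e :: real assume "0 < e"
    then obtain N where "\<And>n. n \<ge> N \<Longrightarrow> sqrt (\<epsilon> n) < e/2"
      using order_tendstoD(2)[OF lim, of "e/2"] by (auto simp: eventually_sequentially)
    then have N: "sqrt (\<epsilon> N) < e/2" by simp
    have "dist (s m) (s n) < e" if "m \<ge> N" "n \<ge> N" for m n
    proof -
      have "dist (s N) (s m) < e/2" "dist (s N) (s n) < e/2"
        using close[of N m] close[of N n] that N by (auto simp: dist_norm)
      then show ?thesis by (metis dist_triangle_half_r)
    qed
    then show "\<exists>M. \<forall>m\<ge>M. \<forall>n\<ge>M. dist (s m) (s n) < e" by blast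
  qed
  then obtain b where b: "s \<longlonglongrightarrow> b" by (meson Cauchy_convergent convergent_def)
  have "b \<in> D" using closed_sequentially[OF cstar_subalgebraD(6)[OF subalg]] s b by blast
  moreover have "positive b"
    using closed_sequentially[OF closed_positive, of s b] s b by simp
  moreover have "b * b = a"
  proof -
    have "(\<lambda>n. s n * s n) \<longlonglongrightarrow> b * b" by (intro tendsto_intros b)
    moreover have "(\<lambda>n. s n * s n) \<longlonglongrightarrow> a + of_real 0"
      unfolding s(2) by (intro tendsto_intros \<open>\<epsilon> \<longlonglongrightarrow> 0\<close>)
    ultimately show ?thesis using LIMSEQ_unique by fastforce
  qed
  ultimately show ?thesis using that by blast
qed

text \<open>Half of \<open>c + a\<close>, where \<open>c\<close> is the absolute value of
  \<open>a\<close>, the root of \<open>a * a\<close>. The values at characters are what the later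
  bump constructions use.\<close>

lemma positive_part:
  assumes a: "a \<in> D" "star a = a"
  obtains b where "b \<in> D" "positive b"
    "\<And>\<rho>. \<rho> \<in> characters D \<Longrightarrow> \<rho> b = complex_of_real (max 0 (Re (\<rho> a)))"
proof -
  have "a * a \<in> D" "positive (a * a)" using a mem positive_square by auto
  then obtain c where c: "c \<in> D" "positive c" "c * c = a * a" by (rule positive_sqrt)
  define b where "b = (1/2) *\<^sub>R (c + a)"
  have b: "b \<in> D" "star b = b" using c a mem positive_star by (auto simp: b_def)
  have rb: "\<rho> b = complex_of_real (max 0 (Re (\<rho> a)))" if r: "\<rho> \<in> characters D" for \<rho>
  proof -
    have "\<rho> c * \<rho> c = \<rho> a * \<rho> a" using c(3) a c charactersD(5)[OF r] by metis
    moreover have c0: "0 \<le> Re (\<rho> c)" "\<rho> c = of_real (Re (\<rho> c))"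
      using character_positive[OF r c(1,2)] by (auto simp: less_eq_complex_def complex_eq_iff)
    moreover have "\<rho> a = of_real (Re (\<rho> a))" using character_selfadjoint[OF r a] .
    ultimately have "Re (\<rho> c) * Re (\<rho> c) = Re (\<rho> a) * Re (\<rho> a)"
      by (metis of_real_eq_iff of_real_mult)
    then have "Re (\<rho> c) = \<bar>Re (\<rho> a)\<bar>"
      using c0(1) power2_eq_iff_nonneg[of "Re (\<rho> c)" "\<bar>Re (\<rho> a)\<bar>"] by (simp add: power2_eq_square)
    then have "\<rho> c = of_real \<bar>Re (\<rho> a)\<bar>" using c0(2) by simp
    moreover have "\<rho> b = (\<rho> c + \<rho> a) / 2"
      using a c mem by (simp add: b_def charactersD[OF r])
    ultimately show ?thesis using character_selfadjoint[OF r a]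
      by (auto simp: complex_eq_iff max_def)
  qed
  have "positive b"
  proof (rule positive_of_characters[OF b])
    show "0 \<le> \<rho> b" if "\<rho> \<in> characters D" for \<rho>
      unfolding rb[OF that] by (simp add: less_eq_complex_def)
  qed
  then show ?thesis using that b rb by blast
qed

end

lemma character_norm_le:
  assumes D: "inclusion D" and r: "\<rho> \<in> characters D" and a: "a \<in> D" "star a = a"
  shows "Re (\<rho> a) \<le> norm a"
proof -
  have "0 \<le> \<rho> (of_real (norm a) - a)"
    using a mem_inclusion[OF D] by (intro character_positive[OF D r] positive_of_real_diff) auto
  then show ?thesis
    using a mem_inclusion[OF D] r
    by (simp add: character_diff[OF D r] character_of_real[OF D r] less_eq_complex_def)
qed

section \<open>Positivity of \<open>x\<^sup>* x\<close>\<close>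

text \<open>For \<open>y = p + \<i> q\<close> the commutator terms cancel in the sum. Hence
  \<open>y * star y\<close> is positive as soon as \<open>- (star y * y)\<close> is.\<close>

lemma selfadjoint_products_add:
  fixes y :: "'a::cstar_algebra"
  obtains p q where "star p = p" "star q = q" "star y * y + y * star y = (p * p + q * q) + (p * p + q * q)"
proof -
  define p q where "p = re_part y" and "q = im_part y"
  have y: "y = p + scaleC \<i> q" using cartesian by (simp add: p_def q_def)
  have pq: "star p = p" "star q = q" by (simp_all add: p_def q_def)
  have "star y * y + y * star y = (p * p + q * q) + (p * p + q * q)"
    by (simp add: y pq algebra_simps scaleC_mult_left scaleC_mult_right scaleC_scaleC)
  with pq show ?thesis using that by blast
qed

text \<open>Kaplansky's argument. Let \<open>b\<close> be the negative part of \<open>h\<close>. For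
  \<open>y = x * b\<close> the element \<open>c = - (star y * y)\<close> is the cube of
  \<open>b\<close>, hence positive, and so \<open>y * star y\<close> is positive too. Then
  \<open>norm c + y * star y\<close> is invertible, which makes \<open>norm c - c\<close> right
  invertible; this is impossible for a positive \<open>c \<noteq> 0\<close>. So
  \<open>c = 0\<close>, and \<open>h\<close> has no negative values.\<close>

theorem positive_star_mult:
  fixes x :: "'a::cstar_algebra"
  shows "positive (star x * x)"
proof -
  define h where "h = star x * x"
  have hs: "star h = h" by (simp add: h_def)
  obtain D where D: "inclusion D" and h: "h \<in> D" using inclusion_singleton[OF hs] .
  note mem = mem_inclusion[OF D]
  have nh: "- h \<in> D" "star (- h) = - h" using h hs mem by auto
  obtain b where b: "b \<in> D" "positive b"
    "\<And>\<rho>. \<rho> \<in> characters D \<Longrightarrow> \<rho> b = complex_of_real (max 0 (Re (\<rho> (- h))))"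
    using positive_part[OF D nh] by metis
  have bs: "star b = b" using b positive_star by blast
  define y where "y = x * b"
  define c where "c = - (star y * y)"
  have yy: "star y * y = b * h * b" by (simp add: y_def h_def bs mult.assoc)
  have c: "c \<in> D" "star c = c" using b h mem by (simp_all add: c_def yy) (simp add: bs hs mult.assoc)
  have rc: "\<rho> c = complex_of_real ((max 0 (- Re (\<rho> h))) ^ 3)" if r: "\<rho> \<in> characters D" for \<rho>
  proof -
    have "\<rho> c = - (\<rho> b * \<rho> h * \<rho> b)"
      using b h mem by (simp add: c_def yy character_diff[OF D r] charactersD(5)[OF r])
    moreover have "\<rho> h = complex_of_real (Re (\<rho> h))" using character_selfadjoint[OF D r h hs] .
    moreover have "\<rho> b = complex_of_real (max 0 (- Re (\<rho> h)))"
      using b(3)[OF r] character_diff(2)[OF D r h h] by simp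
    ultimately show ?thesis by (auto simp: complex_eq_iff max_def power3_eq_cube)
  qed
  have pc: "positive c"
  proof (rule positive_of_characters[OF D c])
    show "0 \<le> \<rho> c" if "\<rho> \<in> characters D" for \<rho>
      unfolding rc[OF that] by (simp add: less_eq_complex_def)
  qed
  have "c = 0"
  proof (rule ccontr)
    assume c0: "c \<noteq> 0"
    define l where "l = norm c"
    have l: "l > 0" using c0 by (simp add: l_def)
    obtain p q where pq: "star p = p" "star q = q"
      "star y * y + y * star y = (p * p + q * q) + (p * p + q * q)"
      by (rule selfadjoint_products_add)
    have "y * star y = ((p * p + q * q) + (p * p + q * q)) + c"
      unfolding pq(3)[symmetric] by (simp add: c_def)
    then have "positive (y * star y)"
      using pq pc by (simp only:) (intro positive_add positive_square pc; simp)
    then obtain k where k: "(of_real l + y * star y) * k = 1"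
      using positive_invertible[OF _ l cstar_subalgebra_UNIV] by auto
    \<comment> \<open>The standard passage from an inverse of \<open>l + y * star y\<close> to one
      of \<open>l + star y * y\<close>, which is \<open>l - c\<close>: a right inverse
      \<open>k\<close> of the former gives the right inverse \<open>r\<close> of the latter.\<close>
    define r where "r = (1 / l) *\<^sub>R (1 - star y * k * y)"
    have "(of_real l - c) * (1 - star y * k * y) = of_real l"
    proof -
      have "(of_real l - c) * (1 - star y * k * y) =
          of_real l + star y * y - star y * ((of_real l + y * star y) * k) * y"
        by (simp add: c_def of_real_def algebra_simps)
      then show ?thesis unfolding k by simp
    qed
    then have r: "(of_real l - c) * r = 1" using l by (simp add: r_def) (simp add: of_real_def)
    \<comment> \<open>Chosen so that \<open>d * norm r < 1\<close>. The bump \<open>e\<close> where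
      \<open>c\<close> exceeds \<open>l - d\<close> is nonzero because \<open>norm c = l\<close>,
      and \<open>l - c\<close> is at most \<open>d\<close> there; so
      \<open>e = e * (l - c) * r\<close> would give \<open>norm e < norm e\<close>.\<close>
    define d where "d = 1 / (norm r + 1)"
    have d: "d > 0" "d * norm r < 1" by (auto simp: d_def add_nonneg_pos divide_simps)
    have cd: "c - of_real (l - d) \<in> D" "star (c - of_real (l - d)) = c - of_real (l - d)"
      using c mem by auto
    obtain e where e: "e \<in> D" "positive e"
      "\<And>\<rho>. \<rho> \<in> characters D \<Longrightarrow> \<rho> e = complex_of_real (max 0 (Re (\<rho> (c - of_real (l - d)))))"
      using positive_part[OF D cd] by metis
    have re: "\<rho> e = complex_of_real (max 0 (Re (\<rho> c) - (l - d)))" if "\<rho> \<in> characters D" for \<rho>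
      using e(3)[OF that] c(1) mem
      by (simp add: character_diff[OF D that] character_of_real[OF D that] del: of_real_diff)
    have rcr: "\<rho> c = complex_of_real (Re (\<rho> c))" "0 \<le> Re (\<rho> c)" "Re (\<rho> c) \<le> l"
      if "\<rho> \<in> characters D" for \<rho>
      using character_selfadjoint[OF D that c] character_positive[OF D that c(1) pc]
        character_norm_le[OF D that c] by (auto simp: l_def less_eq_complex_def)
    have "e \<noteq> 0"
    proof
      assume "e = 0"
      have "norm c \<le> max 0 (l - d)"
      proof (rule norm_le_of_characters[OF D c])
        fix \<rho> assume rho: "\<rho> \<in> characters D"
        have "\<rho> e = 0" using \<open>e = 0\<close> character_diff(3)[OF D rho c(1) c(1)] by simp
        then have "Re (\<rho> c) \<le> l - d" using re[OF rho] by (simp split: if_splits add: max_def)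
        moreover have "cmod (\<rho> c) = Re (\<rho> c)" using rcr[OF rho] by (metis norm_of_real abs_of_nonneg)
        ultimately show "cmod (\<rho> c) \<le> max 0 (l - d)" by simp
      qed simp
      moreover have "max 0 (l - d) < l" using l d by simp
      ultimately show False unfolding l_def by linarith
    qed
    have es: "star e = e" using e positive_star by blast
    have "norm (e * (of_real l - c)) \<le> d * norm e"
    proof (rule norm_le_of_characters[OF D])
      show "e * (of_real l - c) \<in> D" using e c mem by auto
      then show "star (e * (of_real l - c)) = e * (of_real l - c)"
        using es c e mem inclusionD(3)[OF D, of e "of_real l - c"] by simp
      show "0 \<le> d * norm e" using d by simp
      fix \<rho> assume rho: "\<rho> \<in> characters D"
      have "\<rho> (e * (of_real l - c)) = \<rho> e * (of_real l - \<rho> c)"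
        using e c mem
        by (simp add: charactersD(5)[OF rho] character_diff[OF D rho] character_of_real[OF D rho])
      also have "\<dots> = complex_of_real (Re (\<rho> e) * (l - Re (\<rho> c)))"
        using rcr(1)[OF rho] re[OF rho] by (simp add: complex_eq_iff)
      finally have "cmod (\<rho> (e * (of_real l - c))) = \<bar>Re (\<rho> e) * (l - Re (\<rho> c))\<bar>"
        by (simp only: norm_of_real)
      also have "\<dots> = Re (\<rho> e) * (l - Re (\<rho> c))"
        using rcr[OF rho] re[OF rho] by (simp add: abs_mult)
      also have "\<dots> \<le> Re (\<rho> e) * d"
      proof (cases "Re (\<rho> e) = 0")
        case False
        then have "l - d < Re (\<rho> c)" using re[OF rho] by (simp add: max_def split: if_splits)
        then show ?thesis using re[OF rho] by (intro mult_left_mono) auto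
      qed simp
      also have "\<dots> \<le> norm e * d"
        using character_norm_le[OF D rho e(1) es] d by (intro mult_right_mono) auto
      finally show "cmod (\<rho> (e * (of_real l - c))) \<le> d * norm e" by (simp add: mult.commute)
    qed
    moreover have "e = e * (of_real l - c) * r" using r by (simp add: mult.assoc)
    ultimately have "norm e \<le> d * norm e * norm r"
      by (metis mult_right_mono norm_ge_zero norm_mult_ineq order_trans)
    then have "norm e * 1 \<le> norm e * (d * norm r)" by (simp add: mult_ac)
    then show False using d \<open>e \<noteq> 0\<close> by simp
  qed
  then have "positive h"
  proof (intro positive_of_characters[OF D h hs])
    fix \<rho> assume r: "\<rho> \<in> characters D" and "c = 0"
    then have "(max 0 (- Re (\<rho> h))) ^ 3 = 0"
      using rc[OF r] character_diff(3)[OF D r h h] by (metis of_real_eq_0_iff)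
    then have "0 \<le> Re (\<rho> h)" by (simp add: max_def split: if_splits)
    then show "0 \<le> \<rho> h" using character_selfadjoint[OF D r h hs]
      by (simp add: less_eq_complex_def complex_eq_iff)
  qed
  then show ?thesis by (simp add: h_def)
qed

section \<open>States\<close>

lemma statesD:
  assumes "f \<in> states A"
  shows "f \<in> functionals A" "x \<in> A \<Longrightarrow> 0 \<le> f (star x * x)" "f 1 = 1"
  using assms by (auto simp: states_def)

context
  fixes A :: "'a::cstar_algebra set" and f
  assumes A: "cstar_subalgebra A" "1 \<in> A" and f: "f \<in> states A"
  notes mem = cstar_subalgebra_intros[OF A(1)] A(2) cstar_subalgebra_of_real[OF A]
    and lin = functionalsD[OF statesD(1)[OF f]] functionals_diff[OF A(1) statesD(1)[OF f]]
begin

lemma state_of_real: "f (of_real r) = complex_of_real r"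
  using lin(3)[of 1 r] statesD(3)[OF f] mem by (simp add: of_real_def)

text \<open>Up to a summand \<open>e\<close>, a positive \<open>a\<close> is
  \<open>star y * y\<close> with \<open>y\<close> in the same subalgebra, so the defining condition
  of a state reaches all positive elements of \<open>A\<close>.\<close>

lemma state_positive:
  assumes a: "a \<in> A" "positive a"
  shows "0 \<le> f a"
proof -
  have "0 \<le> Re (f a) + e \<and> Im (f a) = 0" if e: "0 < e" for e
  proof -
    obtain y where y: "y \<in> A" "star y = y" "y * y = a + of_real e"
      using positive_sqrt_approx[OF a(2) A a(1) e] by metis
    have "0 \<le> f (a + of_real e)" using statesD(2)[OF f y(1)] y by simp
    also have "f (a + of_real e) = f a + of_real e" using a mem lin(1) by (simp add: state_of_real)
    finally show ?thesis by (simp add: less_eq_complex_def)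
  qed
  then show ?thesis using field_le_epsilon[of 0 "Re (f a)"] zero_less_one
    unfolding less_eq_complex_def by (metis zero_complex.simps)
qed

lemma state_selfadjoint:
  assumes a: "a \<in> A" "star a = a"
  shows "f a = complex_of_real (Re (f a))"
proof -
  have "0 \<le> f (of_real (norm a) - a)"
    using a mem by (intro state_positive positive_of_real_diff) auto
  also have "f (of_real (norm a) - a) = of_real (norm a) - f a"
    using a mem lin by (simp add: state_of_real)
  finally show ?thesis by (simp add: less_eq_complex_def complex_eq_iff)
qed

lemma state_star:
  assumes x: "x \<in> A"
  shows "f (star x) = cnj (f x)"
proof -
  define a b where "a = re_part x" and "b = im_part x"
  have ab: "a \<in> A" "b \<in> A" "star a = a" "star b = b" using x mem by (auto simp: a_def b_def)
  have xa: "x = a + scaleC \<i> b" using cartesian by (simp add: a_def b_def)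
  have sx: "star x = a + scaleC (- \<i>) b" by (simp add: xa ab)
  obtain s t where st: "f a = complex_of_real s" "f b = complex_of_real t"
    using state_selfadjoint ab by metis
  have "f (star x) = s + (- \<i>) * t"
    using ab mem unfolding sx by (simp only: lin(1,2) st)
  moreover have "f x = s + \<i> * t"
    using ab mem unfolding xa by (simp only: lin(1,2) st)
  ultimately show ?thesis by simp
qed

lemma state_Cauchy_Schwarz:
  assumes x: "x \<in> A" and y: "y \<in> A"
  shows "(cmod (f (star y * x)))\<^sup>2 \<le> Re (f (star x * x)) * Re (f (star y * y))"
proof -
  define z where "z = f (star y * x)"
  define p q where "p = Re (f (star x * x))" and "q = Re (f (star y * y))"
  have pq: "f (star x * x) = of_real p" "f (star y * y) = of_real q" "0 \<le> p" "0 \<le> q"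
    using statesD(2)[OF f] x y by (auto simp: p_def q_def less_eq_complex_def complex_eq_iff)
  have zc: "f (star x * y) = cnj z"
    using state_star[of "star y * x"] x y mem by (simp add: z_def)
  \<comment> \<open>Positivity of \<open>f\<close> at \<open>x - s z y\<close> with
    \<open>z = f (star y * x)\<close>; this phase makes the cross terms real. For
    \<open>q > 0\<close> the optimal choice is \<open>s = 1 / q\<close>; for \<open>q = 0\<close> a
    large \<open>s\<close> forces \<open>z = 0\<close>.\<close>
  have main: "0 \<le> p - 2 * s * (cmod z)\<^sup>2 + s\<^sup>2 * (cmod z)\<^sup>2 * q" for s :: real
  proof -
    define w where "w = complex_of_real s * z"
    have "star (x - scaleC w y) * (x - scaleC w y) =
        (star x * x - scaleC w (star x * y)) - scaleC (cnj w) (star y * x)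
         + scaleC (cnj w * w) (star y * y)"
      by (simp add: algebra_simps scaleC_mult_left scaleC_mult_right scaleC_scaleC
          cvec.scale_right_diff_distrib)
    then have "f (star (x - scaleC w y) * (x - scaleC w y)) =
        (of_real p - w * cnj z) - cnj w * z + cnj w * w * of_real q"
      using x y mem by (simp add: lin pq zc flip: z_def)
    also have "\<dots> = of_real p - 2 * of_real s * (z * cnj z) + (of_real s)\<^sup>2 * (z * cnj z) * of_real q"
      by (simp add: w_def algebra_simps power2_eq_square)
    also have "\<dots> = complex_of_real (p - 2 * s * (cmod z)\<^sup>2 + s\<^sup>2 * (cmod z)\<^sup>2 * q)"
      unfolding complex_norm_square[symmetric] by simp
    finally show ?thesis
      using statesD(2)[OF f, of "x - scaleC w y"] x y mem by (simp add: less_eq_complex_def)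
  qed
  have "(cmod z)\<^sup>2 \<le> p * q"
  proof (cases "q = 0")
    case True
    show ?thesis
    proof (rule ccontr)
      assume "\<not> ?thesis"
      then have "(cmod z)\<^sup>2 > 0" using True by simp
      then have *: "2 * ((p + 1) / (cmod z)\<^sup>2) * (cmod z)\<^sup>2 = 2 * (p + 1)" by simp
      have "0 \<le> p - 2 * (p + 1)"
        using main[of "(p + 1) / (cmod z)\<^sup>2"] unfolding True * by simp
      then have "p + 2 \<le> 0" by (simp add: algebra_simps)
      then show False using \<open>0 \<le> p\<close> by simp
    qed
  next
    case False
    then have "q > 0" using pq by simp
    then show ?thesis using main[of "1 / q"] by (simp add: field_simps power2_eq_square)
  qed
  then show ?thesis by (simp add: z_def p_def q_def)
qed

lemma state_norm_le:
  assumes x: "x \<in> A"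
  shows "cmod (f x) \<le> norm x"
proof -
  have "(cmod (f x))\<^sup>2 \<le> Re (f (star x * x))"
    using state_Cauchy_Schwarz[OF x A(2)] statesD(3)[OF f] by simp
  also have "\<dots> \<le> (norm x)\<^sup>2"
  proof -
    have "0 \<le> f (of_real (norm (star x * x)) - star x * x)"
      using x mem by (intro state_positive positive_of_real_diff) auto
    then show ?thesis
      using x mem by (simp add: lin state_of_real less_eq_complex_def cstar_identity del: of_real_power)
  qed
  finally show ?thesis by (rule power2_le_imp_le) simp
qed

end

section \<open>Extension of positive functionals\<close>

text \<open>Real functionals on subspaces of the selfadjoint part are represented by their graphs, so
  that extension is inclusion.\<close>

definition positive_graph :: "('a::cstar_algebra \<times> real) set \<Rightarrow> bool" where
  "positive_graph G \<longleftrightarrow> subspace G \<and> (1, 1) \<in> G \<and>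
     (\<forall>(a, r)\<in>G. star a = a \<and> (positive a \<longrightarrow> 0 \<le> r))"

lemma positive_graphD:
  assumes "positive_graph G"
  shows "(a, r) \<in> G \<Longrightarrow> (b, s) \<in> G \<Longrightarrow> (a + b, r + s) \<in> G"
    "(a, r) \<in> G \<Longrightarrow> (t *\<^sub>R a, t * r) \<in> G"
    "(a, r) \<in> G \<Longrightarrow> (b, s) \<in> G \<Longrightarrow> (a - b, r - s) \<in> G"
    "(a, r) \<in> G \<Longrightarrow> star a = a" "(a, r) \<in> G \<Longrightarrow> positive a \<Longrightarrow> 0 \<le> r"
    "(of_real t, t) \<in> G"
proof -
  have s: "subspace G" using assms by (simp add: positive_graph_def)
  show "(a, r) \<in> G \<Longrightarrow> (b, s) \<in> G \<Longrightarrow> (a + b, r + s) \<in> G"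
    using subspace_add[OF s, of "(a, r)" "(b, s)"] by simp
  show "(a, r) \<in> G \<Longrightarrow> (b, s) \<in> G \<Longrightarrow> (a - b, r - s) \<in> G"
    using subspace_diff[OF s, of "(a, r)" "(b, s)"] by simp
  show "(a, r) \<in> G \<Longrightarrow> (t *\<^sub>R a, t * r) \<in> G"
    using subspace_scale[OF s, of "(a, r)" t] by simp
  show "(a, r) \<in> G \<Longrightarrow> star a = a" "(a, r) \<in> G \<Longrightarrow> positive a \<Longrightarrow> 0 \<le> r"
    using assms by (auto simp: positive_graph_def)
  show "(of_real t, t) \<in> G"
    using subspace_scale[OF s, of "(1, 1)" t] assms by (simp add: positive_graph_def of_real_def)
qed

text \<open>The differences \<open>(0, r - s)\<close> and \<open>(0, s - r)\<close> lie in
  \<open>G\<close>, and \<open>0\<close> is positive.\<close>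

lemma positive_graph_unique:
  assumes G: "positive_graph G" and "(a, r) \<in> G" "(a, s) \<in> G"
  shows "r = s"
  using positive_graphD(5)[OF G positive_graphD(3)[OF G assms(2,3)]]
    positive_graphD(5)[OF G positive_graphD(3)[OF G assms(3,2)]] by simp

text \<open>One step of M. Riesz's extension theorem: dividing \<open>b + t x\<close> by the
  absolute value of \<open>t\<close> turns its positivity into a comparison of \<open>x\<close> with
  an element of the old space, from below for \<open>t > 0\<close> and from above for
  \<open>t < 0\<close>.\<close>

lemma positive_graph_extend:
  fixes x :: "'a::cstar_algebra"
  assumes G: "positive_graph G" and x: "star x = x"
    and low: "\<And>d r. (d, r) \<in> G \<Longrightarrow> positive (x - d) \<Longrightarrow> r \<le> c"
    and up: "\<And>d r. (d, r) \<in> G \<Longrightarrow> positive (d - x) \<Longrightarrow> c \<le> r"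
  obtains G' where "positive_graph G'" "G \<subseteq> G'" "(x, c) \<in> G'"
proof -
  define G' where "G' = {(a + t *\<^sub>R x, r + t * c) | a r t. (a, r) \<in> G}"
  have G'I: "(a + t *\<^sub>R x, r + t * c) \<in> G'" if "(a, r) \<in> G" for a r t
    using that by (auto simp: G'_def)
  have G0: "(0, 0) \<in> G" using positive_graphD(6)[OF G, of 0] by simp
  have sub: "G \<subseteq> G'" using G'I[of _ _ 0] by auto
  have "subspace G'"
    unfolding subspace_def
  proof (intro conjI ballI allI)
    show "0 \<in> G'" using G0 sub by (auto simp: zero_prod_def)
    fix u assume "u \<in> G'"
    then obtain a r t where u: "u = (a + t *\<^sub>R x, r + t * c)" "(a, r) \<in> G" by (auto simp: G'_def)
    show "k *\<^sub>R u \<in> G'" for k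
      using G'I[OF positive_graphD(2)[OF G u(2), of k], of "k * t"] by (simp add: u algebra_simps)
    fix v assume "v \<in> G'"
    then obtain b s t' where v: "v = (b + t' *\<^sub>R x, s + t' * c)" "(b, s) \<in> G" by (auto simp: G'_def)
    show "u + v \<in> G'"
      using G'I[OF positive_graphD(1)[OF G u(2) v(2)], of "t + t'"] by (simp add: u v algebra_simps)
  qed
  moreover have "star a = a \<and> (positive a \<longrightarrow> 0 \<le> r)" if "(a, r) \<in> G'" for a r
  proof -
    obtain b s t where ar: "a = b + t *\<^sub>R x" "r = s + t * c" "(b, s) \<in> G"
      using \<open>(a, r) \<in> G'\<close> by (auto simp: G'_def)
    have "0 \<le> r" if pos: "positive a"
    proof -
      consider "t = 0" | "t > 0" | "t < 0" by linarith
      then show ?thesis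
      proof cases
        case 1
        then show ?thesis using positive_graphD(5)[OF G ar(3)] pos ar by simp
      next
        case 2
        have "positive ((1 / t) *\<^sub>R a)" using pos 2 by (intro positive_scaleR) auto
        moreover have "(1 / t) *\<^sub>R a = x - (- 1 / t) *\<^sub>R b"
          using 2 by (simp add: ar scaleR_add_right)
        ultimately have "- 1 / t * s \<le> c"
          using low[OF positive_graphD(2)[OF G ar(3), of "- 1 / t"]] by simp
        then show ?thesis using 2 by (simp add: ar field_simps)
      next
        case 3
        have "positive ((- 1 / t) *\<^sub>R a)"
          using pos 3 by (intro positive_scaleR) (auto simp: divide_nonpos_neg)
        moreover have "(- 1 / t) *\<^sub>R a = (- 1 / t) *\<^sub>R b - x"
          using 3 by (simp add: ar scaleR_add_right)
        ultimately have "c \<le> - 1 / t * s"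
          using up[OF positive_graphD(2)[OF G ar(3), of "- 1 / t"]] by simp
        then show ?thesis using 3 by (simp add: ar field_simps)
      qed
    qed
    then show ?thesis using ar x positive_graphD(4)[OF G ar(3)] by simp
  qed
  ultimately have "positive_graph G'"
    using sub G by (auto simp: positive_graph_def)
  moreover have "(x, c) \<in> G'" using G'I[OF G0, of 1] by simp
  ultimately show ?thesis using that sub by blast
qed

text \<open>The supremum of the values below \<open>x\<close> is admissible. The scalars
  \<open>- norm x\<close> and \<open>norm x\<close> lie in the old space on either side of
  \<open>x\<close>, so the set is nonempty and bounded.\<close>

lemma positive_graph_extend_ex:
  fixes x :: "'a::cstar_algebra"
  assumes G: "positive_graph G" and x: "star x = x"
  obtains G' c where "positive_graph G'" "G \<subseteq> G'" "(x, c) \<in> G'"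
proof -
  define L where "L = {r. \<exists>d. (d, r) \<in> G \<and> positive (x - d)}"
  have bound: "r \<le> s" if r: "r \<in> L" and s: "(d, s) \<in> G" "positive (d - x)" for r s d
  proof -
    obtain d' where d': "(d', r) \<in> G" "positive (x - d')" using r by (auto simp: L_def)
    have "positive (d - d')" using positive_add[OF s(2) d'(2)] by simp
    then show ?thesis using positive_graphD(5)[OF G positive_graphD(3)[OF G s(1) d'(1)]] by simp
  qed
  have "positive (x - of_real (- norm x))"
    using positive_of_real_diff[of "- x" "norm x"] x by (simp add: add.commute)
  then have "L \<noteq> {}" using positive_graphD(6)[OF G] unfolding L_def by blast
  moreover have "bdd_above L"
    using bound[OF _ positive_graphD(6)[OF G] positive_of_real_diff[OF x order_refl]]
    by (auto simp: bdd_above_def)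
  ultimately have L: "r \<in> L \<Longrightarrow> r \<le> Sup L" "(\<And>r. r \<in> L \<Longrightarrow> r \<le> s) \<Longrightarrow> Sup L \<le> s" for r s
    by (auto intro: cSup_upper cSup_least)
  show ?thesis
  proof (rule positive_graph_extend[OF G x])
    show "r \<le> Sup L" if "(d, r) \<in> G" "positive (x - d)" for d r
      using that by (intro L) (auto simp: L_def)
    show "Sup L \<le> r" if "(d, r) \<in> G" "positive (d - x)" for d r
      using bound that by (intro L) auto
  qed (use that in blast)
qed

lemma state_of_positive_graph:
  assumes "positive_graph (G :: ('a::cstar_algebra \<times> real) set)"
  obtains f where "f \<in> states UNIV" "\<And>a r. (a, r) \<in> G \<Longrightarrow> f a = complex_of_real r"
proof -
  define \<A> where "\<A> = {G'. positive_graph G' \<and> G \<subseteq> G'}"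
  have "\<exists>M\<in>\<A>. \<forall>X\<in>\<A>. M \<subseteq> X \<longrightarrow> X = M"
  proof (rule subset_Zorn_nonempty)
    show "\<A> \<noteq> {}" using assms by (auto simp: \<A>_def)
    fix \<C> assume C: "\<C> \<noteq> {}" "subset.chain \<A> \<C>"
    then have P: "positive_graph X" "G \<subseteq> X" if "X \<in> \<C>" for X
      using that by (auto simp: \<A>_def subset.chain_def)
    have "subspace (\<Union>\<C>)"
      unfolding subspace_def
    proof (intro conjI ballI allI)
      show "0 \<in> \<Union>\<C>" using C(1) P(1) by (auto simp: positive_graph_def subspace_def)
      fix u assume u: "u \<in> \<Union>\<C>"
      then obtain X where X: "X \<in> \<C>" "u \<in> X" by blast
      then have "k *\<^sub>R u \<in> X" for k
        using P(1)[of X] by (simp add: positive_graph_def subspace_def)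
      then show "k *\<^sub>R u \<in> \<Union>\<C>" for k using X by blast
      fix v assume v: "v \<in> \<Union>\<C>"
      obtain X Y where XY: "X \<in> \<C>" "Y \<in> \<C>" "u \<in> X" "v \<in> Y" using u v by blast
      then have "X \<subseteq> Y \<or> Y \<subseteq> X" using C(2) by (auto simp: subset_chain_def)
      then obtain Z where Z: "Z \<in> \<C>" "u \<in> Z" "v \<in> Z" using XY by blast
      then have "u + v \<in> Z" using P(1)[of Z] by (simp add: positive_graph_def subspace_def)
      then show "u + v \<in> \<Union>\<C>" using Z by blast
    qed
    moreover have "(1, 1) \<in> \<Union>\<C>" using C(1) P(1) by (auto simp: positive_graph_def)
    moreover have "\<forall>(a, r)\<in>\<Union>\<C>. star a = a \<and> (positive a \<longrightarrow> 0 \<le> r)"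
      using P(1) unfolding positive_graph_def by blast
    ultimately have "positive_graph (\<Union>\<C>)" unfolding positive_graph_def by blast
    moreover have "G \<subseteq> \<Union>\<C>" using P C(1) by blast
    ultimately show "\<Union>\<C> \<in> \<A>" by (simp add: \<A>_def)
  qed
  then obtain M where "M \<in> \<A>" and max: "\<forall>X\<in>\<A>. M \<subseteq> X \<longrightarrow> X = M" by (elim bexE)
  then have M: "positive_graph M" "G \<subseteq> M" by (auto simp: \<A>_def)
  have total: "\<exists>r. (a, r) \<in> M" if a: "star a = a" for a
  proof -
    obtain X c where X: "positive_graph X" "M \<subseteq> X" "(a, c) \<in> X"
      using positive_graph_extend_ex[OF M(1) a] by metis
    then have "X = M" using max M(2) by (auto simp: \<A>_def)
    then show ?thesis using X by auto
  qed
  define \<phi> where "\<phi> a = (THE r. (a, r) \<in> M)" for a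
  have phi_eq: "\<phi> a = r" if "(a, r) \<in> M" for a r
    unfolding \<phi>_def using that positive_graph_unique[OF M(1)] by blast
  have phi: "(a, \<phi> a) \<in> M" if "star a = a" for a
    using total[OF that] phi_eq by auto
  obtain f where f: "f \<in> functionals UNIV" "\<And>a. star a = a \<Longrightarrow> f a = complex_of_real (\<phi> a)"
  proof (rule functionals_complexify[OF cstar_subalgebra_UNIV])
    show "\<phi> (a + b) = \<phi> a + \<phi> b" if "star a = a" "star b = b" for a b
      using positive_graphD(1)[OF M(1)] phi that by (intro phi_eq) blast
    show "\<phi> (t *\<^sub>R a) = t * \<phi> a" if "star a = a" for t a
      using positive_graphD(2)[OF M(1)] phi that by (intro phi_eq) blast
  qed (use that in auto)
  have fM: "f a = complex_of_real r" if "(a, r) \<in> M" for a r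
    using f(2)[OF positive_graphD(4)[OF M(1) that]] phi_eq[OF that] by simp
  have "f \<in> states UNIV"
    unfolding states_def
  proof (intro CollectI conjI ballI f)
    \<comment> \<open>The extension procedure knows only the cone; \<open>positive_star_mult\<close>
      puts \<open>star x * x\<close> into it.\<close>
    show "0 \<le> f (star x * x)" for x
      using f(2)[of "star x * x"] positive_graphD(5)[OF M(1) phi positive_star_mult[of x]]
      by (simp add: less_eq_complex_def)
    show "f 1 = 1" using fM[of 1 1] M(1) by (simp add: positive_graph_def)
  qed
  then show ?thesis using that fM M(2) by blast
qed

section \<open>Extensions of a character to states\<close>

context
  fixes D :: "'a::cstar_algebra set"
  assumes D: "inclusion D"
  notes mem = mem_inclusion[OF D]
begin

lemma character_extend_value:
  assumes r: "\<rho> \<in> characters D" and x: "star x = x"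
    and low: "\<And>d. d \<in> D \<Longrightarrow> star d = d \<Longrightarrow> positive (x - d) \<Longrightarrow> Re (\<rho> d) \<le> c"
    and up: "\<And>d. d \<in> D \<Longrightarrow> star d = d \<Longrightarrow> positive (d - x) \<Longrightarrow> c \<le> Re (\<rho> d)"
  obtains f where "f \<in> states UNIV" "\<And>d. d \<in> D \<Longrightarrow> f d = \<rho> d" "f x = complex_of_real c"
proof -
  define G where "G = {(d, Re (\<rho> d)) | d. d \<in> D \<and> star d = d}"
  have "positive_graph G"
    unfolding positive_graph_def subspace_def
  proof (intro conjI ballI allI)
    show "0 \<in> G" using character_diff(3)[OF D r] mem
      by (auto simp: G_def zero_prod_def intro!: exI[of _ 0])
    show "(1, 1) \<in> G" using character_one[OF D r] mem by (auto simp: G_def intro!: exI[of _ 1])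
    fix u assume "u \<in> G"
    then obtain a where u: "u = (a, Re (\<rho> a))" "a \<in> D" "star a = a" by (auto simp: G_def)
    show "k *\<^sub>R u \<in> G" for k using u mem by (auto simp: G_def charactersD(4)[OF r])
    show "case u of (a, r) \<Rightarrow> star a = a \<and> (positive a \<longrightarrow> 0 \<le> r)"
      using u character_positive[OF D r u(2)] by (auto simp: less_eq_complex_def)
    fix v assume "v \<in> G"
    then obtain b where v: "v = (b, Re (\<rho> b))" "b \<in> D" "star b = b" by (auto simp: G_def)
    show "u + v \<in> G" using u v mem by (auto simp: G_def charactersD(2)[OF r])
  qed
  then obtain G' where G': "positive_graph G'" "G \<subseteq> G'" "(x, c) \<in> G'"
    by (rule positive_graph_extend[OF _ x]) (use low up in \<open>auto simp: G_def\<close>)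
  obtain f where f: "f \<in> states UNIV" "\<And>a r. (a, r) \<in> G' \<Longrightarrow> f a = complex_of_real r"
    using state_of_positive_graph[OF G'(1)] by metis
  note flin = functionalsD[OF statesD(1)[OF f(1)]]
  have fsa: "f d = \<rho> d" if "d \<in> D" "star d = d" for d
  proof -
    have "(d, Re (\<rho> d)) \<in> G'" using G'(2) that by (auto simp: G_def)
    then show ?thesis using f(2) character_selfadjoint[OF D r that] by simp
  qed
  have "f d = \<rho> d" if d: "d \<in> D" for d
  proof -
    have "f d = f (re_part d) + \<i> * f (im_part d)"
      by (subst cartesian) (simp add: flin)
    also have "\<dots> = \<rho> (re_part d) + \<i> * \<rho> (im_part d)" using d mem by (simp add: fsa)
    also have "\<dots> = \<rho> (re_part d + scaleC \<i> (im_part d))"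
      using d mem by (simp add: charactersD[OF r])
    finally show ?thesis by (simp flip: cartesian)
  qed
  then show ?thesis using that f G'(3) by blast
qed

text \<open>The instance \<open>x = 0\<close> with value \<open>0\<close> of
  \<open>character_extend_value\<close>, for which both conditions say that \<open>\<rho>\<close>
  preserves the order.\<close>

lemma character_extend:
  assumes r: "\<rho> \<in> characters D"
  obtains f where "f \<in> states UNIV" "\<And>d. d \<in> D \<Longrightarrow> f d = \<rho> d"
proof (rule character_extend_value[OF r, of 0 0])
  show "Re (\<rho> d) \<le> 0" if "d \<in> D" "positive (0 - d)" for d
    using character_positive[OF D r, of "- d"] that mem
    by (simp add: character_diff[OF D r] less_eq_complex_def)
  show "0 \<le> Re (\<rho> d)" if "d \<in> D" "positive (d - 0)" for d
    using character_positive[OF D r, of d] that by (simp add: less_eq_complex_def)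
qed (use that in auto)

text \<open>Both \<open>Sup L\<close> and \<open>Inf U\<close> are values at \<open>x\<close> of
  extensions of \<open>\<rho>\<close>. Uniqueness makes them equal, and each is approached to within
  \<open>e / 2\<close> by elements of \<open>D\<close> evaluated at \<open>\<rho>\<close>.\<close>

lemma unique_extension_sandwich:
  assumes r: "\<rho> \<in> characters D"
    and uniq: "\<And>f g. f \<in> states UNIV \<Longrightarrow> g \<in> states UNIV \<Longrightarrow> (\<And>d. d \<in> D \<Longrightarrow> f d = \<rho> d) \<Longrightarrow>
      (\<And>d. d \<in> D \<Longrightarrow> g d = \<rho> d) \<Longrightarrow> f = g"
    and x: "star x = x" and e: "0 < e"
  obtains d1 d2 where "d1 \<in> D" "star d1 = d1" "d2 \<in> D" "star d2 = d2"
    "positive (x - d1)" "positive (d2 - x)" "Re (\<rho> d2) - Re (\<rho> d1) < e"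
proof -
  define L where "L = {Re (\<rho> d) | d. d \<in> D \<and> star d = d \<and> positive (x - d)}"
  define U where "U = {Re (\<rho> d) | d. d \<in> D \<and> star d = d \<and> positive (d - x)}"
  have LU: "l \<le> u" if lu: "l \<in> L" "u \<in> U" for l u
  proof -
    obtain a b where ab: "a \<in> D" "b \<in> D" "positive (x - a)" "positive (b - x)"
      "l = Re (\<rho> a)" "u = Re (\<rho> b)" using lu by (auto simp: L_def U_def)
    have "positive (b - a)" using positive_add[OF ab(4,3)] by simp
    then have "0 \<le> \<rho> (b - a)" using ab mem by (intro character_positive[OF D r]) auto
    then show ?thesis using ab by (simp add: character_diff[OF D r] less_eq_complex_def)
  qed
  have "of_real (norm x) \<in> D" "of_real (- norm x) \<in> D"
    by (rule mem_inclusion_of_real[OF D])+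
  moreover have "positive (x - of_real (- norm x))"
    using positive_of_real_diff[of "- x" "norm x"] x by (simp add: add.commute)
  moreover have "positive (of_real (norm x) - x)" using x by (intro positive_of_real_diff) auto
  ultimately have ne: "L \<noteq> {}" "U \<noteq> {}"
    unfolding L_def U_def using star_of_real by blast+
  have bdd: "bdd_above L" "bdd_below U"
    using ne LU unfolding bdd_above_def bdd_below_def by blast+
  have upper: "l \<le> Sup L" if "l \<in> L" for l using that bdd(1) by (rule cSup_upper)
  have lower: "Inf U \<le> u" if "u \<in> U" for u using that bdd(2) by (rule cInf_lower)
  have SI: "Sup L \<le> Inf U" using ne LU by (intro cSup_least cInf_greatest) auto
  have "Sup L = Inf U"
  proof -
    obtain f where f: "f \<in> states UNIV" "\<And>d. d \<in> D \<Longrightarrow> f d = \<rho> d" "f x = complex_of_real (Sup L)"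
    proof (rule character_extend_value[OF r x])
      show "Re (\<rho> d) \<le> Sup L" if "d \<in> D" "star d = d" "positive (x - d)" for d
        using that by (intro upper) (auto simp: L_def)
      show "Sup L \<le> Re (\<rho> d)" if "d \<in> D" "star d = d" "positive (d - x)" for d
        using that by (intro order_trans[OF SI lower]) (auto simp: U_def)
    qed (use that in auto)
    obtain g where g: "g \<in> states UNIV" "\<And>d. d \<in> D \<Longrightarrow> g d = \<rho> d" "g x = complex_of_real (Inf U)"
    proof (rule character_extend_value[OF r x])
      show "Re (\<rho> d) \<le> Inf U" if "d \<in> D" "star d = d" "positive (x - d)" for d
        using that by (intro order_trans[OF upper SI]) (auto simp: L_def)
      show "Inf U \<le> Re (\<rho> d)" if "d \<in> D" "star d = d" "positive (d - x)" for d
        using that by (intro lower) (auto simp: U_def)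
    qed (use that in auto)
    have "f = g" using uniq f g by blast
    then show ?thesis using f g by simp
  qed
  moreover obtain l where "l \<in> L" "Sup L - e/2 < l"
    using less_cSupD[OF ne(1), of "Sup L - e/2"] e by auto
  moreover obtain u where "u \<in> U" "u < Inf U + e/2"
    using cInf_lessD[OF ne(2), of "Inf U + e/2"] e by auto
  ultimately show ?thesis using that by (force simp: L_def U_def)
qed

text \<open>\<open>D\<close> lies in the multiplicative domain of \<open>f\<close>: with
  \<open>y = star (d - \<rho> d)\<close>, the character kills \<open>star y * y\<close>, and
  Cauchy-Schwarz gives \<open>f (star y * x) = 0\<close> for all \<open>x\<close>. The second
  identity follows by taking adjoints.\<close>

lemma state_character_mult:
  assumes r: "\<rho> \<in> characters D" and f: "f \<in> states UNIV" "\<And>d. d \<in> D \<Longrightarrow> f d = \<rho> d" and d: "d \<in> D"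
  shows "f (d * x) = \<rho> d * f x" "f (x * d) = f x * \<rho> d"
proof -
  note flin = functionalsD[OF statesD(1)[OF f(1)]]
    functionals_diff[OF cstar_subalgebra_UNIV statesD(1)[OF f(1)]]
  have left: "f (d * x) = \<rho> d * f x" if d: "d \<in> D" for d x
  proof -
    define y where "y = star (d - scaleC (\<rho> d) 1)"
    have y: "y \<in> D" "star y = d - scaleC (\<rho> d) 1" using d mem by (auto simp: y_def)
    have "\<rho> (star y) = 0"
      using d mem r unfolding y by (simp add: character_diff[OF D r] charactersD[OF r] character_one[OF D])
    then have "\<rho> (star y * y) = 0" using y(1) mem charactersD(5)[OF r, of "star y" y] by simp
    moreover have "star y * y \<in> D" using y(1) mem by simp
    ultimately have "f (star y * y) = 0" using f(2) by simp
    then have "f (star y * x) = 0"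
      using state_Cauchy_Schwarz[OF cstar_subalgebra_UNIV _ f(1), of x y] by simp
    then show ?thesis by (simp add: y flin algebra_simps scaleC_mult_left)
  qed
  show "f (d * x) = \<rho> d * f x" using d by (rule left)
  note fstar = state_star[OF cstar_subalgebra_UNIV UNIV_I f(1) UNIV_I]
  have "f (x * d) = cnj (f (star d * star x))" using fstar[of "star d * star x"] by simp
  also have "f (star d * star x) = \<rho> (star d) * f (star x)" using d mem by (intro left) auto
  finally show "f (x * d) = f x * \<rho> d"
    using character_star[OF D r d] fstar[of x] by (simp add: mult.commute)
qed

section \<open>Pure states of abelian algebras\<close>

lemma character_state:
  assumes r: "\<rho> \<in> characters D" shows "\<rho> \<in> states D"
  using character_positive[OF D r _ positive_star_mult] mem character_one[OF D r] charactersD(1)[OF r]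
  by (auto simp: states_def)

text \<open>If \<open>\<rho>\<close> is a mixture of \<open>g\<close> and \<open>h\<close>, then
  \<open>g\<close> and \<open>h\<close> vanish at \<open>star y * y\<close> for
  \<open>y = x - \<rho> x\<close>, since \<open>\<rho>\<close> does and both are nonnegative there.
  Cauchy-Schwarz then gives \<open>g y = 0\<close>.\<close>

lemma character_pure:
  assumes r: "\<rho> \<in> characters D" shows "\<rho> \<in> pure_states D"
proof -
  note A = inclusionD(1,2)[OF D]
  have eq: "g = \<rho>" if gh: "g \<in> states D" "h \<in> states D" and t: "0 < t" "t < 1"
    and comb: "\<And>x. x \<in> D \<Longrightarrow> \<rho> x = complex_of_real t * g x + complex_of_real (1 - t) * h x"
    for g h t
  proof (rule extensionalityI)
    fix x assume x: "x \<in> D"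
    define y where "y = x - scaleC (\<rho> x) 1"
    have y: "y \<in> D" using x mem by (auto simp: y_def)
    have "\<rho> y = 0"
      using x mem r by (simp add: y_def character_diff[OF D r] charactersD[OF r] character_one[OF D])
    then have "\<rho> (star y * y) = 0" using y mem by (simp add: charactersD[OF r])
    then have "complex_of_real t * g (star y * y) + complex_of_real (1 - t) * h (star y * y) = 0"
      using comb[of "star y * y"] y mem by simp
    then have "t * Re (g (star y * y)) + (1 - t) * Re (h (star y * y)) = 0"
      by (auto simp: complex_eq_iff)
    moreover have g0: "0 \<le> Re (g (star y * y))" "0 \<le> Re (h (star y * y))"
      using statesD(2)[OF gh(1) y] statesD(2)[OF gh(2) y] by (auto simp: less_eq_complex_def)
    ultimately have "t * Re (g (star y * y)) = 0"
      using t by (intro antisym) (auto simp: add_nonneg_eq_0_iff)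
    then have "Re (g (star y * y)) = 0" using t by simp
    then have "g y = 0"
      using state_Cauchy_Schwarz[OF A gh(1) y A(2)] by simp
    then show "g x = \<rho> x"
      using x mem statesD(3)[OF gh(1)]
      by (simp add: y_def functionals_diff[OF A(1) statesD(1)[OF gh(1)]] functionalsD[OF statesD(1)[OF gh(1)]])
  qed (use gh r in \<open>auto simp: states_def functionals_def characters_def\<close>)
  show ?thesis
    unfolding pure_states_def
  proof (intro CollectI conjI ballI allI impI character_state r; elim conjE)
    fix g h t
    assume gh: "g \<in> states D" "h \<in> states D" and t: "0 < t" "t < 1"
      and comb: "\<forall>x\<in>D. \<rho> x = complex_of_real t * g x + complex_of_real (1 - t) * h x"
    show "g = \<rho>" using eq[OF gh t] comb by blast
    show "h = \<rho>" using eq[OF gh(2,1), of "1 - t"] t comb by (simp add: add.commute)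
  qed
qed

text \<open>For positive \<open>a\<close> and \<open>b\<close> with \<open>a + b = 1\<close>,
  \<open>f\<close> is the mixture with weights \<open>f a\<close> and \<open>f b\<close> of the
  states \<open>f (a * x) / f a\<close> and \<open>f (b * x) / f b\<close>. Extremality gives
  \<open>f (a * x) = f a * f x\<close>. Each selfadjoint \<open>c\<close> with
  \<open>norm c < 1/2\<close> arises from \<open>a = 1/2 + c\<close>, with both weights positive;
  the rest is linearity.\<close>

lemma pure_character:
  assumes f: "f \<in> pure_states D" shows "f \<in> characters D"
proof -
  note A = inclusionD(1,2)[OF D]
  have fs: "f \<in> states D" using f by (simp add: pure_states_def)
  note lin = functionalsD[OF statesD(1)[OF fs]] functionals_diff[OF A(1) statesD(1)[OF fs]]
  have st: "(\<lambda>x\<in>D. f (a * x) / f a) \<in> states D"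
    if a: "a \<in> D" "positive a" "0 < Re (f a)" for a
  proof -
    obtain s where fa: "f a = complex_of_real s" "0 < s"
      using state_selfadjoint[OF A fs a(1) positive_star[OF a(2)]] a(3) by metis
    have "0 \<le> f (a * (star x * x)) / f a" if x: "x \<in> D" for x
    proof -
      have "0 \<le> f (a * (star x * x))"
        using x a(1) mem
        by (intro state_positive[OF A fs] positive_mult[OF D _ _ a(2) positive_star_mult]) auto
      then show ?thesis using fa by (simp add: less_eq_complex_def)
    qed
    moreover have "f a \<noteq> 0" using a(3) by auto
    ultimately show ?thesis
      using a(1) mem by (auto simp: states_def functionals_def lin ring_distribs scaleC_mult_right add_divide_distrib)
  qed
  have small: "f (c * x) = f c * f x"
    if c: "c \<in> D" "star c = c" "norm c < 1/2" and x: "x \<in> D" for c x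
  proof -
    define a where "a = of_real (1/2) + c"
    define b where "b = of_real (1/2) - c"
    have ab: "a \<in> D" "b \<in> D" "a + b = 1" using c mem by (auto simp: a_def b_def simp flip: of_real_add)
    have "\<bar>Re (f c)\<bar> < 1/2"
      using state_norm_le[OF A fs c(1)] c(3) abs_Re_le_cmod[of "f c"] by linarith
    moreover have fa: "Re (f a) = 1/2 + Re (f c)" "Re (f b) = 1/2 - Re (f c)"
      using c mem by (simp_all add: a_def b_def lin state_of_real[OF A fs] del: of_real_divide)
    ultimately have pos: "0 < Re (f a)" "0 < Re (f b)" "Re (f a) < 1" by auto
    have "positive a" using positive_of_real_diff[of "- c" "1/2"] c by (simp add: a_def)
    have "positive b" using positive_of_real_diff[of c "1/2"] c by (simp add: b_def)
    note sa = state_selfadjoint[OF A fs ab(1) positive_star[OF \<open>positive a\<close>]]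
    have fab: "f b = 1 - f a" using lin(1)[OF ab(1,2)] ab(3) statesD(3)[OF fs] by (simp add: algebra_simps)
    have "\<forall>x\<in>D. f x = complex_of_real (Re (f a)) * (\<lambda>x\<in>D. f (a * x) / f a) x +
        complex_of_real (1 - Re (f a)) * (\<lambda>x\<in>D. f (b * x) / f b) x"
    proof
      fix x assume x: "x \<in> D"
      have "f a \<noteq> 0" "f b \<noteq> 0" using pos by auto
      moreover have "f x = f (a * x) + f (b * x)"
        using x ab mem by (simp add: ab(3) flip: lin(1) distrib_right)
      moreover have "complex_of_real (1 - Re (f a)) = f b" using sa fab by simp
      ultimately show "f x = complex_of_real (Re (f a)) * (\<lambda>x\<in>D. f (a * x) / f a) x +
        complex_of_real (1 - Re (f a)) * (\<lambda>x\<in>D. f (b * x) / f b) x"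
        using x sa by simp
    qed
    then have "(\<lambda>x\<in>D. f (a * x) / f a) = f"
      using f st[OF ab(1) \<open>positive a\<close> pos(1)] st[OF ab(2) \<open>positive b\<close> pos(2)] pos
      unfolding pure_states_def by blast
    then have "f (a * x) / f a = f x" using x by (metis restrict_apply')
    moreover have "f a \<noteq> 0" using pos(1) by auto
    ultimately have "f (a * x) = f a * f x" by (simp add: field_simps)
    moreover have "a * x = (1/2) *\<^sub>R x + c * x" by (simp add: a_def of_real_def distrib_right)
    then have "f (a * x) = complex_of_real (1/2) * f x + f (c * x)"
      using lin(1)[of "(1/2) *\<^sub>R x" "c * x"] lin(3)[OF x, of "1/2"] c x mem by simp
    moreover have "f a = complex_of_real (1/2) + f c"
      using lin(1)[of "of_real (1/2)" c] state_of_real[OF A fs, of "1/2"] c mem by (simp add: a_def)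
    ultimately show ?thesis by (simp add: algebra_simps)
  qed
  have sa: "f (c * x) = f c * f x" if c: "c \<in> D" "star c = c" and x: "x \<in> D" for c x
  proof -
    define k where "k = 1 / (2 * (norm c + 1))"
    have k: "k > 0" using norm_ge_zero[of c] by (simp add: k_def add_nonneg_pos)
    have "norm (k *\<^sub>R c) = norm c / (2 * (norm c + 1))" using k by (simp add: k_def)
    also have "\<dots> < 1/2" by (simp add: divide_simps add_nonneg_pos)
    finally have "f ((k *\<^sub>R c) * x) = f (k *\<^sub>R c) * f x"
      using c x mem by (intro small) auto
    then show ?thesis using c x k mem by (simp add: lin)
  qed
  have "f (y * x) = f y * f x" if y: "y \<in> D" and x: "x \<in> D" for x y
  proof -
    define a b where "a = re_part y" and "b = im_part y"
    have ab: "a \<in> D" "b \<in> D" "star a = a" "star b = b" using y mem by (auto simp: a_def b_def)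
    have ya: "y = a + scaleC \<i> b" using cartesian by (simp add: a_def b_def)
    show ?thesis using ab x mem by (simp add: ya ring_distribs lin scaleC_mult_left sa)
  qed
  moreover have "\<exists>x\<in>D. f x \<noteq> 0" using mem statesD(3)[OF fs] by (intro bexI[of _ 1]) auto
  ultimately show ?thesis using statesD(1)[OF fs] by (simp add: characters_def)
qed

lemma pure_states_eq_characters: "pure_states D = characters D"
  using pure_character character_pure by blast

text \<open>Pure states of \<open>D\<close> are its characters, and every character extends, so what
  remains is uniqueness of the extension.\<close>

lemma extension_property_iff:
  "extension_property D \<longleftrightarrow>
    (\<forall>\<rho>\<in>characters D. \<forall>f g. f \<in> states UNIV \<longrightarrow> g \<in> states UNIV \<longrightarrow>
       (\<forall>d\<in>D. f d = \<rho> d) \<longrightarrow> (\<forall>d\<in>D. g d = \<rho> d) \<longrightarrow> f = g)"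
proof -
  have "\<not> (\<forall>d\<in>D. g d = 0)" if "g \<in> pure_states UNIV" for g :: "'a \<Rightarrow> complex"
    using that mem by (auto simp: pure_states_def states_def intro!: bexI[of _ 1])
  then have "extension_property D \<longleftrightarrow>
      (\<forall>\<rho>\<in>characters D. \<exists>!g. g \<in> states UNIV \<and> (\<forall>d\<in>D. g d = \<rho> d))"
    by (auto simp: extension_property_def pure_states_eq_characters)
  moreover have "(\<exists>!g. g \<in> states UNIV \<and> (\<forall>d\<in>D. g d = \<rho> d)) \<longleftrightarrow>
      (\<forall>f g. f \<in> states UNIV \<longrightarrow> g \<in> states UNIV \<longrightarrow>
       (\<forall>d\<in>D. f d = \<rho> d) \<longrightarrow> (\<forall>d\<in>D. g d = \<rho> d) \<longrightarrow> f = g)" if r: "\<rho> \<in> characters D" for \<rho>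
  proof -
    obtain f where "f \<in> states UNIV" "\<And>d. d \<in> D \<Longrightarrow> f d = \<rho> d"
      using character_extend[OF r] by metis
    then show ?thesis by blast
  qed
  ultimately show ?thesis by simp
qed

end

section \<open>The character space\<close>

context
  fixes D :: "'a::cstar_algebra set"
  assumes D: "inclusion D"
  notes mem = mem_inclusion[OF D]
begin

lemma topspace_character_space: "topspace (character_space D) = characters D"
  by (auto simp: character_space_def PiE_def charactersD(6))

lemma continuous_map_evaluation:
  "d \<in> D \<Longrightarrow> continuous_map (character_space D) euclidean (\<lambda>\<rho>. \<rho> d)"
  unfolding character_space_def
  by (intro continuous_map_from_subtopology continuous_map_product_projection)

lemma openin_character_Re:
  assumes "d \<in> D" shows "openin (character_space D) {\<rho> \<in> characters D. 0 < Re (\<rho> d)}"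
proof -
  have "open {z. 0 < Re z}" by (rule open_halfspace_Re_gt)
  then have "openin euclidean {z. 0 < Re z}" by simp
  from openin_continuous_map_preimage[OF continuous_map_evaluation[OF assms] this]
  show ?thesis by (simp add: topspace_character_space)
qed

text \<open>For one coordinate \<open>i\<close>, the positive part of
  \<open>e^2 - |i - \<sigma> i|^2\<close> is nonzero only where \<open>\<rho> i\<close> is within
  \<open>e\<close> of \<open>\<sigma> i\<close>. A basic neighbourhood restricts finitely many
  coordinates, and the product of their bumps serves it.\<close>

lemma character_Urysohn:
  assumes U: "openin (character_space D) U" and s: "\<sigma> \<in> U"
  obtains d where "d \<in> D" "star d = d" "\<sigma> d \<noteq> 0"
    "\<And>\<rho>. \<rho> \<in> characters D \<Longrightarrow> \<rho> d \<noteq> 0 \<Longrightarrow> \<rho> \<in> U"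
proof -
  have sc: "\<sigma> \<in> characters D" using openin_subset[OF U] s by (auto simp: topspace_character_space)
  obtain S where S: "openin (product_topology (\<lambda>_. euclidean) D) S" "U = S \<inter> characters D"
    using U by (auto simp: character_space_def openin_subtopology)
  then obtain X where X: "finite {i \<in> D. X i \<noteq> UNIV}" "\<And>i. i \<in> D \<Longrightarrow> open (X i)"
    "\<sigma> \<in> Pi\<^sub>E D X" "Pi\<^sub>E D X \<subseteq> S"
    using s by (auto simp: openin_product_topology_alt)
  have single: "\<exists>d. d \<in> D \<and> star d = d \<and> \<sigma> d \<noteq> 0 \<and> (\<forall>\<rho>\<in>characters D. \<rho> d \<noteq> 0 \<longrightarrow> \<rho> i \<in> X i)"
    if i: "i \<in> D" for i
  proof -
    have "\<sigma> i \<in> X i" using X(3) i by auto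
    then obtain e where e: "0 < e" "ball (\<sigma> i) e \<subseteq> X i" using X(2)[OF i] by (meson openE)
    define y where "y = i - scaleC (\<sigma> i) 1"
    define k where "k = of_real (e\<^sup>2) - star y * y"
    have y: "y \<in> D" using i mem by (auto simp: y_def)
    have k: "k \<in> D" "star k = k" using y mem by (auto simp: k_def simp del: of_real_power)
    obtain d where d: "d \<in> D" "positive d"
      "\<And>\<rho>. \<rho> \<in> characters D \<Longrightarrow> \<rho> d = complex_of_real (max 0 (Re (\<rho> k)))"
      using positive_part[OF D k] by metis
    have rk: "Re (\<rho> k) = e\<^sup>2 - (cmod (\<rho> i - \<sigma> i))\<^sup>2" if r: "\<rho> \<in> characters D" for \<rho>
    proof -
      have ry: "\<rho> y = \<rho> i - \<sigma> i"
        using i mem r by (simp add: y_def character_diff[OF D r] charactersD[OF r] character_one[OF D])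
      have "\<rho> (star y * y) = cnj (\<rho> y) * \<rho> y"
        using charactersD(5)[OF r, of "star y" y] character_star[OF D r y] y mem by simp
      moreover have "\<rho> k = complex_of_real (e\<^sup>2) - \<rho> (star y * y)"
        using y mem unfolding k_def by (simp add: character_diff[OF D r] character_of_real[OF D r] del: of_real_power)
      ultimately have "\<rho> k = complex_of_real (e\<^sup>2 - (cmod (\<rho> i - \<sigma> i))\<^sup>2)"
        using complex_norm_square[of "\<rho> y"] ry by (simp add: mult.commute)
      then show ?thesis by simp
    qed
    have "\<sigma> d \<noteq> 0" using d(3)[OF sc] rk[OF sc] e by simp
    moreover have "\<rho> i \<in> X i" if r: "\<rho> \<in> characters D" "\<rho> d \<noteq> 0" for \<rho>
    proof -
      have "0 < Re (\<rho> k)" using d(3)[OF r(1)] r(2) by (auto simp: max_def split: if_splits)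
      then have "(cmod (\<rho> i - \<sigma> i))\<^sup>2 < e\<^sup>2" using rk[OF r(1)] by simp
      then have "cmod (\<rho> i - \<sigma> i) < e"
        using power2_less_imp_less[of "cmod (\<rho> i - \<sigma> i)" e] e(1) by simp
      then have "\<rho> i \<in> ball (\<sigma> i) e" by (simp add: dist_norm norm_minus_commute)
      then show ?thesis using e(2) by blast
    qed
    ultimately show ?thesis using d positive_star by blast
  qed
  have "\<exists>d. d \<in> D \<and> star d = d \<and> \<sigma> d \<noteq> 0 \<and> (\<forall>\<rho>\<in>characters D. \<rho> d \<noteq> 0 \<longrightarrow> (\<forall>i\<in>F. \<rho> i \<in> X i))"
    if "finite F" "F \<subseteq> D" for F
    using that
  proof (induction F rule: finite_induct)
    case empty
    then show ?case using mem character_one[OF D sc] by (intro exI[of _ 1]) auto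
  next
    case (insert i F)
    then obtain d where d: "d \<in> D" "star d = d" "\<sigma> d \<noteq> 0"
      "\<forall>\<rho>\<in>characters D. \<rho> d \<noteq> 0 \<longrightarrow> (\<forall>i\<in>F. \<rho> i \<in> X i)" by auto
    obtain e where e: "e \<in> D" "star e = e" "\<sigma> e \<noteq> 0" "\<forall>\<rho>\<in>characters D. \<rho> e \<noteq> 0 \<longrightarrow> \<rho> i \<in> X i"
      using single[of i] insert by auto
    have "star (d * e) = d * e" using d e inclusionD(3)[OF D] by simp
    then show ?case
      using d e mem by (intro exI[of _ "d * e"]) (auto simp: charactersD(5)[OF sc] charactersD(5))
  qed
  from this[OF X(1)] obtain d where d: "d \<in> D" "star d = d" "\<sigma> d \<noteq> 0"
      "\<forall>\<rho>\<in>characters D. \<rho> d \<noteq> 0 \<longrightarrow> (\<forall>i\<in>{i \<in> D. X i \<noteq> UNIV}. \<rho> i \<in> X i)" by auto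
  have "\<rho> \<in> U" if "\<rho> \<in> characters D" "\<rho> d \<noteq> 0" for \<rho>
  proof -
    have "\<rho> i \<in> X i" if "i \<in> D" for i using d(4) that \<open>\<rho> \<in> characters D\<close> \<open>\<rho> d \<noteq> 0\<close> by (cases "X i = UNIV") auto
    then have "\<rho> \<in> Pi\<^sub>E D X" using that charactersD(6) by (auto simp: PiE_def)
    then show ?thesis using X(4) S(2) that by auto
  qed
  then show ?thesis using that d by blast
qed

section \<open>The action of the normalizers\<close>

lemma normalizersD:
  assumes "v \<in> normalizers D"
  shows "d \<in> D \<Longrightarrow> star v * d * v \<in> D" "d \<in> D \<Longrightarrow> v * d * star v \<in> D"
    "d \<in> D \<Longrightarrow> star v * (d * v) \<in> D" "d \<in> D \<Longrightarrow> v * (d * star v) \<in> D"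
    "star v * v \<in> D" "v * star v \<in> D"
proof -
  show 1: "star v * d * v \<in> D" "v * d * star v \<in> D" if "d \<in> D" for d
    using assms that by (auto simp: normalizers_def)
  then show "star v * (d * v) \<in> D" "v * (d * star v) \<in> D" if "d \<in> D" for d
    using that by (simp_all add: mult.assoc)
  show "star v * v \<in> D" "v * star v \<in> D" using 1[of 1] mem by simp_all
qed

lemma normalizers_star: "v \<in> normalizers D \<Longrightarrow> star v \<in> normalizers D"
  by (simp add: normalizers_def)

lemma normalizers_mult:
  assumes "v \<in> normalizers D" "w \<in> normalizers D" shows "v * w \<in> normalizers D"
proof -
  have "star (v * w) * d * (v * w) \<in> D" "(v * w) * d * star (v * w) \<in> D" if "d \<in> D" for d
    using normalizersD(1)[OF assms(2) normalizersD(1)[OF assms(1) that]]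
      normalizersD(2)[OF assms(1) normalizersD(2)[OF assms(2) that]] by (simp_all add: mult.assoc)
  then show ?thesis by (simp add: normalizers_def)
qed

lemma normalizers_one: "1 \<in> normalizers D"
  by (simp add: normalizers_def)

text \<open>\<open>v * star v\<close> lies in \<open>D\<close> and commutes with \<open>d\<close>.
  This makes \<open>\<beta>\<^sub>v \<rho>\<close> multiplicative; it also shows that
  \<open>\<rho> (star v * d * v)\<close> vanishes whenever \<open>\<rho> (star v * v)\<close>
  does.\<close>

lemma character_normalizer_mult:
  assumes r: "\<rho> \<in> characters D" and v: "v \<in> normalizers D" and d: "d \<in> D" "e \<in> D"
  shows "\<rho> (star v * d * v) * \<rho> (star v * e * v) = \<rho> (star v * v) * \<rho> (star v * (d * e) * v)"
proof -
  have eq: "d * (v * star v) = (v * star v) * d"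
    using normalizersD(6)[OF v] d by (intro inclusionD(3)[OF D])
  have "(star v * d * v) * (star v * e * v) = star v * (d * (v * star v)) * (e * v)"
    by (simp add: mult.assoc)
  also have "\<dots> = (star v * v) * (star v * (d * e) * v)"
    unfolding eq by (simp add: mult.assoc)
  finally have "\<rho> ((star v * d * v) * (star v * e * v)) = \<rho> ((star v * v) * (star v * (d * e) * v))"
    by (rule arg_cong)
  then show ?thesis
    using d mem by (simp only: charactersD(5)[OF r] normalizersD(1,5)[OF v])
qed

lemma character_normalizer_pos:
  assumes r: "\<rho> \<in> characters D" and v: "v \<in> normalizers D"
  shows "0 < \<rho> (star v * v) \<longleftrightarrow> \<rho> (star v * v) \<noteq> 0" "0 < \<rho> (star v * v) \<longleftrightarrow> 0 < Re (\<rho> (star v * v))"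
  using character_positive[OF D r normalizersD(5)[OF v] positive_star_mult]
  by (auto simp: less_complex_def less_eq_complex_def complex_eq_iff)

lemma beta_Some_iff:
  "beta D v \<rho> = Some \<sigma> \<longleftrightarrow> \<rho> \<in> characters D \<and> 0 < \<rho> (star v * v) \<and>
     \<sigma> = (\<lambda>d\<in>D. \<rho> (star v * d * v) / \<rho> (star v * v))"
  by (auto simp: beta_def)

lemma dom_beta: "dom (beta D v) = {\<rho> \<in> characters D. 0 < \<rho> (star v * v)}"
  by (auto simp: beta_def dom_def)

lemma beta_character:
  assumes v: "v \<in> normalizers D" and b: "beta D v \<rho> = Some \<sigma>"
  shows "\<sigma> \<in> characters D"
proof -
  have r: "\<rho> \<in> characters D" and p: "0 < \<rho> (star v * v)"
    and s: "\<sigma> = (\<lambda>d\<in>D. \<rho> (star v * d * v) / \<rho> (star v * v))"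
    using b by (auto simp: beta_Some_iff)
  have ne: "\<rho> (star v * v) \<noteq> 0" using p by auto
  have "\<sigma> (x + y) = \<sigma> x + \<sigma> y" if "x \<in> D" "y \<in> D" for x y
    using that mem normalizersD[OF v]
    by (simp add: s distrib_left distrib_right charactersD(2)[OF r] add_divide_distrib)
  moreover have "\<sigma> (scaleC c x) = c * \<sigma> x" if "x \<in> D" for c x
    using that mem normalizersD[OF v]
    by (simp add: s scaleC_mult_left scaleC_mult_right charactersD(3)[OF r])
  moreover have "\<sigma> (x * y) = \<sigma> x * \<sigma> y" if xy: "x \<in> D" "y \<in> D" for x y
    using character_normalizer_mult[OF r v xy] xy mem ne by (simp add: s field_simps)
  moreover have "\<exists>x\<in>D. \<sigma> x \<noteq> 0" using ne mem by (intro bexI[of _ 1]) (simp_all add: s)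
  moreover have "\<sigma> \<in> extensional D" by (simp add: s)
  ultimately show ?thesis by (simp add: characters_def functionals_def)
qed

text \<open>Since \<open>star v * (v * d * star v) * v = (star v * v) * d * (star v * v)\<close>,
  one finds \<open>\<sigma> (v * d * star v) = \<rho> (star v * v) * \<rho> d\<close>;
  \<open>d = 1\<close> gives the normalizing factor.\<close>

lemma beta_star_apply:
  assumes v: "v \<in> normalizers D" and b: "beta D v \<rho> = Some \<sigma>"
  shows "beta D (star v) \<sigma> = Some \<rho>"
proof -
  have r: "\<rho> \<in> characters D" and p: "0 < \<rho> (star v * v)"
    and s: "\<sigma> = (\<lambda>d\<in>D. \<rho> (star v * d * v) / \<rho> (star v * v))"
    using b by (auto simp: beta_Some_iff)
  have ne: "\<rho> (star v * v) \<noteq> 0" using p by auto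
  have 1: "\<rho> (star v * (v * d * star v) * v) = \<rho> (star v * v) * \<rho> d * \<rho> (star v * v)" if "d \<in> D" for d
  proof -
    have "star v * (v * d * star v) * v = (star v * v) * d * (star v * v)" by (simp add: mult.assoc)
    then show ?thesis
      using that mem by (simp only: charactersD(5)[OF r] normalizersD(5)[OF v])
  qed
  have s2: "\<sigma> (v * d * star v) = \<rho> (star v * v) * \<rho> d" if "d \<in> D" for d
    using 1[OF that] ne normalizersD(2)[OF v that] by (simp add: s)
  have s1: "\<sigma> (v * star v) = \<rho> (star v * v)"
    using s2[of 1] mem character_one[OF D r] by simp
  have "(\<lambda>d\<in>D. \<sigma> (v * d * star v) / \<sigma> (v * star v)) = \<rho>"
    using ne charactersD(6)[OF r] by (intro extensionalityI[of _ D]) (auto simp: s1 s2)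
  then show ?thesis
    using beta_character[OF v b] p by (simp add: beta_Some_iff s1)
qed

lemma beta_star_iff:
  assumes v: "v \<in> normalizers D"
  shows "beta D (star v) \<sigma> = Some \<rho> \<longleftrightarrow> beta D v \<rho> = Some \<sigma>"
proof
  assume "beta D (star v) \<sigma> = Some \<rho>"
  then show "beta D v \<rho> = Some \<sigma>" using beta_star_apply[OF normalizers_star[OF v]] by simp
qed (rule beta_star_apply[OF v])

lemma ran_beta:
  assumes v: "v \<in> normalizers D" shows "ran (beta D v) = dom (beta D (star v))"
  using beta_star_iff[OF v] by (auto simp: ran_def dom_def)

lemma beta_star_partial_inv:
  assumes v: "v \<in> normalizers D" shows "beta D (star v) = partial_inv (beta D v)"
proof
  fix y
  show "beta D (star v) y = partial_inv (beta D v) y"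
  proof (cases "y \<in> ran (beta D v)")
    case True
    then obtain x where x: "beta D v x = Some y" by (auto simp: ran_def)
    have "(THE x. beta D v x = Some y) = x"
    proof (rule the_equality)
      show "z = x" if "beta D v z = Some y" for z
        using beta_star_apply[OF v that] beta_star_apply[OF v x] by simp
    qed (rule x)
    then show ?thesis using True beta_star_apply[OF v x] by (simp add: partial_inv_def)
  next
    case False
    then show ?thesis unfolding ran_beta[OF v] using False by (auto simp: partial_inv_def ran_beta[OF v])
  qed
qed

lemma beta_mult:
  assumes v: "v \<in> normalizers D" and w: "w \<in> normalizers D"
  shows "beta D (v * w) = beta D v \<circ>\<^sub>m beta D w"
proof
  fix \<rho>
  show "beta D (v * w) \<rho> = (beta D v \<circ>\<^sub>m beta D w) \<rho>"
  proof (cases "\<rho> \<in> characters D \<and> \<rho> (star w * w) \<noteq> 0")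
    case False
    show ?thesis
    proof (cases "\<rho> \<in> characters D")
      case True
      then have 0: "\<rho> (star w * w) = 0" using False by simp
      have vv: "star v * v \<in> D" by (rule normalizersD(5)[OF v])
      \<comment> \<open>Outside the domain of \<open>beta D w\<close> the map of
        \<open>v * w\<close> must be undefined too: \<open>\<rho> (star w * w) = 0\<close> forces
        the square of \<open>\<rho> (star w * (star v * v) * w)\<close> to vanish.\<close>
      have "\<rho> (star w * (star v * v) * w) * \<rho> (star w * (star v * v) * w) = 0"
        using character_normalizer_mult[OF True w vv vv] 0 by simp
      then have "\<rho> (star (v * w) * (v * w)) = 0" by (simp add: mult.assoc)
      then show ?thesis using 0 by (simp add: beta_def map_comp_def)
    qed (simp add: beta_def map_comp_def)
  next
    case True
    then have r: "\<rho> \<in> characters D" and ne: "\<rho> (star w * w) \<noteq> 0" by auto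
    have p: "0 < \<rho> (star w * w)" using ne character_normalizer_pos[OF r w] by simp
    define \<sigma> where "\<sigma> = (\<lambda>d\<in>D. \<rho> (star w * d * w) / \<rho> (star w * w))"
    have b: "beta D w \<rho> = Some \<sigma>" using r p by (simp add: beta_Some_iff \<sigma>_def)
    have s: "\<sigma> \<in> characters D" by (rule beta_character[OF w b])
    have sv: "\<sigma> (star v * d * v) = \<rho> (star (v * w) * d * (v * w)) / \<rho> (star w * w)" if "d \<in> D" for d
      using normalizersD(1)[OF v that] by (simp add: \<sigma>_def mult.assoc)
    have sv1: "\<sigma> (star v * v) = \<rho> (star (v * w) * (v * w)) / \<rho> (star w * w)"
      using sv[of 1] mem by simp
    have iff: "0 < \<sigma> (star v * v) \<longleftrightarrow> 0 < \<rho> (star (v * w) * (v * w))"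
      using ne sv1 character_normalizer_pos(1)[OF s v]
        character_normalizer_pos(1)[OF r normalizers_mult[OF v w]] by simp
    have eq: "(\<lambda>d\<in>D. \<rho> (star (v * w) * d * (v * w)) / \<rho> (star (v * w) * (v * w))) =
        (\<lambda>d\<in>D. \<sigma> (star v * d * v) / \<sigma> (star v * v))"
      using ne by (intro restrict_ext) (simp add: sv sv1 del: star_mult)
    show ?thesis
      unfolding map_comp_def b using iff r s eq by (simp add: beta_def del: star_mult)
  qed
qed

lemma openin_dom_beta:
  assumes v: "v \<in> normalizers D" shows "openin (character_space D) (dom (beta D v))"
proof -
  have "dom (beta D v) = {\<rho> \<in> characters D. 0 < Re (\<rho> (star v * v))}"
    using character_normalizer_pos(2)[OF _ v] by (auto simp: dom_beta)
  then show ?thesis using openin_character_Re[OF normalizersD(5)[OF v]] by simp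
qed

lemma continuous_map_beta:
  assumes v: "v \<in> normalizers D"
  shows "continuous_map (subtopology (character_space D) (dom (beta D v)))
     (subtopology (character_space D) (ran (beta D v))) (\<lambda>\<rho>. the (beta D v \<rho>))"
    (is "continuous_map ?X _ ?f")
proof -
  have top: "topspace ?X = dom (beta D v)"
    using openin_subset[OF openin_dom_beta[OF v]] by auto
  have app: "?f \<rho> = (\<lambda>d\<in>D. \<rho> (star v * d * v) / \<rho> (star v * v))" "\<rho> (star v * v) \<noteq> 0"
    "beta D v \<rho> = Some (?f \<rho>)" if "\<rho> \<in> dom (beta D v)" for \<rho>
  proof -
    have "\<rho> \<in> characters D" "0 < \<rho> (star v * v)" using that unfolding dom_beta by auto
    then show "?f \<rho> = (\<lambda>d\<in>D. \<rho> (star v * d * v) / \<rho> (star v * v))" "\<rho> (star v * v) \<noteq> 0"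
      "beta D v \<rho> = Some (?f \<rho>)" by (auto simp: beta_def)
  qed
  have ev: "continuous_map ?X euclidean (\<lambda>\<rho>. \<rho> d)" if "d \<in> D" for d
    using continuous_map_evaluation[OF that] by (rule continuous_map_from_subtopology)
  have "continuous_map ?X euclidean (\<lambda>\<rho>. ?f \<rho> d)" if d: "d \<in> D" for d
  proof (rule continuous_map_eq)
    show "continuous_map ?X euclidean (\<lambda>\<rho>. \<rho> (star v * d * v) / \<rho> (star v * v))"
      using ev[OF normalizersD(1)[OF v d]] ev[OF normalizersD(5)[OF v]] app(2)
      unfolding continuous_map_atin top by (auto intro!: tendsto_divide)
  qed (use app d in \<open>auto simp: top\<close>)
  then have "continuous_map ?X (product_topology (\<lambda>_. euclidean) D) ?f"
    unfolding continuous_map_componentwise using app by (auto simp: top)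
  moreover have "?f \<in> topspace ?X \<rightarrow> characters D \<inter> ran (beta D v)"
    unfolding top using app(3) beta_character[OF v] by (auto simp: ran_def)
  ultimately show ?thesis
    unfolding character_space_def by (simp add: continuous_map_in_subtopology subtopology_subtopology)
qed

lemma beta_partial_homeo:
  assumes v: "v \<in> normalizers D" shows "beta D v \<in> partial_homeos (character_space D)"
proof -
  note v' = normalizers_star[OF v]
  have rd: "ran (beta D v) = dom (beta D (star v))" "ran (beta D (star v)) = dom (beta D v)"
    using ran_beta[OF v] ran_beta[OF v'] by auto
  have "the (beta D (star v) (the (beta D v x))) = x" if "x \<in> dom (beta D v)" for x
    using that beta_star_apply[OF v, of x] by auto
  moreover have "the (beta D v (the (beta D (star v) x))) = x" if "x \<in> dom (beta D (star v))" for x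
    using that beta_star_apply[OF v', of x] by auto
  ultimately have "homeomorphic_maps (subtopology (character_space D) (dom (beta D v)))
      (subtopology (character_space D) (ran (beta D v)))
      (\<lambda>x. the (beta D v x)) (\<lambda>x. the (beta D (star v) x))"
    unfolding homeomorphic_maps_def
    using continuous_map_beta[OF v] continuous_map_beta[OF v'] by (auto simp: rd)
  then show ?thesis
    using openin_dom_beta[OF v] openin_dom_beta[OF v'] homeomorphic_map_maps
    by (auto simp: partial_homeos_def rd)
qed

lemma beta_semigroup_action: "semigroup_action (normalizers D) (character_space D) (beta D)"
  unfolding semigroup_action_def
  using normalizers_mult normalizers_star beta_partial_homeo beta_mult beta_star_partial_inv by auto

lemma beta_one: "beta D 1 = (\<lambda>\<rho>. if \<rho> \<in> topspace (character_space D) then Some \<rho> else None)"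
proof
  fix \<rho>
  have "(\<lambda>d\<in>D. \<rho> d) = \<rho>" if "\<rho> \<in> characters D"
    using charactersD(6)[OF that] by (auto simp: extensional_restrict)
  then show "beta D 1 \<rho> = (if \<rho> \<in> topspace (character_space D) then Some \<rho> else None)"
    using character_one[OF D, of \<rho>]
    by (cases "\<rho> \<in> characters D") (simp_all add: beta_def topspace_character_space less_complex_def)
qed

end

section \<open>Germs\<close>

lemma germ_rel_iff:
  "((x, \<phi>, y), (x1, \<phi>1, y1)) \<in> germ_rel X P \<longleftrightarrow>
     \<phi> \<in> P \<and> \<phi> y = Some x \<and> \<phi>1 \<in> P \<and> \<phi>1 y = Some x1 \<and> y1 = y \<and>
     (\<exists>U. openin X U \<and> y \<in> U \<and> U \<subseteq> dom \<phi> \<inter> dom \<phi>1 \<and> (\<forall>z\<in>U. \<phi> z = \<phi>1 z))"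
  unfolding germ_rel_def germ_reps_def by (cases "y1 = y") auto

lemma germ_rel_sym:
  assumes "(u, v) \<in> germ_rel X P" shows "(v, u) \<in> germ_rel X P"
proof -
  obtain x \<phi> y x1 \<phi>1 y1 where uv: "u = (x, \<phi>, y)" "v = (x1, \<phi>1, y1)" by (metis prod_cases3)
  then obtain U where "openin X U" "y \<in> U" "U \<subseteq> dom \<phi> \<inter> dom \<phi>1" "\<forall>z\<in>U. \<phi> z = \<phi>1 z"
    using assms by (auto simp: germ_rel_iff)
  then have "openin X U \<and> y \<in> U \<and> U \<subseteq> dom \<phi>1 \<inter> dom \<phi> \<and> (\<forall>z\<in>U. \<phi>1 z = \<phi> z)" by simp
  then show ?thesis using assms unfolding uv germ_rel_iff by blast
qed

lemma germ_rel_trans: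
  assumes uv: "(u, v) \<in> germ_rel X P" and vw: "(v, w) \<in> germ_rel X P"
  shows "(u, w) \<in> germ_rel X P"
proof -
  obtain x \<phi> y x1 \<phi>1 y1 x2 \<phi>2 y2 where eq: "u = (x, \<phi>, y)" "v = (x1, \<phi>1, y1)" "w = (x2, \<phi>2, y2)"
    by (metis prod_cases3)
  obtain U where U: "openin X U" "y \<in> U" "U \<subseteq> dom \<phi> \<inter> dom \<phi>1" "\<forall>z\<in>U. \<phi> z = \<phi>1 z"
    using uv by (auto simp: eq germ_rel_iff)
  obtain V where V: "openin X V" "y \<in> V" "V \<subseteq> dom \<phi>1 \<inter> dom \<phi>2" "\<forall>z\<in>V. \<phi>1 z = \<phi>2 z"
    using vw uv by (auto simp: eq germ_rel_iff)
  have "openin X (U \<inter> V) \<and> y \<in> U \<inter> V \<and> U \<inter> V \<subseteq> dom \<phi> \<inter> dom \<phi>2 \<and> (\<forall>z\<in>U \<inter> V. \<phi> z = \<phi>2 z)"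
    using U V by auto
  then show ?thesis using uv vw unfolding eq germ_rel_iff by blast
qed

lemma germ_rel_Image_eq:
  assumes "(a, b) \<in> germ_rel X P"
  shows "germ_rel X P `` {a} = germ_rel X P `` {b}"
  using germ_rel_trans[OF assms] germ_rel_trans[OF germ_rel_sym[OF assms]] by blast

text \<open>An isotropy element at \<open>\<sigma>\<close> is the class of some
  \<open>(\<sigma>, \<phi>, \<sigma>)\<close>, and it is the unit exactly when \<open>\<phi>\<close>
  is the identity near \<open>\<sigma>\<close>. As \<open>trivial_group\<close> also asks for a
  group, the product of the unit with itself has to be computed.\<close>

lemma trivial_isotropy_iff:
  fixes X :: "'x topology" and P :: "('x \<rightharpoonup> 'x) set"
  defines "e \<equiv> (\<lambda>y. if y \<in> topspace X then Some y else None)"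
  assumes e: "e \<in> P" and comp: "\<And>\<phi> \<psi>. \<phi> \<in> P \<Longrightarrow> \<psi> \<in> P \<Longrightarrow> \<phi> \<circ>\<^sub>m \<psi> \<in> P"
    and opn: "\<And>\<phi>. \<phi> \<in> P \<Longrightarrow> openin X (dom \<phi>)"
    and s: "\<sigma> \<in> topspace X"
  shows "trivial_group (isotropy_group (germ_groupoid X P) \<sigma>) \<longleftrightarrow>
    (\<forall>\<phi>\<in>P. \<phi> \<sigma> = Some \<sigma> \<longrightarrow> (\<exists>U. openin X U \<and> \<sigma> \<in> U \<and> (\<forall>z\<in>U. \<phi> z = Some z)))"
    (is "?L \<longleftrightarrow> ?R")
proof -
  let ?E = "germ_rel X P"
  let ?I = "isotropy_group (germ_groupoid X P) \<sigma>"
  have refl: "(t, t) \<in> ?E" if t: "t \<in> germ_reps P" for t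
  proof -
    obtain x \<phi> y where "t = (x, \<phi>, y)" "\<phi> \<in> P" "\<phi> y = Some x"
      using t by (auto simp: germ_reps_def)
    then show ?thesis using opn[of \<phi>] by (auto simp: germ_rel_iff intro!: exI[of _ "dom \<phi>"])
  qed
  have es: "e \<sigma> = Some \<sigma>" using s by (simp add: e_def)
  have rel_e: "((\<sigma>, \<phi>, \<sigma>), (\<sigma>, e, \<sigma>)) \<in> ?E \<longleftrightarrow> (\<exists>U. openin X U \<and> \<sigma> \<in> U \<and> (\<forall>z\<in>U. \<phi> z = Some z))"
    if p: "\<phi> \<in> P" "\<phi> \<sigma> = Some \<sigma>" for \<phi>
  proof
    assume "((\<sigma>, \<phi>, \<sigma>), (\<sigma>, e, \<sigma>)) \<in> ?E"
    then obtain U where U: "openin X U" "\<sigma> \<in> U" "\<forall>z\<in>U. \<phi> z = e z" by (auto simp: germ_rel_iff)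
    then show "\<exists>U. openin X U \<and> \<sigma> \<in> U \<and> (\<forall>z\<in>U. \<phi> z = Some z)"
      using openin_subset[OF U(1)] by (auto simp: e_def intro!: exI[of _ U])
  next
    assume "\<exists>U. openin X U \<and> \<sigma> \<in> U \<and> (\<forall>z\<in>U. \<phi> z = Some z)"
    then obtain U where U: "openin X U" "\<sigma> \<in> U" "\<forall>z\<in>U. \<phi> z = Some z" by blast
    have "\<forall>z\<in>U. e z = Some z" using openin_subset[OF U(1)] by (auto simp: e_def)
    then show "((\<sigma>, \<phi>, \<sigma>), (\<sigma>, e, \<sigma>)) \<in> ?E"
      using U p e es by (auto simp: germ_rel_iff intro!: exI[of _ U])
  qed
  have cls: "(x', \<psi>, y') \<in> ?E `` {(x, \<phi>, y)} \<Longrightarrow> x' = x \<and> y' = y" for x x' y y' \<phi> \<psi>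
    by (auto simp: germ_rel_iff)
  have rs: "range_map (germ_groupoid X P) (?E `` {t}) = fst t"
    "source_map (germ_groupoid X P) (?E `` {t}) = snd (snd t)" if t: "t \<in> germ_reps P" for t
  proof -
    obtain x \<phi> y where txy: "t = (x, \<phi>, y)" by (cases t) auto
    have "t \<in> ?E `` {t}" using refl[OF t] by simp
    then show "range_map (germ_groupoid X P) (?E `` {t}) = fst t"
      "source_map (germ_groupoid X P) (?E `` {t}) = snd (snd t)"
      unfolding germ_groupoid_def txy using cls by (auto intro!: the_equality)
  qed
  have carrier: "carrier ?I = {?E `` {(\<sigma>, \<phi>, \<sigma>)} | \<phi>. \<phi> \<in> P \<and> \<phi> \<sigma> = Some \<sigma>}"
  proof -
    have "arrows (germ_groupoid X P) = {?E `` {t} | t. t \<in> germ_reps P}"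
      by (auto simp: germ_groupoid_def quotient_def)
    then have "carrier ?I = {?E `` {t} | t. t \<in> germ_reps P \<and> fst t = \<sigma> \<and> snd (snd t) = \<sigma>}"
      using rs by (auto simp: isotropy_group_def)
    also have "\<dots> = {?E `` {(\<sigma>, \<phi>, \<sigma>)} | \<phi>. \<phi> \<in> P \<and> \<phi> \<sigma> = Some \<sigma>}"
      by (auto simp: germ_reps_def)
    finally show ?thesis .
  qed
  have one: "one ?I = ?E `` {(\<sigma>, e, \<sigma>)}"
    by (simp add: isotropy_group_def germ_groupoid_def e_def)
  show ?thesis
  proof
    assume ?L
    then have c: "carrier ?I = {one ?I}" by (simp add: trivial_group_def)
    show ?R
    proof (intro ballI impI)
      fix \<phi> assume p: "\<phi> \<in> P" "\<phi> \<sigma> = Some \<sigma>"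
      then have "?E `` {(\<sigma>, \<phi>, \<sigma>)} \<in> carrier ?I" unfolding carrier by blast
      then have "?E `` {(\<sigma>, \<phi>, \<sigma>)} = ?E `` {(\<sigma>, e, \<sigma>)}" unfolding c one by simp
      moreover have "(\<sigma>, e, \<sigma>) \<in> ?E `` {(\<sigma>, e, \<sigma>)}"
        using refl[of "(\<sigma>, e, \<sigma>)"] e es by (simp add: germ_reps_def)
      ultimately have "((\<sigma>, \<phi>, \<sigma>), (\<sigma>, e, \<sigma>)) \<in> ?E" by auto
      then show "\<exists>U. openin X U \<and> \<sigma> \<in> U \<and> (\<forall>z\<in>U. \<phi> z = Some z)" using rel_e[OF p] by simp
    qed
  next
    assume R: ?R
    have all: "?E `` {(\<sigma>, \<phi>, \<sigma>)} = ?E `` {(\<sigma>, e, \<sigma>)}" if p: "\<phi> \<in> P" "\<phi> \<sigma> = Some \<sigma>" for \<phi>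
      using rel_e[OF p] R p by (intro germ_rel_Image_eq) blast
    have c: "carrier ?I = {one ?I}" unfolding carrier one using all e es by blast
    \<comment> \<open>Products of germs are images of whole sets of representatives. Once these all
      have the same class, and at least one exists, the image is that class.\<close>
    have const: "?E `` S = c" if "S \<noteq> {}" "\<And>t. t \<in> S \<Longrightarrow> ?E `` {t} = c" for S c
      using that by fast
    have mult: "mult ?I (one ?I) (one ?I) = one ?I"
    proof -
      let ?S = "{(w, \<phi> \<circ>\<^sub>m \<psi>, z) | w \<phi> x \<psi> z. (w, \<phi>, x) \<in> one ?I \<and> (x, \<psi>, z) \<in> one ?I}"
      have "mult ?I (one ?I) (one ?I) = ?E `` ?S" by (simp add: isotropy_group_def germ_groupoid_def)
      also have "?E `` ?S = one ?I"
      proof (rule const)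
      show "?E `` {t} = one ?I" if "t \<in> ?S" for t
      proof -
        obtain w \<phi> x \<psi> z where t: "t = (w, \<phi> \<circ>\<^sub>m \<psi>, z)" "(w, \<phi>, x) \<in> one ?I" "(x, \<psi>, z) \<in> one ?I"
          using \<open>t \<in> ?S\<close> by blast
        have "w = \<sigma>" "x = \<sigma>" "z = \<sigma>" "\<phi> \<in> P" "\<psi> \<in> P" "\<phi> \<sigma> = Some \<sigma>" "\<psi> \<sigma> = Some \<sigma>"
          using t(2,3) unfolding one by (auto simp: germ_rel_iff)
        then show ?thesis using all[of "\<phi> \<circ>\<^sub>m \<psi>"] comp unfolding t one by simp
      qed
      show "?S \<noteq> {}"
      proof -
        have "(\<sigma>, e, \<sigma>) \<in> one ?I"
          using refl[of "(\<sigma>, e, \<sigma>)"] e es unfolding one by (simp add: germ_reps_def)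
        then show ?thesis by blast
      qed
      qed
      finally show ?thesis .
    qed
    have "group ?I"
      by (rule groupI) (use c mult in auto)
    then show ?L using c by (simp add: trivial_group_def)
  qed
qed

section \<open>The extension property\<close>

definition locally_trivial :: "'a::cstar_algebra set \<Rightarrow> bool" where
  "locally_trivial D \<longleftrightarrow> (\<forall>v\<in>normalizers D. \<forall>\<sigma>. beta D v \<sigma> = Some \<sigma> \<longrightarrow>
     (\<exists>U. openin (character_space D) U \<and> \<sigma> \<in> U \<and> (\<forall>\<rho>\<in>U. beta D v \<rho> = Some \<rho>)))"

text \<open>Written out without a representation, this is the vector state that \<open>w\<close>
  defines in the GNS representation of \<open>f\<close>.\<close>

lemma state_conjugate:
  fixes w :: "'a::cstar_algebra"
  assumes f: "f \<in> states UNIV" and w: "0 < Re (f (star w * w))"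
  shows "(\<lambda>x. f (star w * x * w) / f (star w * w)) \<in> states UNIV"
proof -
  note flin = functionalsD[OF statesD(1)[OF f]]
  obtain m where m: "f (star w * w) = complex_of_real m" "0 < m"
    using statesD(2)[OF f UNIV_I, of w] w by (metis less_eq_complex_def complex_is_Real_iff
      complex_of_real_def complex_eq_iff Re_complex_of_real Im_complex_of_real zero_complex.simps(2))
  have "0 \<le> f (star w * (star x * x) * w)" for x
    using statesD(2)[OF f UNIV_I, of "x * w"] by (simp add: mult.assoc)
  then show ?thesis
    using m by (auto simp: states_def functionals_def flin ring_distribs add_divide_distrib
        scaleC_mult_left scaleC_mult_right less_eq_complex_def)
qed

context
  fixes D :: "'a::cstar_algebra set"
  assumes D: "inclusion D"
  notes mem = mem_inclusion[OF D]
begin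

lemma beta_fixed_of_state:
  assumes r: "\<rho> \<in> characters D" and f: "f \<in> states UNIV" "\<And>d. d \<in> D \<Longrightarrow> f d = \<rho> d"
    and v: "v \<in> normalizers D" and nz: "f v \<noteq> 0"
  shows "beta D v \<rho> = Some \<rho>"
proof -
  have fm: "f (d * x) = \<rho> d * f x" "f (x * d) = f x * \<rho> d" if "d \<in> D" for d x
    using state_character_mult[OF D r f(1) _ that] f(2) by auto
  have vv: "star v * v \<in> D" by (rule normalizersD(5)[OF D v])
  \<comment> \<open>Cauchy-Schwarz against \<open>1\<close>: a nonzero \<open>f v\<close> puts
    \<open>\<rho>\<close> into the domain of \<open>beta D v\<close>.\<close>
  have "(cmod (f v))\<^sup>2 \<le> Re (f (star v * v))"
    using state_Cauchy_Schwarz[OF cstar_subalgebra_UNIV UNIV_I f(1), of v 1] statesD(3)[OF f(1)] by simp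
  then have "0 < Re (\<rho> (star v * v))" using nz f(2)[OF vv] by (smt (verit) zero_less_norm_iff zero_less_power)
  then have pos: "0 < \<rho> (star v * v)" using character_normalizer_pos(2)[OF D r v] by simp
  have eq: "\<rho> (star v * d * v) = \<rho> d * \<rho> (star v * v)" if d: "d \<in> D" for d
  proof -
    have "(v * star v) * d = d * (v * star v)"
      using normalizersD(6)[OF D v] d by (intro inclusionD(3)[OF D])
    then have "((v * star v) * d) * v = (d * (v * star v)) * v" by simp
    then have "v * (star v * d * v) = d * (v * (star v * v))" by (simp add: mult.assoc)
    then have "f (v * (star v * d * v)) = f (d * (v * (star v * v)))" by simp
    then have "f v * \<rho> (star v * d * v) = \<rho> d * (f v * \<rho> (star v * v))"
      using fm(1)[OF d] fm(2)[OF vv] fm(2)[OF normalizersD(1)[OF D v d]] by simp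
    then show ?thesis using nz by simp
  qed
  have "(\<lambda>d\<in>D. \<rho> (star v * d * v) / \<rho> (star v * v)) = \<rho>"
    using pos charactersD(6)[OF r] by (intro extensionalityI[of _ D]) (auto simp: eq)
  then show ?thesis using r pos by (simp add: beta_Some_iff[OF D])
qed

lemma state_nonzero_of_fixed:
  assumes r: "\<rho> \<in> characters D" and f: "f \<in> states UNIV" "\<And>d. d \<in> D \<Longrightarrow> f d = \<rho> d"
    and uniq: "\<And>g. g \<in> states UNIV \<Longrightarrow> (\<And>d. d \<in> D \<Longrightarrow> g d = \<rho> d) \<Longrightarrow> g = f"
    and v: "v \<in> normalizers D" and fix_v: "beta D v \<rho> = Some \<rho>"
  shows "f v \<noteq> 0"
proof
  assume fv: "f v = 0"
  have fm: "f (d * x) = \<rho> d * f x" "f (x * d) = f x * \<rho> d" if "d \<in> D" for d x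
    using state_character_mult[OF D r f(1) _ that] f(2) by auto
  note flin = functionalsD[OF statesD(1)[OF f(1)]]
  define s where "s = \<rho> (star v * v)"
  have s: "0 < s" "\<rho> = (\<lambda>d\<in>D. \<rho> (star v * d * v) / s)"
    using fix_v by (auto simp: beta_Some_iff[OF D] s_def)
  have rv: "f (star v * d * v) = \<rho> d * s" if "d \<in> D" for d
    using fun_cong[OF s(2), of d] that s(1) f(2)[OF normalizersD(1)[OF D v that]] by auto
  have fs: "f (star v * v) = s" using f(2)[OF normalizersD(5)[OF D v]] by (simp add: s_def)
  have fvs: "f (star v) = 0" using state_star[OF cstar_subalgebra_UNIV UNIV_I f(1), of v] fv by simp
  \<comment> \<open>The vector state of \<open>v\<close> extends the image of \<open>\<rho>\<close>
    under \<open>beta D v\<close>, which is \<open>\<rho>\<close> itself, so uniqueness identifies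
    it with \<open>f\<close>.\<close>
  have conj: "f (star v * x * v) = f x * s" for x
  proof -
    have "(\<lambda>x. f (star v * x * v) / f (star v * v)) \<in> states UNIV"
      using s(1) by (intro state_conjugate f) (simp add: fs less_complex_def)
    then have "(\<lambda>x. f (star v * x * v) / f (star v * v)) = f"
      using rv s(1) by (intro uniq) (auto simp: fs)
    from fun_cong[OF this, of x] show ?thesis using s(1) by (auto simp: fs field_simps)
  qed
  text \<open>The vector states of \<open>1 + tv\<close> also extend \<open>\<rho>\<close>, hence equal \<open>f\<close>.\<close>
  have pol: "t * f (x * v) + cnj t * f (star v * x) = 0" if t: "cnj t * t = 1" for t x
  proof -
    define w where "w = 1 + scaleC t v"
    have w: "f (star w * x * w) = f x + t * f (x * v) + cnj t * f (star v * x) + f (star v * x * v)" for x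
    proof -
      have "star w * x * w = x + scaleC t (x * v) + scaleC (cnj t) (star v * x)
          + scaleC (cnj t * t) (star v * x * v)"
        by (simp add: w_def ring_distribs scaleC_mult_left scaleC_mult_right scaleC_scaleC mult.assoc
            cvec.scale_right_distrib add_ac mult.commute[of t "cnj t"])
      then show ?thesis using t by (simp add: flin)
    qed
    have w1: "f (star w * w) = 1 + s"
      using w[of 1] fv fvs fs statesD(3)[OF f(1)] by simp
    have wd: "f (star w * d * w) = \<rho> d * (1 + s)" if d: "d \<in> D" for d
      using w[of d] fm[OF d] fv fvs rv[OF d] f(2)[OF d] by (simp add: algebra_simps)
    have pos: "0 < 1 + s" using s(1) by (auto simp: less_complex_def)
    have "(\<lambda>x. f (star w * x * w) / f (star w * w)) \<in> states UNIV"
      using pos by (intro state_conjugate f) (simp add: w1 less_complex_def)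
    then have "(\<lambda>x. f (star w * x * w) / f (star w * w)) = f"
      using wd pos by (intro uniq) (auto simp: w1)
    from fun_cong[OF this, of x] have "f (star w * x * w) = f x * (1 + s)"
      using pos by (auto simp: w1 field_simps)
    then show ?thesis using w[of x] conj[of x] by (simp add: algebra_simps)
  qed
  \<comment> \<open>At \<open>x = star v\<close>, the choices \<open>t = 1\<close> and
    \<open>t = \<i>\<close> give the sum and the difference of the same two numbers; so both vanish,
    against \<open>f (star v * v) = s > 0\<close>.\<close>
  have "f (star v * v) + f (star v * star v) = 0" using pol[of 1 "star v"] by simp
  moreover have "\<i> * (f (star v * v) - f (star v * star v)) = 0"
    using pol[of \<i> "star v"] by (simp add: algebra_simps)
  ultimately have "f (star v * v) = 0" by simp
  then show False using fs s(1) by simp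
qed

section \<open>Consequences of the extension property\<close>

lemma extension_unique:
  assumes "extension_property D" "\<rho> \<in> characters D" "f \<in> states UNIV" "g \<in> states UNIV"
    "\<And>d. d \<in> D \<Longrightarrow> f d = \<rho> d" "\<And>d. d \<in> D \<Longrightarrow> g d = \<rho> d"
  shows "f = g"
  using assms unfolding extension_property_iff[OF D] by blast

lemma extension_property_sandwich:
  assumes EP: "extension_property D" and r: "\<rho> \<in> characters D" and x: "star x = x" and e: "0 < e"
  obtains d1 d2 where "d1 \<in> D" "star d1 = d1" "d2 \<in> D" "star d2 = d2"
    "positive (x - d1)" "positive (d2 - x)" "Re (\<rho> d2) - Re (\<rho> d1) < e"
proof (rule unique_extension_sandwich[OF D r _ x e])
  show "f = g" if "f \<in> states UNIV" "g \<in> states UNIV" "\<And>d. d \<in> D \<Longrightarrow> f d = \<rho> d"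
    "\<And>d. d \<in> D \<Longrightarrow> g d = \<rho> d" for f g
    using extension_unique[OF EP r] that by blast
qed (rule that)

lemma extension_property_locally_trivial:
  assumes EP: "extension_property D"
  shows "locally_trivial D"
  unfolding locally_trivial_def
proof (intro ballI allI impI)
  fix v \<sigma> assume v: "v \<in> normalizers D" and fix_v: "beta D v \<sigma> = Some \<sigma>"
  have s: "\<sigma> \<in> characters D" using fix_v by (simp add: beta_Some_iff[OF D])
  obtain f where f: "f \<in> states UNIV" "\<And>d. d \<in> D \<Longrightarrow> f d = \<sigma> d"
    using character_extend[OF D s] by metis
  have fv: "f v \<noteq> 0"
    using state_nonzero_of_fixed[OF s f _ v fix_v] extension_unique[OF EP s _ f(1) _ f(2)] by blast
  have val: "g v = g (re_part v) + \<i> * g (im_part v)" if "g \<in> states UNIV" for g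
    using functionalsD(1,2)[OF statesD(1)[OF that]] by (subst cartesian) simp
  have sa: "g y = complex_of_real (Re (g y))" if "g \<in> states UNIV" "star y = y" for g y
    using that by (intro state_selfadjoint[OF cstar_subalgebra_UNIV]) auto
  have neg: "g (- y) = - g y" if "g \<in> states UNIV" for g y
    using functionals_diff(1)[OF cstar_subalgebra_UNIV statesD(1)[OF that]] by simp
  text \<open>Up to sign, \<open>y\<close> is the real or the imaginary part of \<open>v\<close>.\<close>
  obtain y where y: "star y = y" "0 < Re (f y)"
    "\<And>g. g \<in> states UNIV \<Longrightarrow> 0 < Re (g y) \<Longrightarrow> g v \<noteq> 0"
  proof -
    have nz: "g v \<noteq> 0" if "g \<in> states UNIV" "Re (g (re_part v)) \<noteq> 0 \<or> Re (g (im_part v)) \<noteq> 0" for g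
      using that val[OF that(1)] sa[OF that(1), of "re_part v"] sa[OF that(1), of "im_part v"]
      by (auto simp: complex_eq_iff)
    have "Re (f (re_part v)) \<noteq> 0 \<or> Re (f (im_part v)) \<noteq> 0"
      using fv val[OF f(1)] sa[OF f(1), of "re_part v"] sa[OF f(1), of "im_part v"] by auto
    then consider "0 < Re (f (re_part v))" | "0 < Re (f (- re_part v))"
      | "0 < Re (f (im_part v))" | "0 < Re (f (- im_part v))"
      by (fastforce simp: neg[OF f(1)])
    then show ?thesis
    proof cases
      case 1 then show ?thesis using that[of "re_part v"] nz by force
    next
      case 2 then show ?thesis using that[of "- re_part v"] nz by (force simp: neg)
    next
      case 3 then show ?thesis using that[of "im_part v"] nz by force
    next
      case 4 then show ?thesis using that[of "- im_part v"] nz by (force simp: neg)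
    qed
  qed
  \<comment> \<open>The gap is below \<open>f y\<close>, and \<open>f y \<le> \<sigma> d2\<close>;
    hence \<open>\<sigma> d1 > 0\<close>. This persists on the open set \<open>U\<close>, where
    every extension \<open>g\<close> of \<open>\<rho>\<close> has
    \<open>g y \<ge> \<rho> d1 > 0\<close>.\<close>
  obtain d1 d2 where d: "d1 \<in> D" "star d1 = d1" "d2 \<in> D" "star d2 = d2"
    "positive (y - d1)" "positive (d2 - y)" "Re (\<sigma> d2) - Re (\<sigma> d1) < Re (f y)"
    by (rule extension_property_sandwich[OF EP s y(1,2)])
  have mono: "Re (g a) \<le> Re (g b)" if "g \<in> states UNIV" "positive (b - a)" for g a b
    using state_positive[OF cstar_subalgebra_UNIV UNIV_I that(1) UNIV_I that(2)]
      functionals_diff(2)[OF cstar_subalgebra_UNIV statesD(1)[OF that(1)], of b a]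
    by (simp add: less_eq_complex_def)
  define U where "U = {\<rho> \<in> characters D. 0 < Re (\<rho> d1)}"
  have "openin (character_space D) U" unfolding U_def using d(1) by (rule openin_character_Re[OF D])
  moreover have "\<sigma> \<in> U"
    using mono[OF f(1) d(6)] f(2)[OF d(3)] d(7) s by (simp add: U_def)
  moreover have "beta D v \<rho> = Some \<rho>" if r: "\<rho> \<in> U" for \<rho>
  proof -
    have rc: "\<rho> \<in> characters D" "0 < Re (\<rho> d1)" using r by (auto simp: U_def)
    obtain g where g: "g \<in> states UNIV" "\<And>d. d \<in> D \<Longrightarrow> g d = \<rho> d"
      using character_extend[OF D rc(1)] by metis
    have "0 < Re (g y)" using mono[OF g(1) d(5)] g(2)[OF d(1)] rc(2) by simp
    then have "g v \<noteq> 0" using y(3) g(1) by blast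
    then show ?thesis using beta_fixed_of_state[OF rc(1) g v] by blast
  qed
  ultimately show "\<exists>U. openin (character_space D) U \<and> \<sigma> \<in> U \<and> (\<forall>\<rho>\<in>U. beta D v \<rho> = Some \<rho>)" by blast
qed

lemma inclusion_insert:
  assumes x: "star x = x" "\<And>d. d \<in> D \<Longrightarrow> x * d = d * x"
  obtains E where "inclusion E" "D \<subseteq> E" "x \<in> E"
proof -
  have "inclusion (commutant (commutant (insert x D)))" "insert x D \<subseteq> commutant (commutant (insert x D))"
    by (rule inclusion_bicommutant; use x mem inclusionD(3)[OF D] in auto)+
  then show ?thesis using that by blast
qed

text \<open>\<open>L\<close> consists of the positive weights \<open>g\<close> in \<open>D\<close>
  for which \<open>g * x\<close> is within \<open>\<epsilon> g\<close> of an element of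
  \<open>D\<close>. It is closed under sums and under multiplication by positive elements of
  \<open>D\<close>. If it contains \<open>1 + p\<close> with \<open>p\<close> positive, division
  puts \<open>x\<close> within \<open>\<epsilon>\<close> of \<open>D\<close>. Otherwise
  \<open>P - L\<close> is a proper preordering; its character is nonpositive on \<open>L\<close>,
  yet the sandwich at that character yields a weight in \<open>L\<close> with a positive value
  there.\<close>

lemma extension_property_commutant_selfadjoint:
  assumes EP: "extension_property D" and x: "star x = x" "\<And>d. d \<in> D \<Longrightarrow> x * d = d * x"
  shows "x \<in> D"
proof -
  \<comment> \<open>Products of positive elements are controlled inside an abelian algebra, and
    \<open>x\<close> is not yet known to be in \<open>D\<close>.\<close>
  obtain E where E: "inclusion E" "D \<subseteq> E" "x \<in> E" using inclusion_insert[OF x] .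
  note memE = mem_inclusion[OF E(1)]
  have approx: "\<exists>y\<in>D. norm (x - y) \<le> \<epsilon>" if eps: "0 < \<epsilon>" for \<epsilon>
  proof -
    define P where "P = {p \<in> D. positive p}"
    have P: "0 \<in> P" "1 \<in> P" "p \<in> P \<Longrightarrow> q \<in> P \<Longrightarrow> p + q \<in> P" "p \<in> P \<Longrightarrow> q \<in> P \<Longrightarrow> p * q \<in> P" for p q
      using mem positive_add positive_mult[OF D] by (auto simp: P_def)
    define L where "L = {g \<in> P. \<exists>d\<in>D. positive (\<epsilon> *\<^sub>R g - (g * x - d)) \<and> positive (\<epsilon> *\<^sub>R g + (g * x - d))}"
    have LP: "g \<in> P" if "g \<in> L" for g using that by (simp add: L_def)
    have LI: "g \<in> L" if "g \<in> P" "d \<in> D" "positive (\<epsilon> *\<^sub>R g - (g * x - d))"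
      "positive (\<epsilon> *\<^sub>R g + (g * x - d))" for g d
      using that by (auto simp: L_def)
    have L0: "0 \<in> L" by (rule LI[of _ 0]) (use P(1) mem in auto)
    have Ladd: "g + h \<in> L" if gh: "g \<in> L" "h \<in> L" for g h
    proof -
      obtain a b where ab: "a \<in> D" "b \<in> D"
        "positive (\<epsilon> *\<^sub>R g - (g * x - a))" "positive (\<epsilon> *\<^sub>R g + (g * x - a))"
        "positive (\<epsilon> *\<^sub>R h - (h * x - b))" "positive (\<epsilon> *\<^sub>R h + (h * x - b))"
        using gh by (auto simp: L_def)
      have "positive (\<epsilon> *\<^sub>R (g + h) - ((g + h) * x - (a + b)))"
        using positive_add[OF ab(3,5)] by (simp add: algebra_simps)
      moreover have "positive (\<epsilon> *\<^sub>R (g + h) + ((g + h) * x - (a + b)))"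
        using positive_add[OF ab(4,6)] by (simp add: algebra_simps)
      ultimately show ?thesis by (rule LI[OF P(3)[OF LP[OF gh(1)] LP[OF gh(2)]] mem(2)[OF ab(1,2)]])
    qed
    have Lmult: "p * g \<in> L" if p: "p \<in> P" and g: "g \<in> L" for p g
    proof -
      obtain a where a: "a \<in> D" "positive (\<epsilon> *\<^sub>R g - (g * x - a))" "positive (\<epsilon> *\<^sub>R g + (g * x - a))"
        using g by (auto simp: L_def)
      have pE: "p \<in> E" "positive p" using p E(2) by (auto simp: P_def)
      have gE: "g \<in> E" "a \<in> E" using LP[OF g] a E(2) by (auto simp: P_def)
      have "positive (p * (\<epsilon> *\<^sub>R g - (g * x - a)))" "positive (p * (\<epsilon> *\<^sub>R g + (g * x - a)))"
        using a pE gE E(3) memE by (auto intro!: positive_mult[OF E(1)])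
      then have "positive (\<epsilon> *\<^sub>R (p * g) - (p * g * x - p * a))"
        "positive (\<epsilon> *\<^sub>R (p * g) + (p * g * x - p * a))"
        by (simp_all add: algebra_simps)
      moreover have "p * a \<in> D" using p a mem by (auto simp: P_def)
      ultimately show ?thesis using LI[OF P(4)[OF p LP[OF g]]] by blast
    qed
    define T where "T = {p - g | p g. p \<in> P \<and> g \<in> L}"
    have TI: "p - g \<in> T" if "p \<in> P" "g \<in> L" for p g using that by (auto simp: T_def)
    have "\<exists>p\<in>P. \<exists>g\<in>L. - 1 = p - g"
    proof (rule ccontr)
      assume no: "\<not> ?thesis"
      have "preordering D T"
        unfolding preordering_def
      proof (intro conjI ballI impI)
        fix a assume "a \<in> T"
        then obtain p g where a: "a = p - g" "p \<in> P" "g \<in> P" using LP by (auto simp: T_def)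
        then show "a \<in> D" using mem by (auto simp: P_def)
        show "star a = a" using a positive_star[of p] positive_star[of g] by (simp add: P_def)
      next
        fix a assume "a \<in> D" "positive a"
        then show "a \<in> T" using TI[OF _ L0, of a] by (simp add: P_def)
      next
        fix a b assume "a \<in> T" "b \<in> T"
        then obtain p g q h where a: "a = p - g" "p \<in> P" "g \<in> L" and b: "b = q - h" "q \<in> P" "h \<in> L"
          by (auto simp: T_def)
        have "a + b = (p + q) - (g + h)" by (simp add: a b)
        then show "a + b \<in> T" using TI[OF P(3)[OF a(2) b(2)] Ladd[OF a(3) b(3)]] by simp
        have "g * q = q * g"
          using LP[OF a(3)] b(2) by (intro inclusionD(3)[OF D]) (auto simp: P_def)
        then have "a * b = (p * q + g * h) - (p * h + q * g)" by (simp add: a b algebra_simps)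
        then show "a * b \<in> T"
          using TI[OF P(3)[OF P(4)[OF a(2) b(2)] P(4)[OF LP[OF a(3)] LP[OF b(3)]]]
            Ladd[OF Lmult[OF a(2) b(3)] Lmult[OF b(2) a(3)]]] by simp
      next
        show "- 1 \<notin> T" using no by (auto simp: T_def)
      qed
      then obtain \<rho> where r: "\<rho> \<in> characters D" "\<And>a. a \<in> T \<Longrightarrow> 0 \<le> \<rho> a"
        by (rule character_of_preordering[OF D]) blast
      obtain d1 d2 where d: "d1 \<in> D" "star d1 = d1" "d2 \<in> D" "star d2 = d2"
        "positive (x - d1)" "positive (d2 - x)" "Re (\<rho> d2) - Re (\<rho> d1) < \<epsilon>"
        by (rule extension_property_sandwich[OF EP r(1) x(1) eps])
      \<comment> \<open>Positive where the sandwich is narrower than \<open>\<epsilon>\<close>. Its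
        positive part \<open>g\<close> is the local weight, and \<open>g * d1\<close> approximates
        \<open>g * x\<close>.\<close>
      define k where "k = of_real \<epsilon> - (d2 - d1)"
      have k: "k \<in> D" "star k = k" using d mem by (auto simp: k_def)
      obtain g where g: "g \<in> D" "positive g"
        "\<And>\<rho>. \<rho> \<in> characters D \<Longrightarrow> \<rho> g = complex_of_real (max 0 (Re (\<rho> k)))"
        using positive_part[OF D k] by metis
      have gk: "positive (g * k)"
      proof (rule positive_of_characters[OF D])
        show "g * k \<in> D" using g k mem by auto
        show "star (g * k) = g * k"
          using g(1) k positive_star[OF g(2)] inclusionD(3)[OF D g(1) k(1)] by simp
        show "0 \<le> \<tau> (g * k)" if t: "\<tau> \<in> characters D" for \<tau>
        proof -
          have "\<tau> (g * k) = complex_of_real (max 0 (Re (\<tau> k)) * Re (\<tau> k))"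
            using charactersD(5)[OF t g(1) k(1)] g(3)[OF t] character_selfadjoint[OF D t k]
            by (metis of_real_mult)
          moreover have "0 \<le> max 0 (Re (\<tau> k)) * Re (\<tau> k)" by (simp add: max_def)
          ultimately show ?thesis by (simp add: less_eq_complex_def)
        qed
      qed
      have gE: "g \<in> E" "d1 \<in> E" "d2 \<in> E" using g d E(2) by auto
      have g1: "positive (g * (x - d1))" "positive (g * (d2 - x))"
        using gE E(3) g(2) d memE by (auto intro!: positive_mult[OF E(1)])
      have "positive (\<epsilon> *\<^sub>R g - (g * x - g * d1))"
        using positive_add[OF gk g1(2)] by (simp add: k_def of_real_def algebra_simps)
      moreover have "positive (\<epsilon> *\<^sub>R g + (g * x - g * d1))"
        using positive_add[OF positive_scaleR[OF g(2)] g1(1), of \<epsilon>] eps by (simp add: algebra_simps)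
      moreover have "g \<in> P" "g * d1 \<in> D" using g d mem by (auto simp: P_def)
      ultimately have "g \<in> L" using LI by blast
      then have "0 \<le> \<rho> (0 - g)" using r(2) TI[OF P(1)] by blast
      then have "Re (\<rho> g) \<le> 0" using character_diff(2)[OF D r(1) g(1) g(1)] by (simp add: less_eq_complex_def)
      moreover have "0 < Re (\<rho> k)"
        using d(1,3,7) mem by (simp add: k_def character_diff[OF D r(1)] character_of_real[OF D r(1)])
      ultimately show False using g(3)[OF r(1)] by simp
    qed
    then obtain p g where pg: "p \<in> P" "g \<in> L" "- 1 = p - g" by blast
    have g: "g = 1 + p" using pg(3) by (simp add: algebra_simps)
    obtain d where d: "d \<in> D" "positive (\<epsilon> *\<^sub>R g - (g * x - d))" "positive (\<epsilon> *\<^sub>R g + (g * x - d))"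
      using pg(2) by (auto simp: L_def)
    have pD: "p \<in> D" "positive p" using pg by (auto simp: P_def)
    obtain q where q: "q \<in> D" "g * q = 1" "q * g = 1"
      using positive_invertible[OF pD(2) zero_less_one inclusionD(1,2)[OF D] pD(1)] by (auto simp: g)
    have gs: "star g = g" using pD positive_star by (simp add: g)
    have "star q * g = 1" using arg_cong[OF q(2), of star] gs by simp
    then have "star q = q" using q(2) by (metis mult.assoc mult.right_neutral mult_1)
    \<comment> \<open>The inverse is positive because \<open>q = star q * g * q\<close>.\<close>
    have qp: "positive q"
    proof -
      have "positive g" unfolding g by (intro positive_add pD) simp
      then have "positive (star q * g * q)" using positive_conjugate positive_star_mult by blast
      then show ?thesis using \<open>star q * g = 1\<close> by simp
    qed
    have inE: "q \<in> E" "g \<in> E" "d \<in> E" using q d pD mem E(2) by (auto simp: g)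
    have "positive (q * (\<epsilon> *\<^sub>R g - (g * x - d)))" "positive (q * (\<epsilon> *\<^sub>R g + (g * x - d)))"
      using d qp inE E(3) memE by (auto intro!: positive_mult[OF E(1)])
    moreover have "q * (\<epsilon> *\<^sub>R g - (g * x - d)) = of_real \<epsilon> - (x - q * d)"
      "q * (\<epsilon> *\<^sub>R g + (g * x - d)) = of_real \<epsilon> + (x - q * d)"
      using q(3) by (simp_all add: of_real_def algebra_simps flip: mult.assoc)
    ultimately have "norm (x - q * d) \<le> \<epsilon>" using eps by (intro norm_le_of_positive) auto
    then show ?thesis using q d mem by blast
  qed
  have "x \<in> closure D"
    unfolding closure_approachable
  proof (intro allI impI)
    fix e :: real assume "0 < e"
    then obtain y where "y \<in> D" "norm (x - y) \<le> e/2" using approx[of "e/2"] by auto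
    then show "\<exists>y\<in>D. dist y x < e"
      using \<open>0 < e\<close> by (intro bexI[of _ y]) (auto simp: dist_norm norm_minus_commute)
  qed
  then show ?thesis using cstar_subalgebraD(6)[OF inclusionD(1)[OF D]] by (simp add: closure_closed)
qed

lemma extension_property_MASA:
  assumes EP: "extension_property D" shows "is_MASA D"
  unfolding is_MASA_def
proof (intro conjI allI impI)
  show "abelian_cstar_subalgebra D" using D by (simp add: inclusion_def)
  fix E assume E: "abelian_cstar_subalgebra E \<and> D \<subseteq> E"
  have "x \<in> D" if x: "x \<in> E" for x
  proof -
    have "re_part x \<in> E" "im_part x \<in> E"
      using E x by (auto simp: abelian_cstar_subalgebra_def intro: cstar_subalgebra_re_im)
    moreover have "a * d = d * a" if "a \<in> E" "d \<in> D" for a d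
      using that E by (auto simp: abelian_cstar_subalgebra_def)
    ultimately have "re_part x \<in> D" "im_part x \<in> D"
      using extension_property_commutant_selfadjoint[OF EP] by auto
    then have "re_part x + scaleC \<i> (im_part x) \<in> D" using mem by blast
    then show ?thesis by (simp flip: cartesian)
  qed
  then show "E = D" using E by blast
qed

section \<open>From a locally trivial action and a MASA to the extension property\<close>

lemma MASA_commutant:
  assumes M: "is_MASA D" and x: "\<And>d. d \<in> D \<Longrightarrow> x * d = d * x"
  shows "x \<in> D"
proof -
  \<comment> \<open>\<open>x\<close> is not known to be normal, so it may lie in no abelian
    subalgebra closed under \<open>star\<close>; its real and imaginary parts commute with
    \<open>D\<close> as well and are treated one at a time.\<close>
  have sa: "y \<in> D" if y: "star y = y" "\<And>d. d \<in> D \<Longrightarrow> y * d = d * y" for y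
  proof -
    obtain E where "inclusion E" "D \<subseteq> E" "y \<in> E" using inclusion_insert[OF y] .
    then show ?thesis using M by (auto simp: is_MASA_def inclusion_def)
  qed
  have A: "cstar_subalgebra (commutant D)" using mem by (intro commutant_subalgebra)
  have "x \<in> commutant D" using x by (simp add: commutant_def)
  then have "re_part x \<in> commutant D" "im_part x \<in> commutant D"
    using cstar_subalgebra_re_im[OF A] by auto
  then have "re_part x \<in> D" "im_part x \<in> D" using sa by (auto simp: commutant_def)
  then have "re_part x + scaleC \<i> (im_part x) \<in> D" using mem by blast
  then show ?thesis by (simp flip: cartesian)
qed

text \<open>For the commutator \<open>w\<close> of \<open>v * d\<close> with \<open>e\<close>,
  \<open>star w * w\<close> lies in \<open>D\<close> because \<open>v\<close> is a normalizer, so it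
  can be tested at characters. Where \<open>\<rho> d \<noteq> 0\<close>, \<open>\<rho>\<close> is
  fixed and \<open>\<rho> (star v * c * v) = \<rho> c * \<rho> (star v * v)\<close>, so the four
  terms cancel; elsewhere each contains the factor \<open>\<rho> d = 0\<close>.\<close>

lemma normalizer_times_bump:
  assumes M: "is_MASA D" and v: "v \<in> normalizers D" and d: "d \<in> D" "star d = d"
    and loc: "\<And>\<rho>. \<rho> \<in> characters D \<Longrightarrow> \<rho> d \<noteq> 0 \<Longrightarrow> beta D v \<rho> = Some \<rho>"
  shows "v * d \<in> D"
proof (rule MASA_commutant[OF M])
  fix e assume e: "e \<in> D"
  define w where "w = v * d * e - e * (v * d)"
  have se: "star e \<in> D" using e mem by simp
  note N = normalizersD(1)[OF D v] normalizersD(5)[OF D v]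
  define a1 a2 a3 a4 where "a1 = star e * d * (star v * v) * (d * e)"
    and "a2 = star e * d * (star v * e * v) * d"
    and "a3 = d * (star v * star e * v) * (d * e)"
    and "a4 = d * (star v * (star e * e) * v) * d"
  have aD: "a1 \<in> D" "a2 \<in> D" "a3 \<in> D" "a4 \<in> D"
    using N e d(1) se mem by (simp_all add: a1_def a2_def a3_def a4_def)
  have ww: "star w * w = (a1 - a2) - (a3 - a4)"
    by (simp add: w_def a1_def a2_def a3_def a4_def d(2) algebra_simps)
  have "star w * w = 0"
  proof (rule zero_of_characters[OF D])
    show "star w * w \<in> D" unfolding ww using aD mem by simp
    fix \<rho> assume r: "\<rho> \<in> characters D"
    have rw: "\<rho> (star w * w) = (\<rho> a1 - \<rho> a2) - (\<rho> a3 - \<rho> a4)"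
      unfolding ww using aD mem by (simp add: character_diff[OF D r])
    have ra: "\<rho> a1 = \<rho> (star e) * \<rho> d * \<rho> (star v * v) * (\<rho> d * \<rho> e)"
      "\<rho> a2 = \<rho> (star e) * \<rho> d * \<rho> (star v * e * v) * \<rho> d"
      "\<rho> a3 = \<rho> d * \<rho> (star v * star e * v) * (\<rho> d * \<rho> e)"
      "\<rho> a4 = \<rho> d * \<rho> (star v * (star e * e) * v) * \<rho> d"
      using N e d(1) se mem unfolding a1_def a2_def a3_def a4_def
      by (simp_all add: charactersD(5)[OF r])
    show "\<rho> (star w * w) = 0"
    proof (cases "\<rho> d = 0")
      case False
      then have b: "0 < \<rho> (star v * v)" "\<rho> = (\<lambda>d\<in>D. \<rho> (star v * d * v) / \<rho> (star v * v))"
        using loc[OF r] by (auto simp: beta_Some_iff[OF D])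
      have val: "\<rho> (star v * c * v) = \<rho> c * \<rho> (star v * v)" if "c \<in> D" for c
        using fun_cong[OF b(2), of c] that b(1) by auto
      have "\<rho> (star e * e) = \<rho> (star e) * \<rho> e" using charactersD(5)[OF r se e] .
      then show ?thesis
        using val[OF e] val[OF se] val[of "star e * e"] e se mem by (simp add: rw ra)
    qed (simp add: rw ra)
  qed
  then have "w = 0" using cstar_identity[of w] by simp
  then show "v * d * e = e * (v * d)" by (simp add: w_def)
qed

lemma extension_property_of_MASA:
  assumes reg: "closure (cspan (normalizers D)) = UNIV"
    and M: "is_MASA D" and loc: "locally_trivial D"
  shows "extension_property D"
  unfolding extension_property_iff[OF D]
proof (intro ballI allI impI)
  fix \<rho> f g assume r: "\<rho> \<in> characters D" and fg: "f \<in> states UNIV" "g \<in> states UNIV"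
    and ext: "\<forall>d\<in>D. f d = \<rho> d" "\<forall>d\<in>D. g d = \<rho> d"
  have norm: "f v = g v" if v: "v \<in> normalizers D" for v
  proof (cases "beta D v \<rho> = Some \<rho>")
    case False
    then have "f v = 0" "g v = 0" using beta_fixed_of_state[OF r _ _ v] fg ext by blast+
    then show ?thesis by simp
  next
    case True
    then obtain U where U: "openin (character_space D) U" "\<rho> \<in> U" "\<forall>\<tau>\<in>U. beta D v \<tau> = Some \<tau>"
      using loc v unfolding locally_trivial_def by blast
    obtain d where d: "d \<in> D" "star d = d" "\<rho> d \<noteq> 0"
      "\<And>\<tau>. \<tau> \<in> characters D \<Longrightarrow> \<tau> d \<noteq> 0 \<Longrightarrow> \<tau> \<in> U"
      using character_Urysohn[OF D U(1,2)] by metis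
    have "v * d \<in> D" using U(3) d(4) by (intro normalizer_times_bump[OF M v d(1,2)]) blast
    then have "f (v * d) = g (v * d)" using ext by simp
    \<comment> \<open>\<open>D\<close> is in the multiplicative domain of both states, so the
      nonzero \<open>\<rho> d\<close> can be divided out.\<close>
    moreover have "f (v * d) = f v * \<rho> d" "g (v * d) = g v * \<rho> d"
      using state_character_mult(2)[OF D r _ _ d(1)] fg ext by blast+
    ultimately show ?thesis using d(3) by simp
  qed
  note lin = functionalsD[OF statesD(1)[OF fg(1)]] functionalsD[OF statesD(1)[OF fg(2)]]
  have span: "f x = g x" if "x \<in> cspan (normalizers D)" for x
    using that unfolding cspan_def
  proof (induction rule: cvec.span_induct_alt)
    case base
    show ?case
      using functionals_diff(3)[OF cstar_subalgebra_UNIV statesD(1)[OF fg(1)], of 0]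
        functionals_diff(3)[OF cstar_subalgebra_UNIV statesD(1)[OF fg(2)], of 0] by simp
  next
    case (step c x y)
    then show ?case using norm by (simp add: lin)
  qed
  show "f = g"
  proof
    fix x
    have "cmod (f x - g x) \<le> e" if e: "0 < e" for e
    proof -
      have "x \<in> closure (cspan (normalizers D))" using reg by simp
      then obtain y where y: "y \<in> cspan (normalizers D)" "norm (x - y) < e/2"
        using e unfolding closure_approachable by (metis dist_norm dist_commute half_gt_zero)
      have "f x - g x = f (x - y) - g (x - y)"
        using span[OF y(1)]
          functionals_diff(2)[OF cstar_subalgebra_UNIV statesD(1)[OF fg(1)], of x y]
          functionals_diff(2)[OF cstar_subalgebra_UNIV statesD(1)[OF fg(2)], of x y] by simp
      also have "cmod \<dots> \<le> norm (x - y) + norm (x - y)"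
        using fg by (intro order_trans[OF norm_triangle_ineq4] add_mono
            state_norm_le[OF cstar_subalgebra_UNIV]) auto
      finally show ?thesis using y by simp
    qed
    then have "cmod (f x - g x) \<le> 0" using field_le_epsilon[of "cmod (f x - g x)" 0] by simp
    then show "f x = g x" by simp
  qed
qed

section \<open>Quasi-freeness and trivial isotropy as local triviality\<close>

lemma quasi_free_iff:
  "quasi_free_action (normalizers D) (character_space D) (beta D) \<longleftrightarrow> locally_trivial D"
proof -
  have "openin (character_space D) {\<rho> \<in> dom (beta D v). beta D v \<rho> = Some \<rho>} \<longleftrightarrow>
      (\<forall>\<sigma>. beta D v \<sigma> = Some \<sigma> \<longrightarrow>
        (\<exists>U. openin (character_space D) U \<and> \<sigma> \<in> U \<and> (\<forall>\<rho>\<in>U. beta D v \<rho> = Some \<rho>)))" for v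
  proof -
    have "{\<rho> \<in> dom (beta D v). beta D v \<rho> = Some \<rho>} = {\<rho>. beta D v \<rho> = Some \<rho>}" by auto
    then show ?thesis
      using openin_subopen[of "character_space D" "{\<rho>. beta D v \<rho> = Some \<rho>}"]
      by (simp only: subset_eq mem_Collect_eq Ball_def)
  qed
  then show ?thesis
    unfolding quasi_free_action_def locally_trivial_def using beta_semigroup_action[OF D] by simp
qed

lemma trivial_weyl_isotropy_iff:
  "(\<forall>\<sigma>\<in>characters D. trivial_group (isotropy_group (weyl_groupoid D) \<sigma>)) \<longleftrightarrow> locally_trivial D"
proof -
  have "trivial_group (isotropy_group (weyl_groupoid D) \<sigma>) \<longleftrightarrow>
      (\<forall>\<phi>\<in>beta D ` normalizers D. \<phi> \<sigma> = Some \<sigma> \<longrightarrow>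
        (\<exists>U. openin (character_space D) U \<and> \<sigma> \<in> U \<and> (\<forall>z\<in>U. \<phi> z = Some z)))"
    if s: "\<sigma> \<in> characters D" for \<sigma>
    unfolding weyl_groupoid_def
  proof (rule trivial_isotropy_iff)
    show "(\<lambda>y. if y \<in> topspace (character_space D) then Some y else None) \<in> beta D ` normalizers D"
      using beta_one[OF D] normalizers_one[OF D] by (metis imageI)
    show "\<phi> \<circ>\<^sub>m \<psi> \<in> beta D ` normalizers D"
      if "\<phi> \<in> beta D ` normalizers D" "\<psi> \<in> beta D ` normalizers D" for \<phi> \<psi>
      using that beta_mult[OF D] normalizers_mult[OF D] by (auto simp flip: beta_mult[OF D])
    show "openin (character_space D) (dom \<phi>)" if "\<phi> \<in> beta D ` normalizers D" for \<phi>
      using that openin_dom_beta[OF D] by auto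
    show "\<sigma> \<in> topspace (character_space D)" using s by (simp add: topspace_character_space[OF D])
  qed
  then show ?thesis
    unfolding locally_trivial_def by (auto simp: beta_Some_iff[OF D])
qed

end

theorem theorem2p9:
  fixes D :: "'a::cstar_algebra set"
  assumes "regular_inclusion D"
  shows "(extension_property D \<longleftrightarrow>
            is_MASA D \<and> quasi_free_action (normalizers D) (character_space D) (beta D)) \<and>
         (extension_property D \<longleftrightarrow>
            is_MASA D \<and>
            (\<forall>\<sigma>\<in>characters D. trivial_group (isotropy_group (weyl_groupoid D) \<sigma>)))"
proof -
  have D: "inclusion D" and reg: "closure (cspan (normalizers D)) = UNIV"
    using assms by (auto simp: regular_inclusion_def)
  have "extension_property D \<longleftrightarrow> is_MASA D \<and> locally_trivial D"
    using extension_property_MASA[OF D] extension_property_locally_trivial[OF D]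
      extension_property_of_MASA[OF D reg] by blast
  then show ?thesis by (simp add: quasi_free_iff[OF D] trivial_weyl_isotropy_iff[OF D])
qed

end
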